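(* Let $(H,K,\rightharpoonup,\leftharpoonup)$ be a matched pair of Hopf algebras whose double cross product $K\bowtie H$ has a projection $\theta$ onto $H$, i.e. $\theta:K\bowtie H\to H$ is a Hopf algebra homomorphism with $\theta\iota_H=\mathrm{id}_H$. Let $\pi=\theta\iota_K:K\to H$. Then $K_\pi=(K,\bullet_\pi,1_K,\Delta_K,\varepsilon_K,S_\pi)$, where $$a\bullet_\pi b=a_1(\pi(S_K(a_2))\rightharpoonup b),\qquad S_\pi(a)=\pi(a_1)\rightharpoonup S_K(a_2),\qquad \forall a,b\in K,$$ is a braided Hopf algebra in the category ${}^H_H\mathcal{YD}$ of Yetter-Drinfeld modules over $H$, where $H$ acts on $K_\pi$ via $\rightharpoonup$ and coacts on it via $$\mathrm{Coad}_\pi:K\to H\otimes K,\quad a\mapsto \pi(a_1S_K(a_3))\otimes a_2.$$ Moreover, the map $$\beta:K\bowtie H\to K_\pi\#_\rightharpoonup H,\qquad a\otimes x\mapsto a_1\otimes\pi(a_2)x$$ is a Hopf algebra isomorphism, where $K_\pi\#_\rightharpoonup H$ is the biproduct (bosonization) of $K_\pi$ by $H$.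
   Context: Everything is over a fixed arbitrary field $\mathbf{k}$; Sweedler notation $\Delta(x)=x_1\otimes x_2$, $\Delta^{(2)}(x)=x_1\otimes x_2\otimes x_3$; $S_H,S_K$ are antipodes. A matched pair of Hopf algebras $(H,K,\rightharpoonup,\leftharpoonup)$ consists of Hopf algebras $H,K$, a left $H$-module coalgebra action $\rightharpoonup:H\otimes K\to K$ on $K$ and a right $K$-module coalgebra action $\leftharpoonup:H\otimes K\to H$ on $H$ (so both maps are module actions and coalgebra maps) such that for all $x,y\in H$, $a,b\in K$: $x\rightharpoonup ab=(x_1\rightharpoonup a_1)((x_2\leftharpoonup a_2)\rightharpoonup b)$; $x\rightharpoonup 1_K=\varepsilon_H(x)1_K$; $xy\leftharpoonup a=(x\leftharpoonup(y_1\rightharpoonup a_1))(y_2\leftharpoonup a_2)$; $1_H\leftharpoonup a=\varepsilon_K(a)1_H$; $(x_1\rightharpoonup a_1)\otimes(x_2\leftharpoonup a_2)=(x_2\rightharpoonup a_2)\otimes(x_1\leftharpoonup a_1)$. The double cross product $K\bowtie H$ is the Hopf algebra on $K\otimes H$ with product $(a\otimes x)(b\otimes y)=a(x_1\rightharpoonup b_1)\otimes(x_2\leftharpoonup b_2)y$, unit $1_K\otimes 1_H$, the tensor product coalgebra structure, and antipode $a\otimes x\mapsto (1\otimes S_H(x))(S_K(a)\otimes 1)$. The inclusions are $\iota_K:K\to K\bowtie H$, $a\mapsto a\otimes 1_H$, and $\iota_H:H\to K\bowtie H$, $x\mapsto 1_K\otimes x$. A (left-left) Yetter-Drinfeld module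 over $H$ is a left $H$-module $(M,\cdot)$ that is also a left $H$-comodule with coaction $\rho(m)=m_{-1}\otimes m_0\in H\otimes M$, such that $\rho(x\cdot m)=x_1m_{-1}S_H(x_3)\otimes(x_2\cdot m_0)$. Morphisms are $H$-linear and $H$-colinear maps. Tensor products carry $x\cdot(m\otimes n)=(x_1\cdot m)\otimes(x_2\cdot n)$ and $\rho(m\otimes n)=m_{-1}n_{-1}\otimes(m_0\otimes n_0)$; the (pre-)braiding is $c_{M,N}(m\otimes n)=(m_{-1}\cdot n)\otimes m_0$. A braided Hopf algebra $L$ in ${}^H_H\mathcal{YD}$ is an object that is a unital algebra and a counital coalgebra whose structure maps (product, unit, coproduct, counit, antipode) are morphisms in ${}^H_H\mathcal{YD}$, with $\varepsilon_L$ an algebra map, $\Delta_L(1)=1\otimes 1$, $\Delta_L(ab)=a_1((a_2)_{-1}\cdot b_1)\otimes(a_2)_0b_2$, and with antipode $S_L$ the convolution inverse of $\mathrm{id}_L$. The biproduct $B\#H$ of a braided Hopf algebra $B$ in ${}^H_H\mathcal{YD}$ by $H$ is the Hopf algebra on $B\otimes H$ with product $(a\otimes x)(b\otimes y)=a(x_1\cdot b)\otimes x_2y$, coproduct $\Delta(a\otimes x)=(a^1\otimes(a^2)_{-1}x_1)\otimes((a^2)_0\otimes x_2)$, where $\Delta_B(a)=a^1\otimes a^2$, and the trivial (tensor) unit and counit. The subscript $\rightharpoonup$ in $K_\pi\#_\rightharpoonup H$ indicates the action used. *)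

theory Defs
  imports Complex_Main "HOL-Library.Function_Algebras"
begin

section \<open>Vector spaces and tensor products over a field\<close>

text \<open>
  A vector space is a linear subspace \<open>vcarr V\<close> of an ambient vector space, which is a whole
  type with scalar multiplication \<open>vscale V\<close>. Addition is that of the ambient type.
\<close>

record ('k, 'v) vspace =
  vcarr :: "'v set"
  vscale :: "'k \<Rightarrow> 'v \<Rightarrow> 'v"

definition kspace :: "('k::field, 'v::ab_group_add, 'z) vspace_scheme \<Rightarrow> bool" where
  "kspace V \<longleftrightarrow> vector_space (vscale V) \<and> module.subspace (vscale V) (vcarr V)"

definition base_field :: "('k::field, 'k) vspace" where
  "base_field = \<lparr>vcarr = UNIV, vscale = (*)\<rparr>"

definition linear_map ::
  "('k::field, 'v::ab_group_add, 'y) vspace_scheme \<Rightarrow> ('k, 'w::ab_group_add, 'z) vspace_scheme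
    \<Rightarrow> ('v \<Rightarrow> 'w) \<Rightarrow> bool" where
  "linear_map V W f \<longleftrightarrow>
     (\<forall>v\<in>vcarr V. f v \<in> vcarr W) \<and>
     (\<forall>u\<in>vcarr V. \<forall>v\<in>vcarr V. f (u + v) = f u + f v) \<and>
     (\<forall>c. \<forall>v\<in>vcarr V. f (vscale V c v) = vscale W c (f v))"

definition bilinear_map ::
  "('k::field, 'v::ab_group_add, 'x) vspace_scheme \<Rightarrow> ('k, 'w::ab_group_add, 'y) vspace_scheme
    \<Rightarrow> ('k, 'u::ab_group_add, 'z) vspace_scheme \<Rightarrow> ('v \<Rightarrow> 'w \<Rightarrow> 'u) \<Rightarrow> bool" where
  "bilinear_map V W U f \<longleftrightarrow>
     (\<forall>v\<in>vcarr V. linear_map W U (f v)) \<and>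
     (\<forall>w\<in>vcarr W. linear_map V U (\<lambda>v. f v w))"

text \<open>
  The tensor product of \<open>V\<close> and \<open>W\<close> is realised inside the dual of the space of bilinear forms
  on \<open>V \<times> W\<close>: the pure tensor of \<open>v\<close> and \<open>w\<close> is evaluation at \<open>(v, w)\<close>, and the tensor
  product is the linear span of the pure tensors. The universal property is proved below
  (\<open>tlift_linear\<close>, \<open>tlift_pure\<close>, \<open>linear_map_tensor_unique\<close>).
\<close>

type_synonym ('k, 'v, 'w) tensor = "('v \<Rightarrow> 'w \<Rightarrow> 'k) \<Rightarrow> 'k"

definition tpure ::
  "('k::field, 'v::ab_group_add, 'y) vspace_scheme \<Rightarrow> ('k, 'w::ab_group_add, 'z) vspace_scheme
    \<Rightarrow> 'v \<Rightarrow> 'w \<Rightarrow> ('k, 'v, 'w) tensor" where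
  "tpure V W v w = (\<lambda>B. if bilinear_map V W base_field B then B v w else 0)"

abbreviation tpure_notation  ("_ \<otimes>\<^bsub>_,_\<^esub> _" [71, 0, 0, 71] 70) where
  "v \<otimes>\<^bsub>V,W\<^esub> w \<equiv> tpure V W v w"

definition tscale :: "'k::field \<Rightarrow> ('k, 'v, 'w) tensor \<Rightarrow> ('k, 'v, 'w) tensor" where
  "tscale c t = (\<lambda>B. c * t B)"

definition tensor ::
  "('k::field, 'v::ab_group_add, 'y) vspace_scheme \<Rightarrow> ('k, 'w::ab_group_add, 'z) vspace_scheme
    \<Rightarrow> ('k, ('k, 'v, 'w) tensor) vspace" where
  "tensor V W =
     \<lparr>vcarr = module.span tscale {v \<otimes>\<^bsub>V,W\<^esub> w | v w. v \<in> vcarr V \<and> w \<in> vcarr W},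
      vscale = tscale\<rparr>"

text \<open>
  \<open>tlift V W t f\<close> is the value at \<open>t\<close> of the linear map on the tensor product induced by a
  bilinear map \<open>f\<close>: write \<open>t\<close> as a sum of pure tensors of \<open>v\<^sub>i\<close> and \<open>w\<^sub>i\<close>, and form
  the sum of the \<open>f v\<^sub>i w\<^sub>i\<close>. The value does not depend on the representation when \<open>f\<close> is
  bilinear, which is the only use made of it. Sweedler notation is expressed through it: an
  expression \<open>f x\<^sub>1 x\<^sub>2\<close> with \<open>\<Delta>(x) = x\<^sub>1 \<otimes> x\<^sub>2\<close> is \<open>tlift C C (\<Delta> x) f\<close>.
\<close>

definition trep ::
  "('k::field, 'v::ab_group_add, 'y) vspace_scheme \<Rightarrow> ('k, 'w::ab_group_add, 'z) vspace_scheme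
    \<Rightarrow> ('k, 'v, 'w) tensor \<Rightarrow> ('v \<times> 'w) list" where
  "trep V W t = (SOME ps. set ps \<subseteq> vcarr V \<times> vcarr W \<and> t = (\<Sum>(v, w)\<leftarrow>ps. v \<otimes>\<^bsub>V,W\<^esub> w))"

definition tlift ::
  "('k::field, 'v::ab_group_add, 'y) vspace_scheme \<Rightarrow> ('k, 'w::ab_group_add, 'z) vspace_scheme
    \<Rightarrow> ('k, 'v, 'w) tensor \<Rightarrow> ('v \<Rightarrow> 'w \<Rightarrow> 'u::ab_group_add) \<Rightarrow> 'u" where
  "tlift V W t f = (\<Sum>(v, w)\<leftarrow>trep V W t. f v w)"


subsection \<open>The universal property\<close>

lemma vector_space_tscale: "vector_space (tscale :: 'k::field \<Rightarrow> _)"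
  by unfold_locales (auto simp: tscale_def fun_eq_iff algebra_simps)

lemma module_tscale: "module (tscale :: 'k::field \<Rightarrow> _)"
  by unfold_locales (auto simp: tscale_def fun_eq_iff algebra_simps)

lemma kspace_base_field: "kspace base_field"
  unfolding kspace_def base_field_def
  by (auto simp: vector_space_def module.subspace_UNIV algebra_simps module_def)

lemma kspace_tensor: "kspace (tensor V W)"
  by (simp add: kspace_def tensor_def vector_space_tscale module.subspace_span module_tscale)

lemma vscale_tensor [simp]: "vscale (tensor V W) = tscale"
  by (simp add: tensor_def)

lemma kspaceD:
  assumes "kspace V"
  shows "0 \<in> vcarr V" "\<And>u v. u \<in> vcarr V \<Longrightarrow> v \<in> vcarr V \<Longrightarrow> u + v \<in> vcarr V"
    "\<And>c v. v \<in> vcarr V \<Longrightarrow> vscale V c v \<in> vcarr V"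
proof -
  interpret vector_space "vscale V" using assms by (simp add: kspace_def)
  have "subspace (vcarr V)" using assms by (simp add: kspace_def)
  then show "0 \<in> vcarr V" "\<And>u v. u \<in> vcarr V \<Longrightarrow> v \<in> vcarr V \<Longrightarrow> u + v \<in> vcarr V"
    "\<And>c v. v \<in> vcarr V \<Longrightarrow> vscale V c v \<in> vcarr V"
    by (auto simp: subspace_def)
qed

lemma tpure_in [simp]:
  "v \<in> vcarr V \<Longrightarrow> w \<in> vcarr W \<Longrightarrow> v \<otimes>\<^bsub>V,W\<^esub> w \<in> vcarr (tensor V W)"
  by (auto simp: tensor_def intro!: module.span_base[OF module_tscale])

lemma bilinear_tpure:
  shows "bilinear_map V W (tensor V W) (tpure V W)"
proof -
  have "(u + v) \<otimes>\<^bsub>V,W\<^esub> w = u \<otimes>\<^bsub>V,W\<^esub> w + v \<otimes>\<^bsub>V,W\<^esub> w"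
    if "u \<in> vcarr V" "v \<in> vcarr V" "w \<in> vcarr W" for u v w
    using that by (auto simp: bilinear_map_def linear_map_def tpure_def fun_eq_iff base_field_def)
  moreover have "v \<otimes>\<^bsub>V,W\<^esub> (u + w) = v \<otimes>\<^bsub>V,W\<^esub> u + v \<otimes>\<^bsub>V,W\<^esub> w"
    if "v \<in> vcarr V" "u \<in> vcarr W" "w \<in> vcarr W" for u v w
    using that by (auto simp: bilinear_map_def linear_map_def tpure_def fun_eq_iff base_field_def)
  moreover have "vscale V c v \<otimes>\<^bsub>V,W\<^esub> w = tscale c (v \<otimes>\<^bsub>V,W\<^esub> w)"
    if "v \<in> vcarr V" "w \<in> vcarr W" for c v w
    using that by (auto simp: bilinear_map_def linear_map_def tpure_def tscale_def fun_eq_iff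
        base_field_def)
  moreover have "v \<otimes>\<^bsub>V,W\<^esub> vscale W c w = tscale c (v \<otimes>\<^bsub>V,W\<^esub> w)"
    if "v \<in> vcarr V" "w \<in> vcarr W" for c v w
    using that by (auto simp: bilinear_map_def linear_map_def tpure_def tscale_def fun_eq_iff
        base_field_def)
  ultimately show ?thesis
    by (simp add: bilinear_map_def linear_map_def)
qed

lemma sum_list_vcarr:
  assumes "kspace U" "\<And>x. x \<in> set xs \<Longrightarrow> f x \<in> vcarr U"
  shows "sum_list (map f xs) \<in> vcarr U"
  using assms(2) by (induction xs) (auto intro: kspaceD[OF assms(1)])

lemma tensor_representation:
  assumes V: "kspace V" and W: "kspace W" and t: "t \<in> vcarr (tensor V W)"
  shows "\<exists>ps. set ps \<subseteq> vcarr V \<times> vcarr W \<and> t = (\<Sum>(v, w)\<leftarrow>ps. v \<otimes>\<^bsub>V,W\<^esub> w)"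
proof -
  have "t \<in> module.span tscale {v \<otimes>\<^bsub>V,W\<^esub> w | v w. v \<in> vcarr V \<and> w \<in> vcarr W}"
    using t by (simp add: tensor_def)
  then show ?thesis
  proof (induction rule: module.span_induct_alt[OF module_tscale, consumes 1])
    case 1
    show ?case by (rule exI[of _ "[]"]) simp
  next
    case (2 c x y)
    then obtain ps v w where *: "set ps \<subseteq> vcarr V \<times> vcarr W" "y = (\<Sum>(v, w)\<leftarrow>ps. v \<otimes>\<^bsub>V,W\<^esub> w)"
      "x = v \<otimes>\<^bsub>V,W\<^esub> w" "v \<in> vcarr V" "w \<in> vcarr W" by blast
    have "tscale c x = vscale V c v \<otimes>\<^bsub>V,W\<^esub> w"
      using bilinear_tpure[of V W] * by (auto simp: bilinear_map_def linear_map_def)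
    with * V show ?case
      by (intro exI[of _ "(vscale V c v, w) # ps"]) (auto intro: kspaceD)
  qed
qed

lemma trep:
  assumes "kspace V" "kspace W" "t \<in> vcarr (tensor V W)"
  shows "set (trep V W t) \<subseteq> vcarr V \<times> vcarr W"
    and "(\<Sum>(v, w)\<leftarrow>trep V W t. v \<otimes>\<^bsub>V,W\<^esub> w) = t"
  using someI_ex[OF tensor_representation[OF assms]] by (auto simp: trep_def)

lemma separating_functional:
  assumes s: "vector_space (s :: 'k::field \<Rightarrow> 'u::ab_group_add \<Rightarrow> 'u)" and u: "u \<noteq> 0"
  shows "\<exists>g :: 'u \<Rightarrow> 'k. (\<forall>x y. g (x + y) = g x + g y) \<and> (\<forall>c x. g (s c x) = c * g x) \<and> g u \<noteq> 0"
proof -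
  have k: "vector_space ((*) :: 'k \<Rightarrow> 'k \<Rightarrow> 'k)"
    by unfold_locales (auto simp: algebra_simps)
  interpret U: vector_space s by fact
  interpret K: vector_space "(*) :: 'k \<Rightarrow> 'k \<Rightarrow> 'k" by fact
  interpret P: vector_space_pair s "(*) :: 'k \<Rightarrow> 'k \<Rightarrow> 'k" ..
  have "U.independent {u}" using u by simp
  from P.linear_independent_extend[OF this, of "\<lambda>_. 1"] obtain g
    where g: "Vector_Spaces.linear s (*) g" "g u = 1" by auto
  interpret Vector_Spaces.linear s "(*)" g by fact
  show ?thesis using g(2) by (intro exI[of _ g]) (auto simp: add scale)
qed

lemma sum_list_tpure:
  "(\<Sum>(v, w)\<leftarrow>ps. v \<otimes>\<^bsub>V,W\<^esub> w) B
     = (if bilinear_map V W base_field B then \<Sum>(v, w)\<leftarrow>ps. B v w else 0)"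
  by (induction ps) (auto simp: tpure_def)

lemma representation_independent:
  assumes U: "kspace U" and f: "bilinear_map V W U f"
    and ps: "set ps \<subseteq> vcarr V \<times> vcarr W" and qs: "set qs \<subseteq> vcarr V \<times> vcarr W"
    and eq: "(\<Sum>(v, w)\<leftarrow>ps. v \<otimes>\<^bsub>V,W\<^esub> w) = (\<Sum>(v, w)\<leftarrow>qs. v \<otimes>\<^bsub>V,W\<^esub> w)"
  shows "(\<Sum>(v, w)\<leftarrow>ps. f v w) = (\<Sum>(v, w)\<leftarrow>qs. f v w)"
proof (rule ccontr)
  assume "\<not> ?thesis"
  then have "(\<Sum>(v, w)\<leftarrow>ps. f v w) - (\<Sum>(v, w)\<leftarrow>qs. f v w) \<noteq> 0" by simp
  moreover have "vector_space (vscale U)" using U by (simp add: kspace_def)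
  ultimately obtain g where g: "\<And>x y. g (x + y) = g x + g y" "\<And>c x. g (vscale U c x) = c * g x"
      "g ((\<Sum>(v, w)\<leftarrow>ps. f v w) - (\<Sum>(v, w)\<leftarrow>qs. f v w)) \<noteq> 0"
    using separating_functional by metis
  have g0: "g 0 = 0" using g(1)[of 0 0] by (metis add_cancel_right_right add_0)
  have gd: "g (x - y) = g x - g y" for x y using g(1)[of "x - y" y] by simp
  have gs: "g (\<Sum>(v, w)\<leftarrow>rs. f v w) = (\<Sum>(v, w)\<leftarrow>rs. g (f v w))" for rs
    by (induction rs) (auto simp: g g0)
  have "bilinear_map V W base_field (\<lambda>v w. g (f v w))"
    using f by (auto simp: bilinear_map_def linear_map_def base_field_def g)
  then have "(\<Sum>(v, w)\<leftarrow>ps. g (f v w)) = (\<Sum>(v, w)\<leftarrow>qs. g (f v w))"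
    using fun_cong[OF eq, of "\<lambda>v w. g (f v w)"] by (simp add: sum_list_tpure)
  then show False using g(3) by (simp add: gd gs)
qed

lemma tlift_representation:
  assumes "kspace V" "kspace W" "kspace U" "bilinear_map V W U f"
    and ps: "set ps \<subseteq> vcarr V \<times> vcarr W"
  shows "tlift V W (\<Sum>(v, w)\<leftarrow>ps. v \<otimes>\<^bsub>V,W\<^esub> w) f = (\<Sum>(v, w)\<leftarrow>ps. f v w)"
proof -
  have "(\<Sum>(v, w)\<leftarrow>ps. v \<otimes>\<^bsub>V,W\<^esub> w) \<in> vcarr (tensor V W)"
    using ps by (intro sum_list_vcarr kspace_tensor) auto
  from trep[OF assms(1,2) this] show ?thesis
    unfolding tlift_def by (intro representation_independent[OF assms(3,4) _ ps])
qed

theorem tlift_pure: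
  assumes "kspace V" "kspace W" "kspace U" "bilinear_map V W U f"
    and "v \<in> vcarr V" "w \<in> vcarr W"
  shows "tlift V W (v \<otimes>\<^bsub>V,W\<^esub> w) f = f v w"
  using tlift_representation[OF assms(1-4), of "[(v, w)]"] assms(5,6) by simp

theorem tlift_linear:
  assumes V: "kspace V" and W: "kspace W" and U: "kspace U" and f: "bilinear_map V W U f"
  shows "linear_map (tensor V W) U (\<lambda>t. tlift V W t f)"
  unfolding linear_map_def
proof (intro conjI ballI allI)
  fix t assume t: "t \<in> vcarr (tensor V W)"
  show "tlift V W t f \<in> vcarr U"
    unfolding tlift_def using f trep(1)[OF V W t]
    by (intro sum_list_vcarr[OF U]) (auto simp: bilinear_map_def linear_map_def)
next
  fix s t assume s: "s \<in> vcarr (tensor V W)" and t: "t \<in> vcarr (tensor V W)"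
  have "s + t = (\<Sum>(v, w)\<leftarrow>trep V W s @ trep V W t. v \<otimes>\<^bsub>V,W\<^esub> w)"
    by (simp add: trep(2)[OF V W s] trep(2)[OF V W t])
  then have "tlift V W (s + t) f = (\<Sum>(v, w)\<leftarrow>trep V W s @ trep V W t. f v w)"
    using tlift_representation[OF V W U f, of "trep V W s @ trep V W t"]
      trep(1)[OF V W s] trep(1)[OF V W t] by simp
  then show "tlift V W (s + t) f = tlift V W s f + tlift V W t f"
    by (simp add: tlift_def)
next
  fix c t assume t: "t \<in> vcarr (tensor V W)"
  let ?g = "\<lambda>(v, w). (vscale V c v, w)"
  interpret U: vector_space "vscale U" using U by (simp add: kspace_def)
  interpret T: vector_space "tscale :: 'a \<Rightarrow> ('a, 'b, 'd) tensor \<Rightarrow> _" by (rule vector_space_tscale)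
  have hp: "tscale c (\<Sum>(v, w)\<leftarrow>ps. v \<otimes>\<^bsub>V,W\<^esub> w) = (\<Sum>(v, w)\<leftarrow>map ?g ps. v \<otimes>\<^bsub>V,W\<^esub> w)"
    if "set ps \<subseteq> vcarr V \<times> vcarr W" for ps
    using that bilinear_tpure[of V W]
    by (induction ps) (auto simp: bilinear_map_def linear_map_def T.scale_right_distrib)
  have hf: "vscale U c (\<Sum>(v, w)\<leftarrow>ps. f v w) = (\<Sum>(v, w)\<leftarrow>map ?g ps. f v w)"
    if "set ps \<subseteq> vcarr V \<times> vcarr W" for ps
    using that f
    by (induction ps) (auto simp: bilinear_map_def linear_map_def U.scale_right_distrib)
  have "tscale c t = (\<Sum>(v, w)\<leftarrow>map ?g (trep V W t). v \<otimes>\<^bsub>V,W\<^esub> w)"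
    using hp[OF trep(1)[OF V W t]] by (simp add: trep(2)[OF V W t])
  moreover have "set (map ?g (trep V W t)) \<subseteq> vcarr V \<times> vcarr W"
    using trep(1)[OF V W t] V by (auto intro: kspaceD)
  ultimately have "tlift V W (tscale c t) f = (\<Sum>(v, w)\<leftarrow>map ?g (trep V W t). f v w)"
    using tlift_representation[OF V W U f] by metis
  then show "tlift V W (vscale (tensor V W) c t) f = vscale U c (tlift V W t f)"
    using hf[OF trep(1)[OF V W t]] by (simp add: tlift_def)
qed

theorem linear_map_tensor_unique:
  assumes V: "kspace V" and W: "kspace W"
    and f: "linear_map (tensor V W) U f" and g: "linear_map (tensor V W) U g"
    and eq: "\<And>v w. v \<in> vcarr V \<Longrightarrow> w \<in> vcarr W \<Longrightarrow> f (v \<otimes>\<^bsub>V,W\<^esub> w) = g (v \<otimes>\<^bsub>V,W\<^esub> w)"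
    and t: "t \<in> vcarr (tensor V W)"
  shows "f t = g t"
proof -
  have zero: "h 0 = 0" if "linear_map (tensor V W) U h" for h
  proof -
    have "h (0 + 0) = h 0 + h 0"
      using that kspaceD(1)[OF kspace_tensor] unfolding linear_map_def by blast
    then show ?thesis by simp
  qed
  have "f (\<Sum>(v, w)\<leftarrow>ps. v \<otimes>\<^bsub>V,W\<^esub> w) = g (\<Sum>(v, w)\<leftarrow>ps. v \<otimes>\<^bsub>V,W\<^esub> w)"
    if "set ps \<subseteq> vcarr V \<times> vcarr W" for ps
    using that
  proof (induction ps)
    case Nil
    show ?case by (simp only: list.map sum_list.Nil zero[OF f] zero[OF g])
  next
    case (Cons p ps)
    obtain v w where p: "p = (v, w)" by force
    have "v \<otimes>\<^bsub>V,W\<^esub> w \<in> vcarr (tensor V W)" using Cons.prems p by simp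
    moreover have "(\<Sum>(v, w)\<leftarrow>ps. v \<otimes>\<^bsub>V,W\<^esub> w) \<in> vcarr (tensor V W)"
      using Cons.prems by (intro sum_list_vcarr kspace_tensor) auto
    ultimately show ?case
      using f g Cons p eq unfolding p linear_map_def list.map sum_list.Cons case_prod_conv
      by (metis insert_subset list.simps(15) mem_Sigma_iff)
  qed
  from this[OF trep(1)[OF V W t]] show ?thesis by (simp add: trep(2)[OF V W t])
qed


section \<open>Hopf algebras\<close>

record ('k, 'v) hopf = "('k, 'v) vspace" +
  mult :: "'v \<Rightarrow> 'v \<Rightarrow> 'v"  (infixl "\<cdot>\<index>" 72)
  one :: "'v"  ("\<one>\<index>")
  comult :: "'v \<Rightarrow> ('k, 'v, 'v) tensor"
  counit :: "'v \<Rightarrow> 'k"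
  antipode :: "'v \<Rightarrow> 'v"

definition sweedler ::
  "('k::field, 'v::ab_group_add, 'z) hopf_scheme \<Rightarrow> 'v \<Rightarrow> ('v \<Rightarrow> 'v \<Rightarrow> 'u::ab_group_add) \<Rightarrow> 'u" where
  "sweedler C x f = tlift C C (comult C x) f"

definition sweedler3 ::
  "('k::field, 'v::ab_group_add, 'z) hopf_scheme \<Rightarrow> 'v
    \<Rightarrow> ('v \<Rightarrow> 'v \<Rightarrow> 'v \<Rightarrow> 'u::ab_group_add) \<Rightarrow> 'u" where
  "sweedler3 C x f = sweedler C x (\<lambda>y x3. sweedler C y (\<lambda>x1 x2. f x1 x2 x3))"

definition unital_algebra :: "('k::field, 'v::ab_group_add, 'z) hopf_scheme \<Rightarrow> bool" where
  "unital_algebra A \<longleftrightarrow>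
     kspace A \<and> bilinear_map A A A (mult A) \<and> \<one>\<^bsub>A\<^esub> \<in> vcarr A \<and>
     (\<forall>x\<in>vcarr A. \<forall>y\<in>vcarr A. \<forall>z\<in>vcarr A. x \<cdot>\<^bsub>A\<^esub> y \<cdot>\<^bsub>A\<^esub> z = x \<cdot>\<^bsub>A\<^esub> (y \<cdot>\<^bsub>A\<^esub> z)) \<and>
     (\<forall>x\<in>vcarr A. \<one>\<^bsub>A\<^esub> \<cdot>\<^bsub>A\<^esub> x = x \<and> x \<cdot>\<^bsub>A\<^esub> \<one>\<^bsub>A\<^esub> = x)"

definition counital_coalgebra :: "('k::field, 'v::ab_group_add, 'z) hopf_scheme \<Rightarrow> bool" where
  "counital_coalgebra C \<longleftrightarrow>
     kspace C \<and> linear_map C (tensor C C) (comult C) \<and> linear_map C base_field (counit C) \<and>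
     (\<forall>x\<in>vcarr C.
        sweedler C x (\<lambda>x1 x2. sweedler C x1 (\<lambda>y z. y \<otimes>\<^bsub>C,tensor C C\<^esub> (z \<otimes>\<^bsub>C,C\<^esub> x2)))
      = sweedler C x (\<lambda>x1 x2. sweedler C x2 (\<lambda>y z. x1 \<otimes>\<^bsub>C,tensor C C\<^esub> (y \<otimes>\<^bsub>C,C\<^esub> z)))) \<and>
     (\<forall>x\<in>vcarr C. sweedler C x (\<lambda>x1 x2. vscale C (counit C x1) x2) = x \<and>
                  sweedler C x (\<lambda>x1 x2. vscale C (counit C x2) x1) = x)"

definition counit_algebra_map :: "('k::field, 'v::ab_group_add, 'z) hopf_scheme \<Rightarrow> bool" where
  "counit_algebra_map A \<longleftrightarrow>
     (\<forall>x\<in>vcarr A. \<forall>y\<in>vcarr A. counit A (x \<cdot>\<^bsub>A\<^esub> y) = counit A x * counit A y) \<and>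
     counit A \<one>\<^bsub>A\<^esub> = 1"

definition antipode_axioms :: "('k::field, 'v::ab_group_add, 'z) hopf_scheme \<Rightarrow> bool" where
  "antipode_axioms A \<longleftrightarrow>
     linear_map A A (antipode A) \<and>
     (\<forall>x\<in>vcarr A.
        sweedler A x (\<lambda>x1 x2. antipode A x1 \<cdot>\<^bsub>A\<^esub> x2) = vscale A (counit A x) \<one>\<^bsub>A\<^esub> \<and>
        sweedler A x (\<lambda>x1 x2. x1 \<cdot>\<^bsub>A\<^esub> antipode A x2) = vscale A (counit A x) \<one>\<^bsub>A\<^esub>)"

definition hopf_algebra :: "('k::field, 'v::ab_group_add, 'z) hopf_scheme \<Rightarrow> bool" where
  "hopf_algebra H \<longleftrightarrow>
     unital_algebra H \<and> counital_coalgebra H \<and> counit_algebra_map H \<and>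
     comult H \<one>\<^bsub>H\<^esub> = \<one>\<^bsub>H\<^esub> \<otimes>\<^bsub>H,H\<^esub> \<one>\<^bsub>H\<^esub> \<and>
     (\<forall>x\<in>vcarr H. \<forall>y\<in>vcarr H. comult H (x \<cdot>\<^bsub>H\<^esub> y) =
        sweedler H x (\<lambda>x1 x2. sweedler H y (\<lambda>y1 y2. (x1 \<cdot>\<^bsub>H\<^esub> y1) \<otimes>\<^bsub>H,H\<^esub> (x2 \<cdot>\<^bsub>H\<^esub> y2)))) \<and>
     antipode_axioms H"

text \<open>As usual, preservation of the antipode is not required; it is automatic.\<close>

definition hopf_hom ::
  "('k::field, 'v::ab_group_add, 'y) hopf_scheme \<Rightarrow> ('k, 'w::ab_group_add, 'z) hopf_scheme
    \<Rightarrow> ('v \<Rightarrow> 'w) \<Rightarrow> bool" where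
  "hopf_hom A B f \<longleftrightarrow>
     linear_map A B f \<and>
     (\<forall>x\<in>vcarr A. \<forall>y\<in>vcarr A. f (x \<cdot>\<^bsub>A\<^esub> y) = f x \<cdot>\<^bsub>B\<^esub> f y) \<and> f \<one>\<^bsub>A\<^esub> = \<one>\<^bsub>B\<^esub> \<and>
     (\<forall>x\<in>vcarr A. comult B (f x) = sweedler A x (\<lambda>x1 x2. f x1 \<otimes>\<^bsub>B,B\<^esub> f x2)) \<and>
     (\<forall>x\<in>vcarr A. counit B (f x) = counit A x)"

definition hopf_iso ::
  "('k::field, 'v::ab_group_add, 'y) hopf_scheme \<Rightarrow> ('k, 'w::ab_group_add, 'z) hopf_scheme
    \<Rightarrow> ('v \<Rightarrow> 'w) \<Rightarrow> bool" where
  "hopf_iso A B f \<longleftrightarrow>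
     hopf_algebra A \<and> hopf_algebra B \<and> hopf_hom A B f \<and> bij_betw f (vcarr A) (vcarr B)"


section \<open>Matched pairs and double cross products\<close>

definition left_action ::
  "('k::field, 'h::ab_group_add, 'y) hopf_scheme \<Rightarrow> ('k, 'm::ab_group_add, 'z) vspace_scheme
    \<Rightarrow> ('h \<Rightarrow> 'm \<Rightarrow> 'm) \<Rightarrow> bool" where
  "left_action H M l \<longleftrightarrow>
     bilinear_map H M M l \<and> (\<forall>m\<in>vcarr M. l \<one>\<^bsub>H\<^esub> m = m) \<and>
     (\<forall>x\<in>vcarr H. \<forall>y\<in>vcarr H. \<forall>m\<in>vcarr M. l (x \<cdot>\<^bsub>H\<^esub> y) m = l x (l y m))"

definition right_action ::
  "('k::field, 'a::ab_group_add, 'y) hopf_scheme \<Rightarrow> ('k, 'm::ab_group_add, 'z) vspace_scheme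
    \<Rightarrow> ('m \<Rightarrow> 'a \<Rightarrow> 'm) \<Rightarrow> bool" where
  "right_action K M r \<longleftrightarrow>
     bilinear_map M K M r \<and> (\<forall>m\<in>vcarr M. r m \<one>\<^bsub>K\<^esub> = m) \<and>
     (\<forall>m\<in>vcarr M. \<forall>a\<in>vcarr K. \<forall>b\<in>vcarr K. r m (a \<cdot>\<^bsub>K\<^esub> b) = r (r m a) b)"

text \<open>The bilinear map \<open>f\<close> induces a coalgebra map from the tensor product of \<open>C\<close> and \<open>D\<close> to \<open>E\<close>.\<close>

definition coalgebra_pairing ::
  "('k::field, 'c::ab_group_add, 'x) hopf_scheme \<Rightarrow> ('k, 'd::ab_group_add, 'y) hopf_scheme
    \<Rightarrow> ('k, 'e::ab_group_add, 'z) hopf_scheme \<Rightarrow> ('c \<Rightarrow> 'd \<Rightarrow> 'e) \<Rightarrow> bool" where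
  "coalgebra_pairing C D E f \<longleftrightarrow>
     (\<forall>c\<in>vcarr C. \<forall>d\<in>vcarr D.
        comult E (f c d) =
          sweedler C c (\<lambda>c1 c2. sweedler D d (\<lambda>d1 d2. f c1 d1 \<otimes>\<^bsub>E,E\<^esub> f c2 d2)) \<and>
        counit E (f c d) = counit C c * counit D d)"

definition matched_pair ::
  "('k::field, 'h::ab_group_add) hopf \<Rightarrow> ('k, 'a::ab_group_add) hopf
    \<Rightarrow> ('h \<Rightarrow> 'a \<Rightarrow> 'a) \<Rightarrow> ('h \<Rightarrow> 'a \<Rightarrow> 'h) \<Rightarrow> bool" where
  "matched_pair H K l r \<longleftrightarrow>
     hopf_algebra H \<and> hopf_algebra K \<and>
     left_action H K l \<and> coalgebra_pairing H K K l \<and>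
     right_action K H r \<and> coalgebra_pairing H K H r \<and>
     (\<forall>x\<in>vcarr H. \<forall>a\<in>vcarr K. \<forall>b\<in>vcarr K. l x (a \<cdot>\<^bsub>K\<^esub> b) =
        sweedler H x (\<lambda>x1 x2. sweedler K a (\<lambda>a1 a2. l x1 a1 \<cdot>\<^bsub>K\<^esub> l (r x2 a2) b))) \<and>
     (\<forall>x\<in>vcarr H. l x \<one>\<^bsub>K\<^esub> = vscale K (counit H x) \<one>\<^bsub>K\<^esub>) \<and>
     (\<forall>x\<in>vcarr H. \<forall>y\<in>vcarr H. \<forall>a\<in>vcarr K. r (x \<cdot>\<^bsub>H\<^esub> y) a =
        sweedler H y (\<lambda>y1 y2. sweedler K a (\<lambda>a1 a2. r x (l y1 a1) \<cdot>\<^bsub>H\<^esub> r y2 a2))) \<and>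
     (\<forall>a\<in>vcarr K. r \<one>\<^bsub>H\<^esub> a = vscale H (counit K a) \<one>\<^bsub>H\<^esub>) \<and>
     (\<forall>x\<in>vcarr H. \<forall>a\<in>vcarr K.
        sweedler H x (\<lambda>x1 x2. sweedler K a (\<lambda>a1 a2. l x1 a1 \<otimes>\<^bsub>K,H\<^esub> r x2 a2)) =
        sweedler H x (\<lambda>x1 x2. sweedler K a (\<lambda>a1 a2. l x2 a2 \<otimes>\<^bsub>K,H\<^esub> r x1 a1)))"

definition double_cross_mult ::
  "('k::field, 'h::ab_group_add) hopf \<Rightarrow> ('k, 'a::ab_group_add) hopf
    \<Rightarrow> ('h \<Rightarrow> 'a \<Rightarrow> 'a) \<Rightarrow> ('h \<Rightarrow> 'a \<Rightarrow> 'h)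
    \<Rightarrow> ('k, 'a, 'h) tensor \<Rightarrow> ('k, 'a, 'h) tensor \<Rightarrow> ('k, 'a, 'h) tensor" where
  "double_cross_mult H K l r s t =
     tlift K H s (\<lambda>a x. tlift K H t (\<lambda>b y.
       sweedler H x (\<lambda>x1 x2. sweedler K b (\<lambda>b1 b2.
         (a \<cdot>\<^bsub>K\<^esub> l x1 b1) \<otimes>\<^bsub>K,H\<^esub> (r x2 b2 \<cdot>\<^bsub>H\<^esub> y)))))"

definition double_cross_product ::
  "('k::field, 'h::ab_group_add) hopf \<Rightarrow> ('k, 'a::ab_group_add) hopf
    \<Rightarrow> ('h \<Rightarrow> 'a \<Rightarrow> 'a) \<Rightarrow> ('h \<Rightarrow> 'a \<Rightarrow> 'h) \<Rightarrow> ('k, ('k, 'a, 'h) tensor) hopf" where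
  "double_cross_product H K l r =
     \<lparr>vcarr = vcarr (tensor K H),
      vscale = vscale (tensor K H),
      mult = double_cross_mult H K l r,
      one = \<one>\<^bsub>K\<^esub> \<otimes>\<^bsub>K,H\<^esub> \<one>\<^bsub>H\<^esub>,
      comult = (\<lambda>t. tlift K H t (\<lambda>a x.
        sweedler K a (\<lambda>a1 a2. sweedler H x (\<lambda>x1 x2.
          (a1 \<otimes>\<^bsub>K,H\<^esub> x1) \<otimes>\<^bsub>tensor K H,tensor K H\<^esub> (a2 \<otimes>\<^bsub>K,H\<^esub> x2))))),
      counit = (\<lambda>t. tlift K H t (\<lambda>a x. counit K a * counit H x)),
      antipode = (\<lambda>t. tlift K H t (\<lambda>a x.
        double_cross_mult H K l r (\<one>\<^bsub>K\<^esub> \<otimes>\<^bsub>K,H\<^esub> antipode H x) (antipode K a \<otimes>\<^bsub>K,H\<^esub> \<one>\<^bsub>H\<^esub>)))\<rparr>"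

definition incl_K ::
  "('k::field, 'h::ab_group_add) hopf \<Rightarrow> ('k, 'a::ab_group_add) hopf \<Rightarrow> 'a \<Rightarrow> ('k, 'a, 'h) tensor" where
  "incl_K H K a = a \<otimes>\<^bsub>K,H\<^esub> \<one>\<^bsub>H\<^esub>"

definition incl_H ::
  "('k::field, 'h::ab_group_add) hopf \<Rightarrow> ('k, 'a::ab_group_add) hopf \<Rightarrow> 'h \<Rightarrow> ('k, 'a, 'h) tensor" where
  "incl_H H K x = \<one>\<^bsub>K\<^esub> \<otimes>\<^bsub>K,H\<^esub> x"


section \<open>Yetter-Drinfeld modules and braided Hopf algebras\<close>

record ('k, 'h, 'm) yd = "('k, 'm) vspace" +
  act :: "'h \<Rightarrow> 'm \<Rightarrow> 'm"
  coact :: "'m \<Rightarrow> ('k, 'h, 'm) tensor"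

definition left_coaction ::
  "('k::field, 'h::ab_group_add, 'y) hopf_scheme \<Rightarrow> ('k, 'm::ab_group_add, 'z) vspace_scheme
    \<Rightarrow> ('m \<Rightarrow> ('k, 'h, 'm) tensor) \<Rightarrow> bool" where
  "left_coaction H M \<rho> \<longleftrightarrow>
     linear_map M (tensor H M) \<rho> \<and>
     (\<forall>m\<in>vcarr M.
        tlift H M (\<rho> m) (\<lambda>h n. sweedler H h (\<lambda>h1 h2. h1 \<otimes>\<^bsub>H,tensor H M\<^esub> (h2 \<otimes>\<^bsub>H,M\<^esub> n)))
      = tlift H M (\<rho> m) (\<lambda>h n. tlift H M (\<rho> n) (\<lambda>g p. h \<otimes>\<^bsub>H,tensor H M\<^esub> (g \<otimes>\<^bsub>H,M\<^esub> p)))) \<and>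
     (\<forall>m\<in>vcarr M. tlift H M (\<rho> m) (\<lambda>h n. vscale M (counit H h) n) = m)"

definition yd_module ::
  "('k::field, 'h::ab_group_add) hopf \<Rightarrow> ('k, 'h, 'm::ab_group_add) yd \<Rightarrow> bool" where
  "yd_module H M \<longleftrightarrow>
     kspace M \<and> left_action H M (act M) \<and> left_coaction H M (coact M) \<and>
     (\<forall>x\<in>vcarr H. \<forall>m\<in>vcarr M. coact M (act M x m) =
        sweedler3 H x (\<lambda>x1 x2 x3. tlift H M (coact M m) (\<lambda>h n.
          (x1 \<cdot>\<^bsub>H\<^esub> h \<cdot>\<^bsub>H\<^esub> antipode H x3) \<otimes>\<^bsub>H,M\<^esub> act M x2 n)))"

definition yd_morphism ::
  "('k::field, 'h::ab_group_add) hopf \<Rightarrow> ('k, 'h, 'm::ab_group_add) yd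
    \<Rightarrow> ('k, 'h, 'n::ab_group_add) yd \<Rightarrow> ('m \<Rightarrow> 'n) \<Rightarrow> bool" where
  "yd_morphism H M N f \<longleftrightarrow>
     linear_map M N f \<and>
     (\<forall>x\<in>vcarr H. \<forall>m\<in>vcarr M. f (act M x m) = act N x (f m)) \<and>
     (\<forall>m\<in>vcarr M. coact N (f m) = tlift H M (coact M m) (\<lambda>h n. h \<otimes>\<^bsub>H,N\<^esub> f n))"

definition yd_tensor ::
  "('k::field, 'h::ab_group_add) hopf \<Rightarrow> ('k, 'h, 'm::ab_group_add) yd
    \<Rightarrow> ('k, 'h, 'n::ab_group_add) yd \<Rightarrow> ('k, 'h, ('k, 'm, 'n) tensor) yd" where
  "yd_tensor H M N =
     \<lparr>vcarr = vcarr (tensor M N),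
      vscale = vscale (tensor M N),
      act = (\<lambda>x t. tlift M N t (\<lambda>m n. sweedler H x (\<lambda>x1 x2. act M x1 m \<otimes>\<^bsub>M,N\<^esub> act N x2 n))),
      coact = (\<lambda>t. tlift M N t (\<lambda>m n.
        tlift H M (coact M m) (\<lambda>h m0. tlift H N (coact N n) (\<lambda>g n0.
          (h \<cdot>\<^bsub>H\<^esub> g) \<otimes>\<^bsub>H,tensor M N\<^esub> (m0 \<otimes>\<^bsub>M,N\<^esub> n0)))))\<rparr>"

definition yd_unit :: "('k::field, 'h::ab_group_add) hopf \<Rightarrow> ('k, 'h, 'k) yd" where
  "yd_unit H =
     \<lparr>vcarr = UNIV, vscale = (*),
      act = (\<lambda>x c. counit H x * c),
      coact = (\<lambda>c. \<one>\<^bsub>H\<^esub> \<otimes>\<^bsub>H,base_field\<^esub> c)\<rparr>"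

definition yd_object ::
  "('k, 'm, 'z) vspace_scheme \<Rightarrow> ('h \<Rightarrow> 'm \<Rightarrow> 'm) \<Rightarrow> ('m \<Rightarrow> ('k, 'h, 'm) tensor)
    \<Rightarrow> ('k, 'h, 'm) yd" where
  "yd_object L l \<rho> = \<lparr>vcarr = vcarr L, vscale = vscale L, act = l, coact = \<rho>\<rparr>"

definition braided_hopf_algebra ::
  "('k::field, 'h::ab_group_add) hopf \<Rightarrow> ('k, 'm::ab_group_add) hopf
    \<Rightarrow> ('h \<Rightarrow> 'm \<Rightarrow> 'm) \<Rightarrow> ('m \<Rightarrow> ('k, 'h, 'm) tensor) \<Rightarrow> bool" where
  "braided_hopf_algebra H L l \<rho> \<longleftrightarrow>
     (let M = yd_object L l \<rho> in
       yd_module H M \<and> unital_algebra L \<and> counital_coalgebra L \<and>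
       yd_morphism H (yd_tensor H M M) M (\<lambda>t. tlift L L t (mult L)) \<and>
       yd_morphism H (yd_unit H) M (\<lambda>c. vscale L c \<one>\<^bsub>L\<^esub>) \<and>
       yd_morphism H M (yd_tensor H M M) (comult L) \<and>
       yd_morphism H M (yd_unit H) (counit L) \<and>
       yd_morphism H M M (antipode L) \<and>
       counit_algebra_map L \<and>
       comult L \<one>\<^bsub>L\<^esub> = \<one>\<^bsub>L\<^esub> \<otimes>\<^bsub>L,L\<^esub> \<one>\<^bsub>L\<^esub> \<and>
       (\<forall>a\<in>vcarr L. \<forall>b\<in>vcarr L. comult L (a \<cdot>\<^bsub>L\<^esub> b) =
          sweedler L a (\<lambda>a1 a2. sweedler L b (\<lambda>b1 b2. tlift H L (\<rho> a2) (\<lambda>h a0.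
            (a1 \<cdot>\<^bsub>L\<^esub> l h b1) \<otimes>\<^bsub>L,L\<^esub> (a0 \<cdot>\<^bsub>L\<^esub> b2))))) \<and>
       antipode_axioms L)"


section \<open>Biproducts\<close>

definition biproduct_mult ::
  "('k::field, 'h::ab_group_add) hopf \<Rightarrow> ('k, 'b::ab_group_add) hopf \<Rightarrow> ('h \<Rightarrow> 'b \<Rightarrow> 'b)
    \<Rightarrow> ('k, 'b, 'h) tensor \<Rightarrow> ('k, 'b, 'h) tensor \<Rightarrow> ('k, 'b, 'h) tensor" where
  "biproduct_mult H B l s t =
     tlift B H s (\<lambda>a x. tlift B H t (\<lambda>b y.
       sweedler H x (\<lambda>x1 x2. (a \<cdot>\<^bsub>B\<^esub> l x1 b) \<otimes>\<^bsub>B,H\<^esub> (x2 \<cdot>\<^bsub>H\<^esub> y))))"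

text \<open>
  The antipode is Radford's,
  \<open>S(a \<otimes> x) = (1 \<otimes> S\<^sub>H(a\<^sub>-\<^sub>1 x)) (S\<^sub>B(a\<^sub>0) \<otimes> 1)\<close>.
\<close>

definition biproduct ::
  "('k::field, 'h::ab_group_add) hopf \<Rightarrow> ('k, 'b::ab_group_add) hopf
    \<Rightarrow> ('h \<Rightarrow> 'b \<Rightarrow> 'b) \<Rightarrow> ('b \<Rightarrow> ('k, 'h, 'b) tensor) \<Rightarrow> ('k, ('k, 'b, 'h) tensor) hopf" where
  "biproduct H B l \<rho> =
     \<lparr>vcarr = vcarr (tensor B H),
      vscale = vscale (tensor B H),
      mult = biproduct_mult H B l,
      one = \<one>\<^bsub>B\<^esub> \<otimes>\<^bsub>B,H\<^esub> \<one>\<^bsub>H\<^esub>,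
      comult = (\<lambda>t. tlift B H t (\<lambda>a x.
        sweedler B a (\<lambda>a1 a2. tlift H B (\<rho> a2) (\<lambda>h a0. sweedler H x (\<lambda>x1 x2.
          (a1 \<otimes>\<^bsub>B,H\<^esub> (h \<cdot>\<^bsub>H\<^esub> x1)) \<otimes>\<^bsub>tensor B H,tensor B H\<^esub> (a0 \<otimes>\<^bsub>B,H\<^esub> x2)))))),
      counit = (\<lambda>t. tlift B H t (\<lambda>a x. counit B a * counit H x)),
      antipode = (\<lambda>t. tlift B H t (\<lambda>a x. tlift H B (\<rho> a) (\<lambda>h a0.
        biproduct_mult H B l
          (\<one>\<^bsub>B\<^esub> \<otimes>\<^bsub>B,H\<^esub> antipode H (h \<cdot>\<^bsub>H\<^esub> x)) (antipode B a0 \<otimes>\<^bsub>B,H\<^esub> \<one>\<^bsub>H\<^esub>))))\<rparr>"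


section \<open>The structures determined by a projection\<close>

definition K_pi ::
  "('k::field, 'a::ab_group_add) hopf \<Rightarrow> ('h \<Rightarrow> 'a \<Rightarrow> 'a) \<Rightarrow> ('a \<Rightarrow> 'h) \<Rightarrow> ('k, 'a) hopf" where
  "K_pi K l \<pi> =
     K\<lparr>mult := (\<lambda>a b. sweedler K a (\<lambda>a1 a2. a1 \<cdot>\<^bsub>K\<^esub> l (\<pi> (antipode K a2)) b)),
       antipode := (\<lambda>a. sweedler K a (\<lambda>a1 a2. l (\<pi> a1) (antipode K a2)))\<rparr>"

definition Coad_pi ::
  "('k::field, 'h::ab_group_add) hopf \<Rightarrow> ('k, 'a::ab_group_add) hopf \<Rightarrow> ('a \<Rightarrow> 'h)
    \<Rightarrow> 'a \<Rightarrow> ('k, 'h, 'a) tensor" where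
  "Coad_pi H K \<pi> a = sweedler3 K a (\<lambda>a1 a2 a3. \<pi> (a1 \<cdot>\<^bsub>K\<^esub> antipode K a3) \<otimes>\<^bsub>H,K\<^esub> a2)"

definition beta ::
  "('k::field, 'h::ab_group_add) hopf \<Rightarrow> ('k, 'a::ab_group_add) hopf \<Rightarrow> ('a \<Rightarrow> 'h)
    \<Rightarrow> ('k, 'a, 'h) tensor \<Rightarrow> ('k, 'a, 'h) tensor" where
  "beta H K \<pi> t =
     tlift K H t (\<lambda>a x. sweedler K a (\<lambda>a1 a2. a1 \<otimes>\<^bsub>K,H\<^esub> (\<pi> a2 \<cdot>\<^bsub>H\<^esub> x)))"

end

theory Submission
  imports Defs
begin

text \<open>
  Since \<open>\<theta>\<close> is an algebra map that is the identity on \<open>H\<close>, it maps \<open>a \<otimes> x\<close> to \<open>\<pi>(a) x\<close>, and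
  its value on the product of \<open>1 \<otimes> x\<close> and \<open>a \<otimes> 1\<close> gives
  \<open>x \<pi>(a) = \<pi>(x\<^sub>1 \<rightharpoonup> a\<^sub>1) (x\<^sub>2 \<leftharpoonup> a\<^sub>2)\<close>. Hence
  \<open>x \<leftharpoonup> a = S\<pi>(x\<^sub>1 \<rightharpoonup> a\<^sub>1) x\<^sub>2 \<pi>(a\<^sub>2)\<close>, and with this expression for the right action the
  axioms of \<open>K\<^sub>\<pi>\<close> become direct calculations. The map \<open>\<beta>\<close> is bijective, with inverse
  \<open>a \<otimes> x \<mapsto> a\<^sub>1 \<otimes> S\<pi>(a\<^sub>2) x\<close>, and compatible with all structure maps including the antipodes, so
  the Hopf algebra structure of the double cross product carries over to the biproduct.
\<close>

section \<open>Linear maps and Sweedler sums\<close>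

text \<open>The formulas come from Radford's theorem on Hopf algebras with a projection. The map
  \<open>d \<mapsto> d1 \<iota>S\<theta>(d2)\<close>, with \<open>\<iota>\<close> the inclusion of
  \<open>H\<close>, projects the double cross product onto its right \<open>H\<close>-coinvariants
  and sends \<open>a \<otimes> 1\<close> to \<open>a1 \<otimes> S\<pi>(a2)\<close>. This identifies
  \<open>K\<close> with the coinvariants. Carried over to \<open>K\<close>, their product is that of
  \<open>K_pi\<close>, the adjoint action of \<open>H\<close> is the left action of the matched
  pair, and the coaction is the coadjoint one pushed along \<open>\<pi>\<close>; the inverse of
  \<open>\<beta>\<close> multiplies such coinvariants by \<open>H\<close>. The calculations take
  place on \<open>K\<close> itself. Their difficulty is that the right action appears whenever
  \<open>x\<close> acts on a product of \<open>K\<close>, but occurs in no structure map of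
  \<open>K_pi\<close>. Each chain therefore regroups a sum until the right action can be traded for
  \<open>\<pi>\<close>, or until a pair \<open>S\<pi>(u1) \<pi>(u2)\<close> or
  \<open>\<pi>(u1) S\<pi>(u2)\<close> stands together and cancels.\<close>

text \<open>
  Sweedler calculations are done by rewriting. Linearity and membership conditions are discharged
  by simp rules. The rules \<open>push\<close> move sums outwards and expand products and actions; the rules
  \<open>sw\<close>, instantiated at the target space \<open>U\<close> of the equation, add coassociativity (sums nested
  to the right), the counit laws and the coproducts of products and actions. Exchanging two sums
  does not terminate as a rewrite rule, so \<open>exchange\<close> is instantiated at the sum that is to be
  moved inwards. In a chain of equations an inner \<open>sweedler\<close> marks the factors to which an axiom
  is applied next; if a step has two simp calls, the first applies the axiom and the second
  normalises.
\<close>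

text \<open>
  Rules instantiated at a tensor product only match while its scaling is written
  \<open>vscale (tensor V W)\<close>.
\<close>

declare vscale_tensor [simp del]

named_theorems push

section \<open>Linear and bilinear maps on carriers\<close>

lemma linear_mapD:
  assumes "linear_map V W f"
  shows "v \<in> vcarr V \<Longrightarrow> f v \<in> vcarr W"
    "u \<in> vcarr V \<Longrightarrow> v \<in> vcarr V \<Longrightarrow> f (u + v) = f u + f v"
    "v \<in> vcarr V \<Longrightarrow> f (vscale V c v) = vscale W c (f v)"
  using assms by (auto simp: linear_map_def)

lemma linear_mapI:
  assumes "\<And>v. v \<in> vcarr V \<Longrightarrow> f v \<in> vcarr W"
    "\<And>u v. u \<in> vcarr V \<Longrightarrow> v \<in> vcarr V \<Longrightarrow> f (u + v) = f u + f v"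
    "\<And>c v. v \<in> vcarr V \<Longrightarrow> f (vscale V c v) = vscale W c (f v)"
  shows "linear_map V W f"
  using assms by (auto simp: linear_map_def)

lemma linear_map_zero:
  assumes "kspace V" "linear_map V W f"
  shows "f 0 = 0"
  using linear_mapD(2)[OF assms(2), of 0 0] kspaceD(1)[OF assms(1)] by simp

lemma linear_map_sum_list:
  assumes "kspace V" "linear_map V W f" "\<And>x. x \<in> set xs \<Longrightarrow> g x \<in> vcarr V"
  shows "f (sum_list (map g xs)) = (\<Sum>x\<leftarrow>xs. f (g x))"
  using assms(3)
proof (induction xs)
  case Nil
  show ?case using linear_map_zero[OF assms(1,2)] by simp
next
  case (Cons x xs)
  have "sum_list (map g xs) \<in> vcarr V"
    by (rule sum_list_vcarr[OF assms(1)]) (use Cons in auto)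
  then show ?case using Cons linear_mapD(2)[OF assms(2)] by simp
qed

lemma linear_map_id: "linear_map V V (\<lambda>v. v)"
  by (auto simp: linear_map_def)

lemma linear_map_comp:
  "linear_map V W g \<Longrightarrow> linear_map Z V f \<Longrightarrow> linear_map Z W (\<lambda>z. g (f z))"
  by (auto simp: linear_map_def)

lemma bilinear_mapD:
  assumes "bilinear_map V W U f"
  shows "v \<in> vcarr V \<Longrightarrow> linear_map W U (f v)"
    and "w \<in> vcarr W \<Longrightarrow> linear_map V U (\<lambda>v. f v w)"
  using assms by (auto simp: bilinear_map_def)

lemma bilinear_mapI:
  assumes "\<And>v. v \<in> vcarr V \<Longrightarrow> linear_map W U (f v)"
    and "\<And>w. w \<in> vcarr W \<Longrightarrow> linear_map V U (\<lambda>v. f v w)"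
  shows "bilinear_map V W U f"
  using assms by (auto simp: bilinear_map_def)

lemma bilinear_closed:
  "bilinear_map V W U f \<Longrightarrow> v \<in> vcarr V \<Longrightarrow> w \<in> vcarr W \<Longrightarrow> f v w \<in> vcarr U"
  by (auto simp: bilinear_map_def linear_map_def)

lemma bilinear_lin1:
  "bilinear_map V W U f \<Longrightarrow> w \<in> vcarr W \<Longrightarrow> linear_map Z V g \<Longrightarrow> linear_map Z U (\<lambda>z. f (g z) w)"
  by (auto simp: bilinear_map_def linear_map_def)

lemma bilinear_lin2:
  "bilinear_map V W U f \<Longrightarrow> v \<in> vcarr V \<Longrightarrow> linear_map Z W g \<Longrightarrow> linear_map Z U (\<lambda>z. f v (g z))"
  by (auto simp: bilinear_map_def linear_map_def)

lemma bilinear_scale1: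
  "bilinear_map V W U f \<Longrightarrow> v \<in> vcarr V \<Longrightarrow> w \<in> vcarr W \<Longrightarrow> f (vscale V c v) w = vscale U c (f v w)"
  by (auto simp: bilinear_map_def linear_map_def)

lemma bilinear_scale2:
  "bilinear_map V W U f \<Longrightarrow> v \<in> vcarr V \<Longrightarrow> w \<in> vcarr W \<Longrightarrow> f v (vscale W c w) = vscale U c (f v w)"
  by (auto simp: bilinear_map_def linear_map_def)

lemma vscale_base_field: "vscale base_field = (*)" "vcarr base_field = UNIV"
  by (simp_all add: base_field_def)

lemma kspace_scale:
  assumes "kspace V"
  shows "vscale V (c * d) v = vscale V c (vscale V d v)" "vscale V 1 v = v"
    "vscale V c (u + v) = vscale V c u + vscale V c v"
    "vscale V (c + d) v = vscale V c v + vscale V d v"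
    "vscale V c (vscale V d v) = vscale V d (vscale V c v)" "vscale V 0 v = 0" "vscale V c 0 = 0"
proof -
  interpret vector_space "vscale V" using assms by (simp add: kspace_def)
  show "vscale V (c * d) v = vscale V c (vscale V d v)" "vscale V 1 v = v"
    "vscale V c (u + v) = vscale V c u + vscale V c v"
    "vscale V (c + d) v = vscale V c v + vscale V d v"
    "vscale V c (vscale V d v) = vscale V d (vscale V c v)" "vscale V 0 v = 0" "vscale V c 0 = 0"
    by (simp_all add: algebra_simps)
qed

lemma bilinear_vscale: "kspace V \<Longrightarrow> bilinear_map base_field V V (vscale V)"
  by (auto simp: bilinear_map_def linear_map_def base_field_def kspaceD kspace_scale)

lemma linear_map_add:
  assumes "kspace U" "linear_map V U f" "linear_map V U g"
  shows "linear_map V U (\<lambda>v. f v + g v)"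
  using assms by (auto simp: linear_map_def kspaceD kspace_scale algebra_simps)

lemma linear_map_0: "kspace U \<Longrightarrow> linear_map V U (\<lambda>v. 0)"
  by (auto simp: linear_map_def kspaceD kspace_scale)

lemma linear_map_sum_list_fun:
  assumes "kspace U" "\<And>x. x \<in> set xs \<Longrightarrow> linear_map V U (\<lambda>v. f v x)"
  shows "linear_map V U (\<lambda>v. \<Sum>x\<leftarrow>xs. f v x)"
  using assms(2) by (induction xs) (auto intro: linear_map_0 linear_map_add assms(1))

subsection \<open>Lifting\<close>

text \<open>Each side is a double sum over the two lists chosen by \<open>trep\<close>, so this is
  the exchange of finite sums.\<close>

lemma tlift_exchange:
  "tlift V W s (\<lambda>a b. tlift V' W' t (\<lambda>c d. f a b c d)) =
   tlift V' W' t (\<lambda>c d. tlift V W s (\<lambda>a b. f a b c d))"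
proof -
  have "(\<Sum>p\<leftarrow>ps. \<Sum>q\<leftarrow>qs. g p q) = (\<Sum>q\<leftarrow>qs. \<Sum>p\<leftarrow>ps. g p q)" for ps :: "'p list" and qs :: "'q list"
     and g :: "'p \<Rightarrow> 'q \<Rightarrow> 'u::ab_group_add"
    by (induction ps) (auto simp: sum_list_addf)
  note ex = this
  show ?thesis unfolding tlift_def case_prod_beta by (rule ex)
qed

text \<open>As a congruence rule it supplies carrier membership of the bound variables while the
  body is rewritten, which discharges the side conditions of the calculation rules. The equations
  between the spaces allow these to be rewritten too.\<close>

lemma tlift_cong:
  assumes "V = V'" "W = W'" "t = t'" "kspace V'" "kspace W'" "t' \<in> vcarr (tensor V' W')"
    "\<And>v w. v \<in> vcarr V' \<Longrightarrow> w \<in> vcarr W' \<Longrightarrow> f v w = g v w"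
  shows "tlift V W t f = tlift V' W' t' g"
  unfolding tlift_def assms(1-3)
  by (rule arg_cong[where f=sum_list]) (use trep(1)[OF assms(4-6)] assms(7) in auto)

lemma tlift_closed:
  assumes "kspace V" "kspace W" "kspace U" "t \<in> vcarr (tensor V W)"
    "\<And>v w. v \<in> vcarr V \<Longrightarrow> w \<in> vcarr W \<Longrightarrow> f v w \<in> vcarr U"
  shows "tlift V W t f \<in> vcarr U"
  unfolding tlift_def using trep(1)[OF assms(1,2,4)] assms(5)
    by (auto intro!: sum_list_vcarr[OF assms(3)])

lemma linear_map_tlift:
  assumes "linear_map U X g" "kspace V" "kspace W" "kspace U" "t \<in> vcarr (tensor V W)"
    "\<And>v w. v \<in> vcarr V \<Longrightarrow> w \<in> vcarr W \<Longrightarrow> f v w \<in> vcarr U"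
  shows "g (tlift V W t f) = tlift V W t (\<lambda>v w. g (f v w))"
proof -
  have "g (tlift V W t f) = (\<Sum>x\<leftarrow>trep V W t. g (case x of (v, w) \<Rightarrow> f v w))"
    unfolding tlift_def using trep(1)[OF assms(2,3,5)] assms(6)
    by (intro linear_map_sum_list[OF assms(4,1)]) auto
  also have "\<dots> = tlift V W t (\<lambda>v w. g (f v w))"
    unfolding tlift_def by (intro arg_cong[where f=sum_list] map_cong) auto
  finally show ?thesis .
qed

lemma lin_tlift_arg:
  assumes "kspace V" "kspace W" "kspace U" "bilinear_map V W U f" "linear_map Z (tensor V W) g"
  shows "linear_map Z U (\<lambda>z. tlift V W (g z) f)"
  by (rule linear_map_comp[OF tlift_linear[OF assms(1-4)] assms(5)])

lemma lin_tlift_body: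
  assumes "kspace V" "kspace W" "kspace U" "t \<in> vcarr (tensor V W)"
    "\<And>v w. v \<in> vcarr V \<Longrightarrow> w \<in> vcarr W \<Longrightarrow> linear_map Z U (\<lambda>z. f z v w)"
  shows "linear_map Z U (\<lambda>z. tlift V W t (f z))"
  unfolding tlift_def using trep(1)[OF assms(1,2,4)] assms(5)
  by (intro linear_map_sum_list_fun[OF assms(3)]) (auto simp: case_prod_beta)

subsection \<open>Coalgebras\<close>

abbreviation "coalg \<equiv> counital_coalgebra"

text \<open>The part of the coalgebra axioms on which the handling of Sweedler sums depends.\<close>

definition cospace where
  "cospace C \<longleftrightarrow> kspace C \<and> linear_map C (tensor C C) (comult C)"

lemma cospaceD:
  assumes "cospace C"
  shows "kspace C" "linear_map C (tensor C C) (comult C)"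
  using assms by (simp_all add: cospace_def)

lemma coalgD:
  assumes "coalg C"
  shows "cospace C" "linear_map C base_field (counit C)"
  using assms by (simp_all add: counital_coalgebra_def cospace_def)

lemma comult_in: "cospace C \<Longrightarrow> x \<in> vcarr C \<Longrightarrow> comult C x \<in> vcarr (tensor C C)"
  using linear_mapD(1)[OF cospaceD(2)] by blast

lemma sweedler_exchange:
  "sweedler C x (\<lambda>a b. sweedler D y (\<lambda>c d. f a b c d)) =
   sweedler D y (\<lambda>c d. sweedler C x (\<lambda>a b. f a b c d))"
  unfolding sweedler_def by (rule tlift_exchange)

lemma sweedler_cong:
  assumes "x = x'" "cospace C" "x' \<in> vcarr C"
    "\<And>v w. v \<in> vcarr C \<Longrightarrow> w \<in> vcarr C \<Longrightarrow> f v w = g v w"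
  shows "sweedler C x f = sweedler C x' g"
  unfolding sweedler_def using assms comult_in[of C x'] cospaceD[of C]
  by (intro tlift_cong) auto

lemma sweedler_closed:
  assumes "cospace C" "kspace U" "x \<in> vcarr C"
    "\<And>v w. v \<in> vcarr C \<Longrightarrow> w \<in> vcarr C \<Longrightarrow> f v w \<in> vcarr U"
  shows "sweedler C x f \<in> vcarr U"
  unfolding sweedler_def using assms comult_in cospaceD by (intro tlift_closed) auto

lemma linear_map_sweedler:
  assumes "linear_map U X g" "kspace U" "cospace C" "x \<in> vcarr C"
    "\<And>v w. v \<in> vcarr C \<Longrightarrow> w \<in> vcarr C \<Longrightarrow> f v w \<in> vcarr U"
  shows "g (sweedler C x f) = sweedler C x (\<lambda>v w. g (f v w))"
  unfolding sweedler_def using assms comult_in cospaceD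
  by (intro linear_map_tlift[OF assms(1)]) auto

lemma bilinear_sweedler1:
  assumes "bilinear_map V W U g" "kspace V" "w \<in> vcarr W" "cospace C" "x \<in> vcarr C"
    "\<And>c d. c \<in> vcarr C \<Longrightarrow> d \<in> vcarr C \<Longrightarrow> f c d \<in> vcarr V"
  shows "g (sweedler C x f) w = sweedler C x (\<lambda>c d. g (f c d) w)"
  by (rule linear_map_sweedler[OF bilinear_mapD(2)[OF assms(1)]]) (use assms in auto)

lemma bilinear_sweedler2:
  assumes "bilinear_map V W U g" "kspace W" "v \<in> vcarr V" "cospace C" "x \<in> vcarr C"
    "\<And>c d. c \<in> vcarr C \<Longrightarrow> d \<in> vcarr C \<Longrightarrow> f c d \<in> vcarr W"
  shows "g v (sweedler C x f) = sweedler C x (\<lambda>c d. g v (f c d))"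
  by (rule linear_map_sweedler[OF bilinear_mapD(1)[OF assms(1)]]) (use assms in auto)

lemma lin_sweedler_arg:
  assumes "cospace C" "kspace U" "bilinear_map C C U f" "linear_map Z C g"
  shows "linear_map Z U (\<lambda>z. sweedler C (g z) f)"
  unfolding sweedler_def using assms cospaceD[OF assms(1)]
  by (intro lin_tlift_arg linear_map_comp[OF cospaceD(2)]) auto

lemma lin_sweedler_body:
  assumes "cospace C" "kspace U" "x \<in> vcarr C"
    "\<And>v w. v \<in> vcarr C \<Longrightarrow> w \<in> vcarr C \<Longrightarrow> linear_map Z U (\<lambda>z. f z v w)"
  shows "linear_map Z U (\<lambda>z. sweedler C x (f z))"
  unfolding sweedler_def using assms cospaceD[OF assms(1)] comult_in
  by (intro lin_tlift_body) auto

lemma sweedler_sweedler: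
  assumes "cospace C" "cospace D" "kspace U" "bilinear_map D D U g" "x \<in> vcarr C"
    "\<And>c d. c \<in> vcarr C \<Longrightarrow> d \<in> vcarr C \<Longrightarrow> f c d \<in> vcarr D"
  shows "sweedler D (sweedler C x f) g = sweedler C x (\<lambda>c d. sweedler D (f c d) g)"
proof -
  have "linear_map D U (\<lambda>z. sweedler D z g)"
    by (rule lin_sweedler_arg) (use assms linear_map_id in auto)
  from linear_map_sweedler[OF this cospaceD(1)[OF assms(2)] assms(1,5)]
    show ?thesis using assms(6) by simp
qed

lemma sweedler_scale:
  assumes "cospace D" "kspace U" "bilinear_map D D U g" "x \<in> vcarr D"
  shows "sweedler D (vscale D c x) g = vscale U c (sweedler D x g)"
proof -
  have "linear_map D U (\<lambda>z. sweedler D z g)"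
    by (rule lin_sweedler_arg) (use assms linear_map_id in auto)
  from linear_mapD(3)[OF this] show ?thesis using assms cospaceD by simp
qed

lemma sweedler_scale_out:
  assumes "cospace C" "kspace U" "x \<in> vcarr C"
    "\<And>v w. v \<in> vcarr C \<Longrightarrow> w \<in> vcarr C \<Longrightarrow> f v w \<in> vcarr U"
  shows "sweedler C x (\<lambda>v w. vscale U c (f v w)) = vscale U c (sweedler C x f)"
  by (rule linear_map_sweedler[symmetric, of U U])
     (use assms in \<open>auto simp: linear_map_def kspaceD kspace_scale\<close>)

section \<open>Coassociativity and counit laws under multilinear maps\<close>

definition trilinear where
  "trilinear V W X U f \<longleftrightarrow>
     (\<forall>w\<in>vcarr W. \<forall>x\<in>vcarr X. linear_map V U (\<lambda>v. f v w x)) \<and>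
     (\<forall>v\<in>vcarr V. \<forall>x\<in>vcarr X. linear_map W U (\<lambda>w. f v w x)) \<and>
     (\<forall>v\<in>vcarr V. \<forall>w\<in>vcarr W. linear_map X U (\<lambda>x. f v w x))"

text \<open>The coalgebra axiom is the universal case, with values in the threefold tensor product.
  A trilinear \<open>f\<close> factors through the linear map \<open>F\<close> on that product, and
  \<open>F\<close> is applied to both sides of the axiom.\<close>

lemma coassoc:
  assumes C: "coalg C" and U: "kspace U" and f: "trilinear C C C U f" and x: "x \<in> vcarr C"
  shows "sweedler C x (\<lambda>p x3. sweedler C p (\<lambda>x1 x2. f x1 x2 x3)) =
         sweedler C x (\<lambda>x1 q. sweedler C q (\<lambda>x2 x3. f x1 x2 x3))"
proof -
  let ?T = "tensor C C" and ?TT = "tensor C (tensor C C)"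
  note C' = coalgD(1)[OF C]
  note k = cospaceD(1)[OF C'] kspace_tensor[of C C] kspace_tensor[of C ?T] U
  define F where "F = (\<lambda>t. tlift C ?T t (\<lambda>a s. tlift C C s (\<lambda>b c. f a b c)))"
  have bl: "bilinear_map C C U (f a)" if "a \<in> vcarr C" for a
    using f that by (auto simp: trilinear_def intro!: bilinear_mapI)
  have lin2: "linear_map C U (\<lambda>a. f a b c)" if "b \<in> vcarr C" "c \<in> vcarr C" for b c
    using f that by (auto simp: trilinear_def)
  have b2: "bilinear_map C ?T U (\<lambda>a s. tlift C C s (\<lambda>b c. f a b c))"
    by (intro bilinear_mapI tlift_linear lin_tlift_body k bl lin2)
  have F: "linear_map ?TT U F"
    unfolding F_def by (intro tlift_linear k b2)
  have Fp: "F (tpure C ?T a (tpure C C b c)) = f a b c"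
    if "a \<in> vcarr C" "b \<in> vcarr C" "c \<in> vcarr C" for a b c
    using that unfolding F_def
    by (simp add: tlift_pure[OF k(1,2) U b2] tlift_pure[OF k(1,1) U bl])
  have e: "sweedler C x (\<lambda>x1 x2. sweedler C x1 (\<lambda>y z. tpure C ?T y (tpure C C z x2)))
      = sweedler C x (\<lambda>x1 x2. sweedler C x2 (\<lambda>y z. tpure C ?T x1 (tpure C C y z)))"
    using C x by (simp add: counital_coalgebra_def)
  have "F (sweedler C x (\<lambda>x1 x2. sweedler C x1 (\<lambda>y z. tpure C ?T y (tpure C C z x2))))
     = sweedler C x (\<lambda>p x3. sweedler C p (\<lambda>x1 x2. f x1 x2 x3))"
    by (subst linear_map_sweedler[OF F k(3) C' x], intro sweedler_closed C' k, simp_all,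
        intro sweedler_cong refl C' x, subst linear_map_sweedler[OF F k(3) C'], simp_all,
        intro sweedler_cong refl C', simp_all add: Fp)
  moreover have "F (sweedler C x (\<lambda>x1 x2. sweedler C x2 (\<lambda>y z. tpure C ?T x1 (tpure C C y z))))
     = sweedler C x (\<lambda>x1 q. sweedler C q (\<lambda>x2 x3. f x1 x2 x3))"
    by (subst linear_map_sweedler[OF F k(3) C' x], intro sweedler_closed C' k, simp_all,
        intro sweedler_cong refl C' x, subst linear_map_sweedler[OF F k(3) C'], simp_all,
        intro sweedler_cong refl C', simp_all add: Fp)
  ultimately show ?thesis using e by simp
qed

lemma counit_left:
  assumes C: "coalg C" and f: "linear_map C U f" and x: "x \<in> vcarr C"
  shows "sweedler C x (\<lambda>u v. vscale U (counit C u) (f v)) = f x"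
proof -
  note C' = coalgD(1)[OF C]
  have "sweedler C x (\<lambda>u v. vscale U (counit C u) (f v)) =
        sweedler C x (\<lambda>u v. f (vscale C (counit C u) v))"
    by (intro sweedler_cong refl C' x) (use f in \<open>simp add: linear_map_def\<close>)
  also have "\<dots> = f (sweedler C x (\<lambda>u v. vscale C (counit C u) v))"
    by (subst linear_map_sweedler[OF f cospaceD(1)[OF C'] C' x])
       (use kspaceD(3)[OF cospaceD(1)[OF C']] in auto)
  also have "\<dots> = f x" using C x by (simp add: counital_coalgebra_def)
  finally show ?thesis .
qed

lemma counit_right:
  assumes C: "coalg C" and f: "linear_map C U f" and x: "x \<in> vcarr C"
  shows "sweedler C x (\<lambda>u v. vscale U (counit C v) (f u)) = f x"
proof -
  note C' = coalgD(1)[OF C]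
  have "sweedler C x (\<lambda>u v. vscale U (counit C v) (f u)) =
        sweedler C x (\<lambda>u v. f (vscale C (counit C v) u))"
    by (intro sweedler_cong refl C' x) (use f in \<open>simp add: linear_map_def\<close>)
  also have "\<dots> = f (sweedler C x (\<lambda>u v. vscale C (counit C v) u))"
    by (subst linear_map_sweedler[OF f cospaceD(1)[OF C'] C' x])
       (use kspaceD(3)[OF cospaceD(1)[OF C']] in auto)
  also have "\<dots> = f x" using C x by (simp add: counital_coalgebra_def)
  finally show ?thesis .
qed

text \<open>Needed because \<open>coassoc\<close> as a rewrite rule only matches directly nested
  sums; here the sum over \<open>D\<close> stands between them. It is moved out and back in.\<close>

lemma coassoc_skip:
  assumes C: "coalg C" and D: "cospace D" and U: "kspace U" and x: "x \<in> vcarr C"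
    and y: "y \<in> vcarr D"
    and f: "\<And>c d. c \<in> vcarr D \<Longrightarrow> d \<in> vcarr D \<Longrightarrow> trilinear C C C U (\<lambda>x1 x2 x3. f x1 x2 x3 c d)"
  shows "sweedler C x (\<lambda>p x3. sweedler D y (\<lambda>c d. sweedler C p (\<lambda>x1 x2. f x1 x2 x3 c d))) =
         sweedler C x (\<lambda>x1 q. sweedler D y (\<lambda>c d. sweedler C q (\<lambda>x2 x3. f x1 x2 x3 c d)))"
proof -
  have "sweedler C x (\<lambda>p x3. sweedler D y (\<lambda>c d. sweedler C p (\<lambda>x1 x2. f x1 x2 x3 c d))) =
    sweedler D y (\<lambda>c d. sweedler C x (\<lambda>p x3. sweedler C p (\<lambda>x1 x2. f x1 x2 x3 c d)))"
    by (rule sweedler_exchange)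
  also have "\<dots> = sweedler D y (\<lambda>c d. sweedler C x (\<lambda>x1 q. sweedler C q (\<lambda>x2 x3. f x1 x2 x3 c d)))"
    by (intro sweedler_cong refl D y coassoc[OF C U f x])
  also have "\<dots> = sweedler C x (\<lambda>x1 q. sweedler D y (\<lambda>c d. sweedler C q (\<lambda>x2 x3. f x1 x2 x3 c d)))"
    by (rule sweedler_exchange)
  finally show ?thesis .
qed

section \<open>Exchange of Sweedler sums\<close>

lemma sweedler_exchange2:
  "sweedler C x (\<lambda>a b. sweedler C b (\<lambda>p q. sweedler D z (\<lambda>u v. f a p q u v))) =
   sweedler D z (\<lambda>u v. sweedler C x (\<lambda>a b. sweedler C b (\<lambda>p q. f a p q u v)))"
  by (simp only: sweedler_exchange[of C _ D])

lemma sweedler_exchange3: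
  "sweedler C x (\<lambda>a b. sweedler C b (\<lambda>p q. sweedler C q (\<lambda>s t. sweedler D z (\<lambda>u v.
    f a p s t u v)))) =
   sweedler D z (\<lambda>u v. sweedler C x (\<lambda>a b. sweedler C b (\<lambda>p q. sweedler C q (\<lambda>s t.
     f a p s t u v))))"
  by (simp only: sweedler_exchange[of C _ D])

text \<open>Of two sums that split the two components of one coproduct, the one splitting the left
  component is placed first, where \<open>coassoc\<close> can reach it. The two components play
  different roles, so the rule does not loop.\<close>

lemma sweedler_swap [push]:
  "sweedler C x (\<lambda>p q. sweedler C q (\<lambda>s t. sweedler C p (\<lambda>u v. f u v s t))) =
   sweedler C x (\<lambda>p q. sweedler C p (\<lambda>u v. sweedler C q (\<lambda>s t. f u v s t)))"
  by (rule arg_cong[where f="sweedler C x"], intro ext, rule sweedler_exchange)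

lemma sweedler_swap2 [push]:
  "sweedler C x (\<lambda>p q. sweedler C q (\<lambda>s t. sweedler C t (\<lambda>s' t'. sweedler C p (\<lambda>u v.
    f u v s s' t')))) =
   sweedler C x (\<lambda>p q. sweedler C p (\<lambda>u v. sweedler C q (\<lambda>s t. sweedler C t (\<lambda>s' t'.
     f u v s s' t'))))"
  by (rule arg_cong[where f="sweedler C x"], intro ext, rule sweedler_exchange2)

lemma sweedler_swap3 [push]:
  "sweedler C x (\<lambda>p q. sweedler C q (\<lambda>s t. sweedler C t (\<lambda>s' t'. sweedler C t' (\<lambda>s'' t''.
    sweedler C p (\<lambda>u v. f u v s s' s'' t''))))) =
   sweedler C x (\<lambda>p q. sweedler C p (\<lambda>u v. sweedler C q (\<lambda>s t. sweedler C t (\<lambda>s' t'.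
     sweedler C t' (\<lambda>s'' t''. f u v s s' s'' t'')))))"
  by (rule arg_cong[where f="sweedler C x"], intro ext, rule sweedler_exchange3)

lemmas exchange = sweedler_exchange sweedler_exchange2 sweedler_exchange3

lemma trilinearI:
  assumes "\<And>w x. w\<in>vcarr W \<Longrightarrow> x\<in>vcarr X \<Longrightarrow> linear_map V U (\<lambda>v. f v w x)"
     "\<And>v x. v\<in>vcarr V \<Longrightarrow> x\<in>vcarr X \<Longrightarrow> linear_map W U (\<lambda>w. f v w x)"
     "\<And>v w. v\<in>vcarr V \<Longrightarrow> w\<in>vcarr W \<Longrightarrow> linear_map X U (\<lambda>x. f v w x)"
  shows "trilinear V W X U f" using assms by (auto simp: trilinear_def)

section \<open>Rule sets for linearity, membership and normalisation\<close>

declare sweedler_cong [cong] tlift_cong [cong]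
declare trilinearI [simp] bilinear_mapI [simp]
lemmas [simp] = bilinear_lin1[OF bilinear_tpure] bilinear_lin2[OF bilinear_tpure]
  bilinear_mapD[OF bilinear_tpure] linear_map_id
  bilinear_lin1[OF bilinear_vscale] bilinear_lin2[OF bilinear_vscale]
  lin_sweedler_arg lin_sweedler_body lin_tlift_arg lin_tlift_body
lemmas [simp] = vscale_base_field(2)
  kspace_tensor kspace_base_field bilinear_closed[OF bilinear_vscale] sweedler_closed tlift_closed
lemmas [push] = bilinear_sweedler1[OF bilinear_tpure] bilinear_sweedler2[OF bilinear_tpure]
  bilinear_sweedler1[OF bilinear_vscale]
  bilinear_scale1[OF bilinear_tpure] bilinear_scale2[OF bilinear_tpure]
  kspace_scale(1,2,5) vscale_base_field(1)

section \<open>Hopf algebras and matched pairs\<close>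

locale hopf = fixes H :: "('k::field, 'h::ab_group_add, 'x) hopf_scheme"
  assumes hopf: "hopf_algebra H"
begin

lemma hopf_parts: "unital_algebra H" "coalg H" "counit_algebra_map H" "antipode_axioms H"
  using hopf by (auto simp: hopf_algebra_def)

lemma coalg: "coalg H" and kspace [simp]: "kspace H" and cospace [simp]: "cospace H"
  using hopf_parts by (auto simp: unital_algebra_def intro: coalgD)

lemma mult_bil: "bilinear_map H H H (mult H)"
  using hopf_parts by (auto simp: unital_algebra_def)

lemma one_in [simp]: "\<one>\<^bsub>H\<^esub> \<in> vcarr H" using hopf_parts by (auto simp: unital_algebra_def)

lemma S_lin: "linear_map H H (antipode H)" using hopf_parts by (auto simp: antipode_axioms_def)

lemma counit_lin: "linear_map H base_field (counit H)"
  using coalg by (rule coalgD)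

lemmas [simp] = bilinear_closed[OF mult_bil] linear_mapD(1)[OF S_lin] linear_mapD(1)[OF counit_lin]
lemmas [simp] = bilinear_lin1[OF mult_bil] bilinear_lin2[OF mult_bil]
  bilinear_mapD(1)[OF mult_bil] linear_map_comp[OF S_lin] linear_map_comp[OF counit_lin]
    S_lin counit_lin
lemmas [push] = bilinear_sweedler1[OF mult_bil] bilinear_sweedler2[OF mult_bil]
  bilinear_scale1[OF mult_bil] bilinear_scale2[OF mult_bil]
  linear_mapD(3)[OF S_lin] linear_map_sweedler[OF S_lin]
  linear_mapD(3)[OF counit_lin] linear_map_sweedler[OF counit_lin]

lemma assoc: "x \<in> vcarr H \<Longrightarrow> y \<in> vcarr H \<Longrightarrow> z \<in> vcarr H \<Longrightarrow> x \<cdot>\<^bsub>H\<^esub> y \<cdot>\<^bsub>H\<^esub> z = x \<cdot>\<^bsub>H\<^esub> (y \<cdot>\<^bsub>H\<^esub> z)"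
  and one_mult: "x \<in> vcarr H \<Longrightarrow> \<one>\<^bsub>H\<^esub> \<cdot>\<^bsub>H\<^esub> x = x" and mult_one: "x \<in> vcarr H \<Longrightarrow> x \<cdot>\<^bsub>H\<^esub> \<one>\<^bsub>H\<^esub> = x"
  using hopf_parts by (auto simp: unital_algebra_def)
lemmas [push] = assoc one_mult mult_one

lemma counit_mult [push]: "x \<in> vcarr H \<Longrightarrow> y \<in> vcarr H \<Longrightarrow> counit H (x \<cdot>\<^bsub>H\<^esub> y) =
  counit H x * counit H y"
  and counit_one [push]: "counit H \<one>\<^bsub>H\<^esub> = 1"
  using hopf_parts by (auto simp: counit_algebra_map_def)

lemma antipode_left: "x \<in> vcarr H \<Longrightarrow>
    sweedler H x (\<lambda>x1 x2. antipode H x1 \<cdot>\<^bsub>H\<^esub> x2) = vscale H (counit H x) \<one>\<^bsub>H\<^esub>"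
  and antipode_right: "x \<in> vcarr H \<Longrightarrow>
    sweedler H x (\<lambda>x1 x2. x1 \<cdot>\<^bsub>H\<^esub> antipode H x2) = vscale H (counit H x) \<one>\<^bsub>H\<^esub>"
  using hopf_parts by (auto simp: antipode_axioms_def)

lemma sw_one:
  assumes "kspace U" "bilinear_map H H U f"
  shows "sweedler H \<one>\<^bsub>H\<^esub> f = f \<one>\<^bsub>H\<^esub> \<one>\<^bsub>H\<^esub>"
  using hopf assms one_in kspace by (simp add: sweedler_def hopf_algebra_def tlift_pure)

text \<open>The Hopf axiom is an equation between tensors. Applying the linear lift of
  \<open>f\<close> to it gives a rule for every bilinear \<open>f\<close>; \<open>sw_l\<close>,
  \<open>sw_r\<close>, \<open>sw_pi\<close> and \<open>sw_D\<close> are obtained in the same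
  way.\<close>

lemma sw_mult:
  assumes U: "kspace U" and f: "bilinear_map H H U f" and x: "x \<in> vcarr H" and y: "y \<in> vcarr H"
  shows "sweedler H (x \<cdot>\<^bsub>H\<^esub> y) f =
    sweedler H x (\<lambda>x1 x2. sweedler H y (\<lambda>y1 y2. f (x1 \<cdot>\<^bsub>H\<^esub> y1) (x2 \<cdot>\<^bsub>H\<^esub> y2)))"
proof -
  have L: "linear_map (tensor H H) U (\<lambda>t. tlift H H t f)"
    by (intro tlift_linear kspace U f)
  have "sweedler H (x \<cdot>\<^bsub>H\<^esub> y) f = tlift H H (sweedler H x (\<lambda>x1 x2. sweedler H y (\<lambda>y1 y2.
    tpure H H (x1 \<cdot>\<^bsub>H\<^esub> y1) (x2 \<cdot>\<^bsub>H\<^esub> y2)))) f"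
    using hopf x y by (simp add: sweedler_def[of _ "x \<cdot>\<^bsub>H\<^esub> y"] hopf_algebra_def)
  also have "\<dots> = sweedler H x (\<lambda>x1 x2. sweedler H y (\<lambda>y1 y2. f (x1 \<cdot>\<^bsub>H\<^esub> y1) (x2 \<cdot>\<^bsub>H\<^esub> y2)))"
    by (simp add: linear_map_sweedler[OF L] x y tlift_pure[OF kspace kspace U f])
  finally show ?thesis .
qed

lemmas sw = coassoc[OF coalg] counit_left[OF coalg] counit_right[OF coalg] sw_one sw_mult
  sweedler_scale[OF cospace] sweedler_scale_out[OF cospace]
  coassoc_skip[OF coalg]
  sweedler_sweedler[where D=H, OF _ cospace]

end

locale matched_hopf_pair = H: hopf H + K: hopf K
  for H :: "('k::field, 'h::ab_group_add) hopf" and K :: "('k, 'a::ab_group_add) hopf" +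
  fixes l :: "'h \<Rightarrow> 'a \<Rightarrow> 'a" and r :: "'h \<Rightarrow> 'a \<Rightarrow> 'h"
  assumes mp: "matched_pair H K l r"
begin

lemma l_bil: "bilinear_map H K K l" and r_bil: "bilinear_map H K H r"
  using mp by (auto simp: matched_pair_def left_action_def right_action_def)
lemmas [simp] = bilinear_closed[OF l_bil] bilinear_closed[OF r_bil]
lemmas [simp] = bilinear_lin1[OF l_bil] bilinear_lin2[OF l_bil] bilinear_mapD(1)[OF l_bil]
  bilinear_lin1[OF r_bil] bilinear_lin2[OF r_bil] bilinear_mapD(1)[OF r_bil]
lemmas [push] = bilinear_sweedler1[OF l_bil] bilinear_sweedler2[OF l_bil]
  bilinear_scale1[OF l_bil] bilinear_scale2[OF l_bil]
  bilinear_sweedler1[OF r_bil] bilinear_sweedler2[OF r_bil]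
  bilinear_scale1[OF r_bil] bilinear_scale2[OF r_bil]

lemma l_act [push]: "a \<in> vcarr K \<Longrightarrow> l \<one>\<^bsub>H\<^esub> a = a"
    "x \<in> vcarr H \<Longrightarrow> y \<in> vcarr H \<Longrightarrow> a \<in> vcarr K \<Longrightarrow> l (x \<cdot>\<^bsub>H\<^esub> y) a = l x (l y a)"
  and r_act [push]: "x \<in> vcarr H \<Longrightarrow> r x \<one>\<^bsub>K\<^esub> = x"
    "x \<in> vcarr H \<Longrightarrow> a \<in> vcarr K \<Longrightarrow> b \<in> vcarr K \<Longrightarrow> r x (a \<cdot>\<^bsub>K\<^esub> b) = r (r x a) b"
  and l_mult [push]: "x \<in> vcarr H \<Longrightarrow> a \<in> vcarr K \<Longrightarrow> b \<in> vcarr K \<Longrightarrow> l x (a \<cdot>\<^bsub>K\<^esub> b) =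
        sweedler H x (\<lambda>x1 x2. sweedler K a (\<lambda>a1 a2. l x1 a1 \<cdot>\<^bsub>K\<^esub> l (r x2 a2) b))"
  and l_one [push]: "x \<in> vcarr H \<Longrightarrow> l x \<one>\<^bsub>K\<^esub> = vscale K (counit H x) \<one>\<^bsub>K\<^esub>"
  and r_mult [push]: "x \<in> vcarr H \<Longrightarrow> y \<in> vcarr H \<Longrightarrow> a \<in> vcarr K \<Longrightarrow> r (x \<cdot>\<^bsub>H\<^esub> y) a =
        sweedler H y (\<lambda>y1 y2. sweedler K a (\<lambda>a1 a2. r x (l y1 a1) \<cdot>\<^bsub>H\<^esub> r y2 a2))"
  and r_one [push]: "a \<in> vcarr K \<Longrightarrow> r \<one>\<^bsub>H\<^esub> a = vscale H (counit K a) \<one>\<^bsub>H\<^esub>"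
  and compat: "x \<in> vcarr H \<Longrightarrow> a \<in> vcarr K \<Longrightarrow>
        sweedler H x (\<lambda>x1 x2. sweedler K a (\<lambda>a1 a2. l x1 a1 \<otimes>\<^bsub>K,H\<^esub> r x2 a2)) =
        sweedler H x (\<lambda>x1 x2. sweedler K a (\<lambda>a1 a2. l x2 a2 \<otimes>\<^bsub>K,H\<^esub> r x1 a1))"
  and counit_l [push]: "x \<in> vcarr H \<Longrightarrow> a \<in> vcarr K \<Longrightarrow> counit K (l x a) = counit H x * counit K a"
  and counit_r [push]: "x \<in> vcarr H \<Longrightarrow> a \<in> vcarr K \<Longrightarrow> counit H (r x a) = counit H x * counit K a"
  using mp by (auto simp: matched_pair_def left_action_def right_action_def coalgebra_pairing_def)

lemma sw_l:
  assumes U: "kspace U" and f: "bilinear_map K K U f" and x: "x \<in> vcarr H" and y: "a \<in> vcarr K"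
  shows "sweedler K (l x a) f =
    sweedler H x (\<lambda>x1 x2. sweedler K a (\<lambda>a1 a2. f (l x1 a1) (l x2 a2)))"
proof -
  have L: "linear_map (tensor K K) U (\<lambda>t. tlift K K t f)"
    by (intro tlift_linear K.kspace U f)
  have "sweedler K (l x a) f = tlift K K (sweedler H x (\<lambda>x1 x2. sweedler K a (\<lambda>y1 y2.
    tpure K K (l x1 y1) (l x2 y2)))) f"
    using mp x y by (simp add: sweedler_def[of _ "l x a"] matched_pair_def coalgebra_pairing_def)
  also have "\<dots> = sweedler H x (\<lambda>x1 x2. sweedler K a (\<lambda>y1 y2. f (l x1 y1) (l x2 y2)))"
    by (simp add: linear_map_sweedler[OF L] x y tlift_pure[OF K.kspace K.kspace U f])
  finally show ?thesis .
qed

lemma sw_r: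
  assumes U: "kspace U" and f: "bilinear_map H H U f" and x: "x \<in> vcarr H" and y: "a \<in> vcarr K"
  shows "sweedler H (r x a) f =
    sweedler H x (\<lambda>x1 x2. sweedler K a (\<lambda>a1 a2. f (r x1 a1) (r x2 a2)))"
proof -
  have L: "linear_map (tensor H H) U (\<lambda>t. tlift H H t f)"
    by (intro tlift_linear H.kspace U f)
  have "sweedler H (r x a) f = tlift H H (sweedler H x (\<lambda>x1 x2. sweedler K a (\<lambda>y1 y2.
    tpure H H (r x1 y1) (r x2 y2)))) f"
    using mp x y by (simp add: sweedler_def[of _ "r x a"] matched_pair_def coalgebra_pairing_def)
  also have "\<dots> = sweedler H x (\<lambda>x1 x2. sweedler K a (\<lambda>y1 y2. f (r x1 y1) (r x2 y2)))"
    by (simp add: linear_map_sweedler[OF L] x y tlift_pure[OF H.kspace H.kspace U f])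
  finally show ?thesis .
qed

declare sweedler_exchange[of K _ H, push]

text \<open>The exchange axiom of the matched pair enters the calculations at two places through
  this form: in the multiplicativity of the coproduct of \<open>D\<close> and in the Yetter-Drinfeld
  condition.\<close>

lemma compat_gen:
  assumes U: "kspace U" and f: "bilinear_map K H U f" and [simp]: "x \<in> vcarr H" "a \<in> vcarr K"
  shows "sweedler H x (\<lambda>x1 x2. sweedler K a (\<lambda>a1 a2. f (l x1 a1) (r x2 a2))) =
     sweedler H x (\<lambda>x1 x2. sweedler K a (\<lambda>a1 a2. f (l x2 a2) (r x1 a1)))"
proof -
  have L: "linear_map (tensor K H) U (\<lambda>t. tlift K H t f)"
    by (intro tlift_linear H.kspace K.kspace U f)
  show ?thesis
    using arg_cong[OF compat, of x a "\<lambda>t. tlift K H t f"]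
    by (simp add: linear_map_sweedler[OF L] tlift_pure[OF K.kspace H.kspace U f])
qed

lemmas sw = H.sw K.sw sw_l sw_r

end

section \<open>The antipode reverses products and coproducts\<close>

context hopf begin

lemma antipode_one: "antipode H \<one>\<^bsub>H\<^esub> = \<one>\<^bsub>H\<^esub>"
  using antipode_left[of "\<one>\<^bsub>H\<^esub>"] by (simp add: push sw[where U=H])

lemma counit_antipode: "x \<in> vcarr H \<Longrightarrow> counit H (antipode H x) = counit H x"
proof -
  assume x [simp]: "x \<in> vcarr H"
  have "counit H (antipode H x) = counit H (sweedler H x (\<lambda>x1 x2. x1 \<cdot>\<^bsub>H\<^esub> antipode H x2))"
    using counit_left[OF coalg, of base_field "\<lambda>x. counit H (antipode H x)" x] by (simp add: push)
  also have "\<dots> = counit H x" by (simp add: antipode_right push)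
  finally show ?thesis .
qed

text \<open>Uniqueness of convolution inverses: as maps on the tensor square of \<open>H\<close>,
  both sides invert the product. The chain puts \<open>S(x1 y1) (x2 y2)\<close>, which is the
  counit, in front of \<open>S(y3) S(x3)\<close> and then cancels from the inside on the
  right.\<close>

lemma antipode_mult:
  assumes [simp]: "x \<in> vcarr H" "y \<in> vcarr H"
  shows "antipode H (x \<cdot>\<^bsub>H\<^esub> y) = antipode H y \<cdot>\<^bsub>H\<^esub> antipode H x"
proof -
  have "antipode H y \<cdot>\<^bsub>H\<^esub> antipode H x =
     sweedler H x (\<lambda>p x3. sweedler H y (\<lambda>q y3.
       vscale H (counit H (p \<cdot>\<^bsub>H\<^esub> q)) (antipode H y3 \<cdot>\<^bsub>H\<^esub> antipode H x3)))"
    by (simp add: push sw[where U=H])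
  also have "\<dots> = sweedler H x (\<lambda>p x3. sweedler H y (\<lambda>q y3.
       sweedler H (p \<cdot>\<^bsub>H\<^esub> q) (\<lambda>u v. antipode H u \<cdot>\<^bsub>H\<^esub> v) \<cdot>\<^bsub>H\<^esub> (antipode H y3 \<cdot>\<^bsub>H\<^esub> antipode H x3)))"
    by (simp add: antipode_left) (simp add: push)
  also have "\<dots> = sweedler H x (\<lambda>x1 p. sweedler H y (\<lambda>y1 q. antipode H (x1 \<cdot>\<^bsub>H\<^esub> y1) \<cdot>\<^bsub>H\<^esub>
     sweedler H p (\<lambda>x2 x3. x2 \<cdot>\<^bsub>H\<^esub> (sweedler H q (\<lambda>y2 y3. y2 \<cdot>\<^bsub>H\<^esub> antipode H y3)
       \<cdot>\<^bsub>H\<^esub> antipode H x3))))"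
    by (simp add: push sw[where U=H] exchange[of H y H])
  also have "\<dots> = sweedler H x (\<lambda>x1 p. sweedler H p (\<lambda>x2 x3. antipode H (x1 \<cdot>\<^bsub>H\<^esub> y) \<cdot>\<^bsub>H\<^esub>
     (x2 \<cdot>\<^bsub>H\<^esub> antipode H x3)))"
    by (simp add: antipode_right) (simp add: push sw[where U=H])
  also have "\<dots> = sweedler H x (\<lambda>x1 p. antipode H (x1 \<cdot>\<^bsub>H\<^esub> y) \<cdot>\<^bsub>H\<^esub>
     sweedler H p (\<lambda>x2 x3. x2 \<cdot>\<^bsub>H\<^esub> antipode H x3))"
    by (simp add: push sw[where U=H])
  also have "\<dots> = antipode H (x \<cdot>\<^bsub>H\<^esub> y)"
    by (simp add: antipode_right) (simp add: push sw[where U=H])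
  finally show ?thesis by simp
qed

text \<open>The dual argument: the coproduct of \<open>S(x)\<close> and
  \<open>S(x2) \<otimes> S(x1)\<close> are both convolution inverses of the coproduct of
  \<open>x\<close>, and \<open>f\<close> is the bilinear map applied to them.\<close>

lemma sw_antipode:
  assumes U [simp]: "kspace U" and f: "bilinear_map H H U f" and x [simp]: "x \<in> vcarr H"
  shows "sweedler H (antipode H x) f = sweedler H x (\<lambda>x1 x2. f (antipode H x2) (antipode H x1))"
proof -
  note [simp] = bilinear_closed[OF f] bilinear_lin1[OF f] bilinear_lin2[OF f] bilinear_mapD(1)[OF f]
  note [push] = bilinear_sweedler1[OF f] bilinear_sweedler2[OF f] bilinear_scale1[OF f]
    bilinear_scale2[OF f]
  have "sweedler H x (\<lambda>x1 x2. f (antipode H x2) (antipode H x1)) =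
    sweedler H x (\<lambda>p q. vscale U (counit H p) (sweedler H q (\<lambda>s t. f (antipode H t)
      (antipode H s))))"
    by (simp add: push sw[where U=U])
  also have "\<dots> = sweedler H x (\<lambda>p q. sweedler H (sweedler H p (\<lambda>x1 x2. antipode H x1 \<cdot>\<^bsub>H\<^esub> x2))
    (\<lambda>u v.
      sweedler H q (\<lambda>s t. f (u \<cdot>\<^bsub>H\<^esub> antipode H t) (v \<cdot>\<^bsub>H\<^esub> antipode H s))))"
    by (simp add: antipode_left) (simp add: push sw[where U=U])
  \<comment> \<open>The second tensor factor cancels first: \<open>q\<close> and \<open>s\<close>
    are neighbours in the iterated coproduct, while \<open>p\<close> and \<open>t\<close> become
    neighbours only when these have disappeared.\<close>
  also have "\<dots> = sweedler H x (\<lambda>x1 y. sweedler H (antipode H x1) (\<lambda>u v.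
      sweedler H y (\<lambda>p y'. sweedler H y' (\<lambda>z t. f (u \<cdot>\<^bsub>H\<^esub> (p \<cdot>\<^bsub>H\<^esub> antipode H t))
        (v \<cdot>\<^bsub>H\<^esub> sweedler H z (\<lambda>q s. q \<cdot>\<^bsub>H\<^esub> antipode H s))))))"
    by (simp add: push sw[where U=U] exchange[of H "antipode H _" H])
  also have "\<dots> = sweedler H x (\<lambda>x1 y. sweedler H (antipode H x1) (\<lambda>u v.
      sweedler H y (\<lambda>p t. f (u \<cdot>\<^bsub>H\<^esub> (p \<cdot>\<^bsub>H\<^esub> antipode H t)) v)))"
    by (simp add: antipode_right) (simp add: push sw[where U=U])
  also have "\<dots> = sweedler H x (\<lambda>x1 y. sweedler H (antipode H x1) (\<lambda>u v.
      f (u \<cdot>\<^bsub>H\<^esub> sweedler H y (\<lambda>p t. p \<cdot>\<^bsub>H\<^esub> antipode H t)) v))"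
    by (simp add: push sw[where U=U])
  also have "\<dots> = sweedler H (antipode H x) f"
    by (simp add: antipode_right) (simp add: push sw[where U=U])
  finally show ?thesis by simp
qed

lemmas [push] = antipode_one counit_antipode antipode_mult

end

section \<open>Projections of the double cross product\<close>

text \<open>
  The projection enters only through the Hopf algebra map \<open>\<pi>\<close> and the relation \<open>cross\<close>.
\<close>

locale split_matched_pair = matched_hopf_pair H K l r
  for H :: "('k::field, 'h::ab_group_add) hopf" and K :: "('k, 'a::ab_group_add) hopf"
    and l :: "'h \<Rightarrow> 'a \<Rightarrow> 'a" and r :: "'h \<Rightarrow> 'a \<Rightarrow> 'h" +
  fixes \<pi> :: "'a \<Rightarrow> 'h"
  assumes pi_lin: "linear_map K H \<pi>"
    and pi_mult [push]: "\<And>a b. a \<in> vcarr K \<Longrightarrow> b \<in> vcarr K \<Longrightarrow> \<pi> (a \<cdot>\<^bsub>K\<^esub> b) = \<pi> a \<cdot>\<^bsub>H\<^esub> \<pi> b"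
    and pi_one [push]: "\<pi> \<one>\<^bsub>K\<^esub> = \<one>\<^bsub>H\<^esub>"
    and pi_comult: "\<And>a. a \<in> vcarr K \<Longrightarrow> comult H (\<pi> a) = sweedler K a (\<lambda>a1 a2. \<pi> a1 \<otimes>\<^bsub>H,H\<^esub> \<pi> a2)"
    and pi_counit [push]: "\<And>a. a \<in> vcarr K \<Longrightarrow> counit H (\<pi> a) = counit K a"
    and cross: "\<And>x a. x \<in> vcarr H \<Longrightarrow> a \<in> vcarr K \<Longrightarrow> x \<cdot>\<^bsub>H\<^esub> \<pi> a =
      sweedler H x (\<lambda>x1 x2. sweedler K a (\<lambda>a1 a2. \<pi> (l x1 a1) \<cdot>\<^bsub>H\<^esub> r x2 a2))"
begin

lemmas [simp] = linear_mapD(1)[OF pi_lin] pi_lin linear_map_comp[OF pi_lin]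
lemmas [push] = linear_mapD(3)[OF pi_lin] linear_map_sweedler[OF pi_lin]

lemma sw_pi:
  assumes U: "kspace U" and f: "bilinear_map H H U f" and y: "a \<in> vcarr K"
  shows "sweedler H (\<pi> a) f = sweedler K a (\<lambda>a1 a2. f (\<pi> a1) (\<pi> a2))"
proof -
  have L: "linear_map (tensor H H) U (\<lambda>t. tlift H H t f)"
    by (intro tlift_linear H.kspace U f)
  show ?thesis
    by (simp add: sweedler_def[of _ "\<pi> a"] pi_comult linear_map_sweedler[OF L]
      y tlift_pure[OF H.kspace H.kspace U f])
qed

lemmas sw_pi_rules = sw H.sw_antipode K.sw_antipode sw_pi

section \<open>The convolution inverse of \<pi> and the elimination of the right action\<close>

lemma spi_left: "a \<in> vcarr K \<Longrightarrow>
    sweedler K a (\<lambda>a1 a2. antipode H (\<pi> a1) \<cdot>\<^bsub>H\<^esub> \<pi> a2) = vscale H (counit K a) \<one>\<^bsub>H\<^esub>"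
  using H.antipode_left[of "\<pi> a"] by (simp add: sw_pi[where U=H] push)

lemma spi_right: "a \<in> vcarr K \<Longrightarrow>
    sweedler K a (\<lambda>a1 a2. \<pi> a1 \<cdot>\<^bsub>H\<^esub> antipode H (\<pi> a2)) = vscale H (counit K a) \<one>\<^bsub>H\<^esub>"
  using H.antipode_right[of "\<pi> a"] by (simp add: sw_pi[where U=H] push)

text \<open>Both sides are convolution inverses of \<open>\<pi>\<close> among the linear maps from
  \<open>K\<close> to \<open>H\<close>: the left because \<open>\<pi>\<close> is an algebra map, the
  right because it is a coalgebra map.\<close>

lemma pi_antipode:
  assumes [simp]: "a \<in> vcarr K"
  shows "\<pi> (antipode K a) = antipode H (\<pi> a)"
proof -
  have "antipode H (\<pi> a) = sweedler K a (\<lambda>p a3. \<pi> (vscale K (counit K p) \<one>\<^bsub>K\<^esub>)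
    \<cdot>\<^bsub>H\<^esub> antipode H (\<pi> a3))"
    by (simp add: push sw_pi_rules[where U=H])
  also have "\<dots> = sweedler K a (\<lambda>p a3. \<pi> (sweedler K p (\<lambda>a1 a2. antipode K a1 \<cdot>\<^bsub>K\<^esub> a2))
    \<cdot>\<^bsub>H\<^esub> antipode H (\<pi> a3))"
    by (simp add: K.antipode_left)
  also have "\<dots> = sweedler K a (\<lambda>a1 q. \<pi> (antipode K a1) \<cdot>\<^bsub>H\<^esub> sweedler K q (\<lambda>a2 a3.
    \<pi> a2 \<cdot>\<^bsub>H\<^esub> antipode H (\<pi> a3)))"
    by (simp add: push sw_pi_rules[where U=H])
  also have "\<dots> = \<pi> (antipode K a)"
    by (simp add: spi_right) (simp add: push sw_pi_rules[where U=H])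
  finally show ?thesis by simp
qed

lemmas [push] = pi_antipode

text \<open>This is \<open>cross\<close> solved for the right action. Since \<open>l\<close> is a
  coalgebra map, the prefixed factor \<open>S\<pi>(l x1 a1)\<close> is convolution inverse to the
  factor \<open>\<pi>(l x2 a2)\<close> that \<open>cross\<close> produces.\<close>

lemma r_eq:
  assumes [simp]: "x \<in> vcarr H" "a \<in> vcarr K"
  shows "sweedler H x (\<lambda>x1 x2. sweedler K a (\<lambda>a1 a2. antipode H (\<pi> (l x1 a1))
    \<cdot>\<^bsub>H\<^esub> (x2 \<cdot>\<^bsub>H\<^esub> \<pi> a2))) = r x a"
proof -
  have "sweedler H x (\<lambda>x1 x2. sweedler K a (\<lambda>a1 a2. antipode H (\<pi> (l x1 a1)) \<cdot>\<^bsub>H\<^esub> (x2 \<cdot>\<^bsub>H\<^esub> \<pi> a2))) =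
    sweedler H x (\<lambda>x1 p. sweedler K a (\<lambda>a1 q. antipode H (\<pi> (l x1 a1)) \<cdot>\<^bsub>H\<^esub>
      sweedler H p (\<lambda>x2 x3. sweedler K q (\<lambda>a2 a3. \<pi> (l x2 a2) \<cdot>\<^bsub>H\<^esub> r x3 a3))))"
    by (simp add: cross)
  also have "\<dots> = sweedler H x (\<lambda>p x3. sweedler K a (\<lambda>q a3.
      sweedler K (l p q) (\<lambda>u v. antipode H (\<pi> u) \<cdot>\<^bsub>H\<^esub> \<pi> v) \<cdot>\<^bsub>H\<^esub> r x3 a3))"
    by (simp add: push sw_pi_rules[where U=H])
  also have "\<dots> = r x a"
    by (simp add: spi_left) (simp add: push sw_pi_rules[where U=H])
  finally show ?thesis .
qed

text \<open>Convolving \<open>r_eq\<close> with \<open>S\<pi>\<close> on the right removes its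
  factor \<open>\<pi> a2\<close>. In this form the left action applies to the undivided
  \<open>a\<close>, and the right action can be eliminated wherever a factor \<open>S\<pi>\<close>
  follows it.\<close>

lemma r_spi:
  assumes [simp]: "x \<in> vcarr H" "a \<in> vcarr K"
  shows "sweedler K a (\<lambda>a1 a2. r x a1 \<cdot>\<^bsub>H\<^esub> antipode H (\<pi> a2)) =
    sweedler H x (\<lambda>x1 x2. antipode H (\<pi> (l x1 a)) \<cdot>\<^bsub>H\<^esub> x2)"
proof -
  have "sweedler K a (\<lambda>a1 a2. r x a1 \<cdot>\<^bsub>H\<^esub> antipode H (\<pi> a2)) =
    sweedler H x (\<lambda>x1 x2. sweedler K a (\<lambda>a1 q. antipode H (\<pi> (l x1 a1)) \<cdot>\<^bsub>H\<^esub> (x2 \<cdot>\<^bsub>H\<^esub>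
      sweedler K q (\<lambda>a2 a3. \<pi> a2 \<cdot>\<^bsub>H\<^esub> antipode H (\<pi> a3)))))"
    by (simp add: r_eq[symmetric]) (simp add: push sw_pi_rules[where U=H])
  also have "\<dots> = sweedler H x (\<lambda>x1 x2. antipode H (\<pi> (l x1 a)) \<cdot>\<^bsub>H\<^esub> x2)"
    by (simp add: spi_right) (simp add: push sw_pi_rules[where U=H])
  finally show ?thesis .
qed

text \<open>Both sides are convolution inverses of \<open>l\<close> on the tensor product of
  \<open>H\<close> and \<open>K\<close>. For the right side this is the action of \<open>x\<close>
  on \<open>a1 S(a2)\<close>, expanded with \<open>l_mult\<close>.\<close>

lemma S_l:
  assumes [simp]: "x \<in> vcarr H" "a \<in> vcarr K"
  shows "antipode K (l x a) = sweedler K a (\<lambda>a1 a2. l (r x a1) (antipode K a2))"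
proof -
  have "sweedler K a (\<lambda>a1 a2. l (r x a1) (antipode K a2)) =
    sweedler H x (\<lambda>p x3. sweedler K a (\<lambda>q w. vscale K (counit K (l p q)) (sweedler K w (\<lambda>a3 a4.
      l (r x3 a3) (antipode K a4)))))"
    by (simp add: push sw_pi_rules[where U=K])
  also have "\<dots> = sweedler H x (\<lambda>p x3. sweedler K a (\<lambda>q w.
    sweedler K (l p q) (\<lambda>u v. antipode K u \<cdot>\<^bsub>K\<^esub> v) \<cdot>\<^bsub>K\<^esub> sweedler K w (\<lambda>a3 a4. l (r x3 a3)
      (antipode K a4))))"
    by (simp add: K.antipode_left) (simp add: push sw_pi_rules[where U=K])
  also have "\<dots> = sweedler H x (\<lambda>x1 q. sweedler K a (\<lambda>a1 w.
     antipode K (l x1 a1) \<cdot>\<^bsub>K\<^esub> l q (sweedler K w (\<lambda>a2 a3. a2 \<cdot>\<^bsub>K\<^esub> antipode K a3))))"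
    by (simp add: push sw_pi_rules[where U=K])
  also have "\<dots> = antipode K (l x a)"
    by (simp add: K.antipode_right) (simp add: push sw_pi_rules[where U=K])
  finally show ?thesis by simp
qed

text \<open>The Yetter-Drinfeld condition with the antipode moved to the other side.\<close>

lemma yd_key:
  assumes [simp]: "kspace U" and f: "bilinear_map H K U f" and [simp]: "x \<in> vcarr H" "a \<in> vcarr K"
  shows "sweedler H x (\<lambda>x1 x'. sweedler H x' (\<lambda>x2 x''. sweedler K a (\<lambda>a1 a'. sweedler K a' (\<lambda>a2 a3.
      f (\<pi> (l x1 a1) \<cdot>\<^bsub>H\<^esub> sweedler H x'' (\<lambda>x3 x4. antipode H (\<pi> (l x3 a3)) \<cdot>\<^bsub>H\<^esub> x4)) (l x2 a2))))) =
    sweedler H x (\<lambda>x1 x2. sweedler K a (\<lambda>a1 a'. sweedler K a' (\<lambda>a2 a3.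
      f (x1 \<cdot>\<^bsub>H\<^esub> (\<pi> a1 \<cdot>\<^bsub>H\<^esub> antipode H (\<pi> a3))) (l x2 a2))))"
    (is "?L = _")
proof -
  note [simp] = bilinear_closed[OF f] bilinear_lin1[OF f] bilinear_lin2[OF f] bilinear_mapD(1)[OF f]
  note [push] = bilinear_sweedler1[OF f] bilinear_sweedler2[OF f] bilinear_scale1[OF f]
    bilinear_scale2[OF f]
  \<comment> \<open>After \<open>r_spi\<close> the right action carries the components
    \<open>x3\<close> and \<open>a3\<close>. The exchange axiom gives it \<open>x2\<close> and
    \<open>a2\<close> instead, next to \<open>\<pi> (l x1 a1)\<close>, so that \<open>cross\<close>
    applies.\<close>
  have c: "sweedler H x' (\<lambda>x2 x3. sweedler K p (\<lambda>a2 a3.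
        f (\<pi> (l x1 a1) \<cdot>\<^bsub>H\<^esub> (r x3 a3 \<cdot>\<^bsub>H\<^esub> antipode H (\<pi> a4))) (l x2 a2))) =
      sweedler H x' (\<lambda>x2 x3. sweedler K p (\<lambda>a2 a3.
        f (\<pi> (l x1 a1) \<cdot>\<^bsub>H\<^esub> (r x2 a2 \<cdot>\<^bsub>H\<^esub> antipode H (\<pi> a4))) (l x3 a3)))"
    if [simp]: "x1 \<in> vcarr H" "x' \<in> vcarr H" "a1 \<in> vcarr K" "a4 \<in> vcarr K" "p \<in> vcarr K"
      for x1 x' a1 a4 p
    by (rule compat_gen[where U=U]) simp_all
  have "?L = sweedler H x (\<lambda>x1 x'. sweedler K a (\<lambda>a1 a'. sweedler K a' (\<lambda>p a4.
      sweedler H x' (\<lambda>x2 x3. sweedler K p (\<lambda>a2 a3.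
      f (\<pi> (l x1 a1) \<cdot>\<^bsub>H\<^esub> (r x3 a3 \<cdot>\<^bsub>H\<^esub> antipode H (\<pi> a4))) (l x2 a2))))))"
    by (simp add: r_spi[symmetric]) (simp add: push sw_pi_rules[where U=U])
  also have "\<dots> = sweedler H x (\<lambda>x1 x'. sweedler K a (\<lambda>a1 a'. sweedler K a' (\<lambda>p a4.
      sweedler H x' (\<lambda>x2 x3. sweedler K p (\<lambda>a2 a3.
      f (\<pi> (l x1 a1) \<cdot>\<^bsub>H\<^esub> (r x2 a2 \<cdot>\<^bsub>H\<^esub> antipode H (\<pi> a4))) (l x3 a3))))))"
    by (simp add: c)
  also have "\<dots> = sweedler H x (\<lambda>p x3. sweedler K a (\<lambda>q a'. sweedler K a' (\<lambda>a3 a4.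
      f (sweedler H p (\<lambda>x1 x2. sweedler K q (\<lambda>a1 a2. \<pi> (l x1 a1) \<cdot>\<^bsub>H\<^esub> r x2 a2))
        \<cdot>\<^bsub>H\<^esub> antipode H (\<pi> a4)) (l x3 a3))))"
    by (simp add: push sw_pi_rules[where U=U])
  also have "\<dots> = sweedler H x (\<lambda>x1 x2. sweedler K a (\<lambda>a1 a'. sweedler K a' (\<lambda>a2 a3.
      f (x1 \<cdot>\<^bsub>H\<^esub> (\<pi> a1 \<cdot>\<^bsub>H\<^esub> antipode H (\<pi> a3))) (l x2 a2))))"
    by (simp add: cross[symmetric]) (simp add: push sw_pi_rules[where U=U])
  finally show ?thesis .
qed

end

text \<open>The lift of \<open>tpure\<close> is the identity, by uniqueness in the universal
  property. Equations between coproducts thereby become equations between Sweedler sums.\<close>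

lemma comult_sweedler:
  assumes "cospace C" "x \<in> vcarr C"
  shows "comult C x = sweedler C x (tpure C C)"
proof -
  note k = cospaceD(1)[OF assms(1)]
  have t: "comult C x \<in> vcarr (tensor C C)" by (rule comult_in[OF assms])
  show ?thesis unfolding sweedler_def
    by (rule linear_map_tensor_unique[OF k k linear_map_id tlift_linear[OF k k kspace_tensor
      bilinear_tpure] _ t])
       (simp add: tlift_pure[OF k k kspace_tensor bilinear_tpure])
qed

section \<open>The braided Hopf algebra structure on \<open>K\<close>\<close>

context split_matched_pair begin

text \<open>\<open>pmult\<close> and \<open>coad\<close> are the product of \<open>K_pi\<close> and
  the coaction \<open>Coad_pi\<close> with \<open>\<pi>\<close> already moved past antipodes and
  products, the form to which the rules normalise. \<open>coad\<close> is the coadjoint coaction of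
  \<open>K\<close> pushed forward along \<open>\<pi>\<close>.\<close>

definition pmult where "pmult a b = sweedler K a (\<lambda>a1 a2. a1 \<cdot>\<^bsub>K\<^esub> l (antipode H (\<pi> a2)) b)"

definition Spi where "Spi a = sweedler K a (\<lambda>a1 a2. l (\<pi> a1) (antipode K a2))"

definition coad where "coad a = sweedler K a (\<lambda>a1 q. sweedler K q (\<lambda>a2 a3.
  (\<pi> a1 \<cdot>\<^bsub>H\<^esub> antipode H (\<pi> a3)) \<otimes>\<^bsub>H,K\<^esub> a2))"

lemma pmult_bil: "bilinear_map K K K pmult"
  unfolding pmult_def by simp

lemmas [simp] = bilinear_closed[OF pmult_bil] bilinear_lin1[OF pmult_bil]
  bilinear_lin2[OF pmult_bil] bilinear_mapD(1)[OF pmult_bil]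
lemmas [push] = bilinear_sweedler1[OF pmult_bil] bilinear_sweedler2[OF pmult_bil]
  bilinear_scale1[OF pmult_bil] bilinear_scale2[OF pmult_bil]

lemma Spi_lin: "linear_map K K Spi"
  unfolding Spi_def by simp

lemmas [simp] = linear_mapD(1)[OF Spi_lin] Spi_lin linear_map_comp[OF Spi_lin]
lemmas [push] = linear_mapD(3)[OF Spi_lin] linear_map_sweedler[OF Spi_lin]

lemma coad_lin: "linear_map K (tensor H K) coad"
  unfolding coad_def by simp

lemmas [simp] = linear_mapD(1)[OF coad_lin] coad_lin linear_map_comp[OF coad_lin]
lemmas [push] = linear_mapD(3)[OF coad_lin] linear_map_sweedler[OF coad_lin]

lemma tlift_coad:
  assumes U: "kspace U" and g: "bilinear_map H K U g" and [simp]: "a \<in> vcarr K"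
  shows "tlift H K (coad a) g = sweedler K a (\<lambda>a1 q. sweedler K q (\<lambda>a2 a3.
    g (\<pi> a1 \<cdot>\<^bsub>H\<^esub> antipode H (\<pi> a3)) a2))"
proof -
  have L: "linear_map (tensor H K) U (\<lambda>t. tlift H K t g)"
    by (intro tlift_linear H.kspace K.kspace U g)
  show ?thesis
    by (simp add: coad_def linear_map_sweedler[OF L] tlift_pure[OF H.kspace K.kspace U g])
qed

section \<open>The product of \<open>K_pi\<close>\<close>

lemma pmult_one: "a \<in> vcarr K \<Longrightarrow> pmult \<one>\<^bsub>K\<^esub> a = a" "a \<in> vcarr K \<Longrightarrow> pmult a \<one>\<^bsub>K\<^esub> = a"
  unfolding pmult_def by (simp_all add: push sw_pi_rules[where U=K])

lemma counit_pmult: "a \<in> vcarr K \<Longrightarrow> b \<in> vcarr K \<Longrightarrow> counit K (pmult a b) = counit K a * counit K b"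
proof -
  assume [simp]: "a \<in> vcarr K" "b \<in> vcarr K"
  \<comment> \<open>Products of scalars are written as scalings of the base field, the shape that
    the counit laws match.\<close>
  have "counit K (pmult a b) = sweedler K a (\<lambda>a1 a2. vscale base_field (counit K a1)
    (vscale base_field (counit K a2) (counit K b)))"
    unfolding pmult_def by (simp add: push)
  also have "\<dots> = vscale base_field (counit K a) (counit K b)"
    by (rule counit_left[OF K.coalg]) simp_all
  finally show ?thesis by (simp add: push)
qed

text \<open>By \<open>l_mult\<close>, the left side contains \<open>r x2 a2\<close> followed by
  \<open>S\<pi>(a3)\<close>. \<open>r_spi\<close> turns this into \<open>S\<pi>(l x2 a2) x3\<close>,
  the element of \<open>H\<close> that the product of \<open>l x1 a\<close> and
  \<open>l x2 b\<close> prescribes.\<close>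

lemma l_pmult:
  assumes [simp]: "x \<in> vcarr H" "a \<in> vcarr K" "b \<in> vcarr K"
  shows "l x (pmult a b) = sweedler H x (\<lambda>x1 x2. pmult (l x1 a) (l x2 b))"
proof -
  have "l x (pmult a b) = sweedler H x (\<lambda>x1 x2. sweedler K a (\<lambda>a1 q.
     l x1 a1 \<cdot>\<^bsub>K\<^esub> l (sweedler K q (\<lambda>a2 a3. r x2 a2 \<cdot>\<^bsub>H\<^esub> antipode H (\<pi> a3))) b))"
    by (simp add: pmult_def push sw_pi_rules[where U=K])
  also have "\<dots> = sweedler H x (\<lambda>x1 x2. pmult (l x1 a) (l x2 b))"
    by (simp add: r_spi) (simp add: pmult_def push sw_pi_rules[where U=K])
  finally show ?thesis .
qed

text \<open>\<open>pmult a b\<close> is a sum of ordinary products of \<open>K\<close>; this expands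
  a further product with such an element on the left.\<close>

lemma pmult_mult:
  assumes [simp]: "u \<in> vcarr K" "v \<in> vcarr K" "c \<in> vcarr K"
  shows "pmult (u \<cdot>\<^bsub>K\<^esub> v) c = sweedler K u (\<lambda>u1 u2. u1 \<cdot>\<^bsub>K\<^esub> pmult v (l (antipode H (\<pi> u2)) c))"
  by (simp add: pmult_def push sw_pi_rules[where U=K] exchange[of K v K])

text \<open>Associativity reduces to \<open>l_pmult\<close>: the coproduct of
  \<open>S\<pi>(q)\<close> acts on \<open>b\<close> and \<open>c\<close> separately, hence on their
  product.\<close>

lemma pmult_assoc:
  assumes [simp]: "a \<in> vcarr K" "b \<in> vcarr K" "c \<in> vcarr K"
  shows "pmult (pmult a b) c = pmult a (pmult b c)"
proof -
  have "pmult (pmult a b) c = sweedler K a (\<lambda>a1 q. a1 \<cdot>\<^bsub>K\<^esub>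
    sweedler H (antipode H (\<pi> q)) (\<lambda>y1 y2. pmult (l y1 b) (l y2 c)))"
    by (simp add: pmult_def[of a b] push pmult_mult sw_pi_rules[where U=K])
  also have "\<dots> = pmult a (pmult b c)"
    by (simp add: l_pmult[symmetric]) (simp add: pmult_def[of a "pmult b c"])
  finally show ?thesis .
qed

section \<open>The coadjoint coaction\<close>

lemma coad_coassoc:
  assumes [simp]: "a \<in> vcarr K"
  shows "tlift H K (coad a) (\<lambda>h n. sweedler H h (\<lambda>h1 h2. h1 \<otimes>\<^bsub>H,tensor H K\<^esub> (h2 \<otimes>\<^bsub>H,K\<^esub> n)))
      = tlift H K (coad a) (\<lambda>h n. tlift H K (coad n) (\<lambda>g p. h \<otimes>\<^bsub>H,tensor H K\<^esub> (g \<otimes>\<^bsub>H,K\<^esub> p)))"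
  \<comment> \<open>Both sides normalise to the sum of the \<open>\<pi>(a1) S\<pi>(a5) \<otimes>
    \<pi>(a2) S\<pi>(a4) \<otimes> a3\<close>.\<close>
  by (simp add: tlift_coad[where U="tensor H (tensor H K)"]
    push sw_pi_rules[where U="tensor H (tensor H K)"])

lemma coad_counit:
  assumes [simp]: "a \<in> vcarr K"
  shows "tlift H K (coad a) (\<lambda>h n. vscale K (counit H h) n) = a"
  by (simp add: tlift_coad[where U=K] push sw_pi_rules[where U=K])

text \<open>Inserting the trivial factor \<open>x4 S(x5)\<close> behind
  \<open>S\<pi>(l x3 a3)\<close> produces the left side of \<open>yd_key\<close>, multiplied by
  \<open>S(x5)\<close>. That factor is absorbed into the bilinear map to which \<open>yd_key\<close>
  is applied.\<close>

lemma coad_l: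
  assumes [simp]: "x \<in> vcarr H" "a \<in> vcarr K"
  shows "coad (l x a) = sweedler3 H x (\<lambda>x1 x2 x3. tlift H K (coad a) (\<lambda>h n.
          (x1 \<cdot>\<^bsub>H\<^esub> h \<cdot>\<^bsub>H\<^esub> antipode H x3) \<otimes>\<^bsub>H,K\<^esub> l x2 n))"
proof -
  have Y: "sweedler H y (\<lambda>x1 x'. sweedler H x' (\<lambda>x2 x''. sweedler K a (\<lambda>a1 a'.
    sweedler K a' (\<lambda>a2 a3.
      ((\<pi> (l x1 a1) \<cdot>\<^bsub>H\<^esub> sweedler H x'' (\<lambda>x3 x4. antipode H (\<pi> (l x3 a3)) \<cdot>\<^bsub>H\<^esub> x4))
        \<cdot>\<^bsub>H\<^esub> antipode H x5)
        \<otimes>\<^bsub>H,K\<^esub> l x2 a2)))) =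
     sweedler H y (\<lambda>x1 x2. sweedler K a (\<lambda>a1 a'. sweedler K a' (\<lambda>a2 a3.
      ((x1 \<cdot>\<^bsub>H\<^esub> (\<pi> a1 \<cdot>\<^bsub>H\<^esub> antipode H (\<pi> a3))) \<cdot>\<^bsub>H\<^esub> antipode H x5) \<otimes>\<^bsub>H,K\<^esub> l x2 a2)))"
    if [simp]: "y \<in> vcarr H" "x5 \<in> vcarr H" for y x5
    using yd_key[of "tensor H K" "\<lambda>h k. (h \<cdot>\<^bsub>H\<^esub> antipode H x5) \<otimes>\<^bsub>H,K\<^esub> k" y a] by simp
  have "coad (l x a) = sweedler H x (\<lambda>x1 x'. sweedler H x' (\<lambda>x2 x''. sweedler K a (\<lambda>a1 a'.
    sweedler K a' (\<lambda>a2 a3.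
      (\<pi> (l x1 a1) \<cdot>\<^bsub>H\<^esub> sweedler H x'' (\<lambda>x3 q. antipode H (\<pi> (l x3 a3)) \<cdot>\<^bsub>H\<^esub>
        vscale H (counit H q) \<one>\<^bsub>H\<^esub>)) \<otimes>\<^bsub>H,K\<^esub> l x2 a2))))"
    by (simp add: coad_def push sw_pi_rules[where U="tensor H K"])
  also have "\<dots> = sweedler H x (\<lambda>x1 x'. sweedler H x' (\<lambda>x2 x''. sweedler K a (\<lambda>a1 a'.
    sweedler K a' (\<lambda>a2 a3.
      (\<pi> (l x1 a1) \<cdot>\<^bsub>H\<^esub> sweedler H x'' (\<lambda>x3 q. antipode H (\<pi> (l x3 a3)) \<cdot>\<^bsub>H\<^esub>
        sweedler H q (\<lambda>x4 x5. x4 \<cdot>\<^bsub>H\<^esub> antipode H x5))) \<otimes>\<^bsub>H,K\<^esub> l x2 a2))))"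
    by (simp add: H.antipode_right)
  also have "\<dots> = sweedler H x (\<lambda>y x5. sweedler H y (\<lambda>x1 x'. sweedler H x' (\<lambda>x2 x''.
    sweedler K a (\<lambda>a1 a'. sweedler K a' (\<lambda>a2 a3.
      ((\<pi> (l x1 a1) \<cdot>\<^bsub>H\<^esub> sweedler H x'' (\<lambda>x3 x4. antipode H (\<pi> (l x3 a3)) \<cdot>\<^bsub>H\<^esub> x4))
        \<cdot>\<^bsub>H\<^esub> antipode H x5)
        \<otimes>\<^bsub>H,K\<^esub> l x2 a2)))))"
    by (simp add: push sw_pi_rules[where U="tensor H K"])
  also have "\<dots> = sweedler H x (\<lambda>y x5. sweedler H y (\<lambda>x1 x2. sweedler K a (\<lambda>a1 a'.
    sweedler K a' (\<lambda>a2 a3.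
      ((x1 \<cdot>\<^bsub>H\<^esub> (\<pi> a1 \<cdot>\<^bsub>H\<^esub> antipode H (\<pi> a3))) \<cdot>\<^bsub>H\<^esub> antipode H x5) \<otimes>\<^bsub>H,K\<^esub> l x2 a2))))"
    by (simp add: Y)
  also have "\<dots> = sweedler3 H x (\<lambda>x1 x2 x3. tlift H K (coad a) (\<lambda>h n.
          (x1 \<cdot>\<^bsub>H\<^esub> h \<cdot>\<^bsub>H\<^esub> antipode H x3) \<otimes>\<^bsub>H,K\<^esub> l x2 n))"
    by (simp add: sweedler3_def tlift_coad[where U="tensor H K"]
      push sw_pi_rules[where U="tensor H K"])
  finally show ?thesis .
qed

text \<open>Again \<open>yd_key\<close>, now with \<open>S\<pi>(w)\<close> in place of
  \<open>x\<close>. Its last component is already present: the coaction on the components of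
  \<open>a\<close> leaves a factor \<open>S\<pi>\<close>, and since \<open>S\<close> reverses
  coproducts this factor and the acting element together form the coproduct of
  \<open>S\<pi>(w)\<close>.\<close>

lemma coad_pmult:
  assumes [simp]: "a \<in> vcarr K" "b \<in> vcarr K"
  shows "coad (pmult a b) = tlift H K (coad a) (\<lambda>h m. tlift H K (coad b) (\<lambda>g n. (h \<cdot>\<^bsub>H\<^esub> g)
    \<otimes>\<^bsub>H,K\<^esub> pmult m n))"
proof -
  have Y: "sweedler H y (\<lambda>x1 x'. sweedler H x' (\<lambda>x2 x''. sweedler K b (\<lambda>b1 b'.
    sweedler K b' (\<lambda>b2 b3.
      (\<pi> a1 \<cdot>\<^bsub>H\<^esub> (\<pi> (l x1 b1) \<cdot>\<^bsub>H\<^esub> sweedler H x'' (\<lambda>x3 x4. antipode H (\<pi> (l x3 b3)) \<cdot>\<^bsub>H\<^esub> x4)))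
         \<otimes>\<^bsub>H,K\<^esub> (a2 \<cdot>\<^bsub>K\<^esub> l x2 b2))))) =
     sweedler H y (\<lambda>x1 x2. sweedler K b (\<lambda>b1 b'. sweedler K b' (\<lambda>b2 b3.
      (\<pi> a1 \<cdot>\<^bsub>H\<^esub> (x1 \<cdot>\<^bsub>H\<^esub> (\<pi> b1 \<cdot>\<^bsub>H\<^esub> antipode H (\<pi> b3))))
         \<otimes>\<^bsub>H,K\<^esub> (a2 \<cdot>\<^bsub>K\<^esub> l x2 b2))))"
    if [simp]: "y \<in> vcarr H" "a1 \<in> vcarr K" "a2 \<in> vcarr K" for y a1 a2
    using yd_key[of "tensor H K" "\<lambda>h k. (\<pi> a1 \<cdot>\<^bsub>H\<^esub> h) \<otimes>\<^bsub>H,K\<^esub> (a2 \<cdot>\<^bsub>K\<^esub> k)" y b] by simp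
  have "coad (pmult a b) = sweedler K a (\<lambda>a1 q. sweedler K q (\<lambda>a2 w.
     sweedler H (antipode H (\<pi> w)) (\<lambda>x1 x'. sweedler H x' (\<lambda>x2 x''. sweedler K b (\<lambda>b1 b'.
       sweedler K b' (\<lambda>b2 b3.
      (\<pi> a1 \<cdot>\<^bsub>H\<^esub> (\<pi> (l x1 b1) \<cdot>\<^bsub>H\<^esub> sweedler H x'' (\<lambda>x3 x4. antipode H (\<pi> (l x3 b3)) \<cdot>\<^bsub>H\<^esub> x4)))
         \<otimes>\<^bsub>H,K\<^esub> (a2 \<cdot>\<^bsub>K\<^esub> l x2 b2)))))))"
    by (simp add: coad_def pmult_def push sw_pi_rules[where U="tensor H K"] exchange[of K b K])
  also have "\<dots> = sweedler K a (\<lambda>a1 q. sweedler K q (\<lambda>a2 w.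
     sweedler H (antipode H (\<pi> w)) (\<lambda>x1 x2. sweedler K b (\<lambda>b1 b'. sweedler K b' (\<lambda>b2 b3.
      (\<pi> a1 \<cdot>\<^bsub>H\<^esub> (x1 \<cdot>\<^bsub>H\<^esub> (\<pi> b1 \<cdot>\<^bsub>H\<^esub> antipode H (\<pi> b3))))
         \<otimes>\<^bsub>H,K\<^esub> (a2 \<cdot>\<^bsub>K\<^esub> l x2 b2))))))"
    by (simp add: Y)
  also have "\<dots> = tlift H K (coad a) (\<lambda>h m. tlift H K (coad b) (\<lambda>g n. (h \<cdot>\<^bsub>H\<^esub> g) \<otimes>\<^bsub>H,K\<^esub> pmult m n))"
    by (simp add: pmult_def tlift_coad[where U="tensor H K"]
      push sw_pi_rules[where U="tensor H K"] exchange[of K b K])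
  finally show ?thesis .
qed

text \<open>The coactions of the two components of \<open>a\<close> meet in
  \<open>S\<pi>(a3) \<pi>(a4)\<close>, which cancels.\<close>

lemma coad_comult:
  assumes [simp]: "a \<in> vcarr K"
  shows "sweedler K a (\<lambda>m n. tlift H K (coad m) (\<lambda>h m0. tlift H K (coad n) (\<lambda>g n0.
          (h \<cdot>\<^bsub>H\<^esub> g) \<otimes>\<^bsub>H,tensor K K\<^esub> (m0 \<otimes>\<^bsub>K,K\<^esub> n0)))) =
    tlift H K (coad a) (\<lambda>h n. h \<otimes>\<^bsub>H,tensor K K\<^esub> comult K n)"
proof -
  have "sweedler K a (\<lambda>m n. tlift H K (coad m) (\<lambda>h m0. tlift H K (coad n) (\<lambda>g n0.
          (h \<cdot>\<^bsub>H\<^esub> g) \<otimes>\<^bsub>H,tensor K K\<^esub> (m0 \<otimes>\<^bsub>K,K\<^esub> n0)))) =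
    sweedler K a (\<lambda>a1 q. sweedler K q (\<lambda>a2 w. sweedler K w (\<lambda>z y. sweedler K y (\<lambda>a5 a6.
       (\<pi> a1 \<cdot>\<^bsub>H\<^esub> (sweedler K z (\<lambda>a3 a4. antipode H (\<pi> a3) \<cdot>\<^bsub>H\<^esub> \<pi> a4) \<cdot>\<^bsub>H\<^esub> antipode H (\<pi> a6)))
          \<otimes>\<^bsub>H,tensor K K\<^esub> (a2 \<otimes>\<^bsub>K,K\<^esub> a5)))))"
    by (simp add: tlift_coad[where U="tensor H (tensor K K)"]
      push sw_pi_rules[where U="tensor H (tensor K K)"])
  also have "\<dots> = tlift H K (coad a) (\<lambda>h n. h \<otimes>\<^bsub>H,tensor K K\<^esub> sweedler K n (tpure K K))"
    by (simp add: spi_left) (simp add: tlift_coad[where U="tensor H (tensor K K)"]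
      push sw_pi_rules[where U="tensor H (tensor K K)"])
  also have "\<dots> = tlift H K (coad a) (\<lambda>h n. h \<otimes>\<^bsub>H,tensor K K\<^esub> comult K n)"
    by (intro tlift_cong refl) (simp_all add: comult_sweedler)
  finally show ?thesis .
qed

lemma coad_counit_morph:
  assumes [simp]: "a \<in> vcarr K"
  shows "tlift H K (coad a) (\<lambda>h n. h \<otimes>\<^bsub>H,base_field\<^esub> counit K n) = \<one>\<^bsub>H\<^esub> \<otimes>\<^bsub>H,base_field\<^esub> counit K a"
proof -
  \<comment> \<open>The second tensor factor is the field, so the counit value can be moved out as a
    scalar, where the counit law absorbs it.\<close>
  have e: "h \<otimes>\<^bsub>H,base_field\<^esub> c = vscale (tensor H base_field) c (h \<otimes>\<^bsub>H,base_field\<^esub> 1)"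
    if "h \<in> vcarr H" for h c
    using bilinear_scale2[OF bilinear_tpure, of h H "1::'k" base_field c]
      that by (simp add: vscale_base_field)
  have "tlift H K (coad a) (\<lambda>h n. h \<otimes>\<^bsub>H,base_field\<^esub> counit K n) =
     tlift H K (coad a) (\<lambda>h n. vscale (tensor H base_field) (counit K n) (h \<otimes>\<^bsub>H,base_field\<^esub> 1))"
    by (intro tlift_cong refl e) simp_all
  also have "\<dots> = sweedler K a (\<lambda>a1 a2. \<pi> a1 \<cdot>\<^bsub>H\<^esub> antipode H (\<pi> a2)) \<otimes>\<^bsub>H,base_field\<^esub> 1"
    by (simp add: tlift_coad[where U="tensor H base_field"]
      push sw_pi_rules[where U="tensor H base_field"])
  also have "\<dots> = \<one>\<^bsub>H\<^esub> \<otimes>\<^bsub>H,base_field\<^esub> counit K a"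
    by (subst (2) e) (simp_all add: spi_right push)
  finally show ?thesis .
qed

section \<open>The antipode of \<open>K_pi\<close> and compatibility of product and
  coproduct\<close>

lemma Spi_l:
  assumes [simp]: "x \<in> vcarr H" "a \<in> vcarr K"
  shows "Spi (l x a) = l x (Spi a)"
proof -
  have "l x (Spi a) = sweedler K a (\<lambda>a1 a2. l (x \<cdot>\<^bsub>H\<^esub> \<pi> a1) (antipode K a2))"
    by (simp add: Spi_def push)
  \<comment> \<open>\<open>cross\<close> moves \<open>x\<close> past \<open>\<pi>\<close> at the
    price of a right action, which is just the one that \<open>S_l\<close> absorbs.\<close>
  also have "\<dots> = sweedler H x (\<lambda>x1 x2. sweedler K a (\<lambda>a1 q. l (\<pi> (l x1 a1)) (sweedler K q (\<lambda>a2 a3.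
    l (r x2 a2) (antipode K a3)))))"
    by (simp add: cross) (simp add: push sw_pi_rules[where U=K])
  also have "\<dots> = Spi (l x a)"
    by (simp add: S_l[symmetric]) (simp add: Spi_def push sw_pi_rules[where U=K])
  finally show ?thesis by simp
qed

text \<open>\<open>coad_l\<close> gives the coaction of \<open>l (\<pi> a1) (antipode K a2)\<close>.
  The square of the antipode that arises stays inside \<open>antipode H\<close> of
  \<open>\<pi>(a3) S\<pi>(a4)\<close>, which cancels.\<close>

lemma coad_Spi:
  assumes [simp]: "a \<in> vcarr K"
  shows "coad (Spi a) = tlift H K (coad a) (\<lambda>h n. h \<otimes>\<^bsub>H,K\<^esub> Spi n)"
proof -
  have "coad (Spi a) = sweedler K a (\<lambda>a1 q. sweedler K q (\<lambda>a2 w. sweedler K w (\<lambda>z y.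
    sweedler K y (\<lambda>a5 a6.
      (\<pi> a1 \<cdot>\<^bsub>H\<^esub> (antipode H (\<pi> a6) \<cdot>\<^bsub>H\<^esub> antipode H (sweedler K z (\<lambda>a3 a4.
        \<pi> a3 \<cdot>\<^bsub>H\<^esub> antipode H (\<pi> a4)))))
        \<otimes>\<^bsub>H,K\<^esub> l (\<pi> a2) (antipode K a5)))))"
    by (simp add: Spi_def coad_l sweedler3_def tlift_coad[where U="tensor H K"]
      push sw_pi_rules[where U="tensor H K"])
  also have "\<dots> = tlift H K (coad a) (\<lambda>h n. h \<otimes>\<^bsub>H,K\<^esub> Spi n)"
    by (simp add: spi_right) (simp add: Spi_def tlift_coad[where U="tensor H K"]
      push sw_pi_rules[where U="tensor H K"])
  finally show ?thesis .
qed

text \<open>On the right side the \<open>S\<pi>\<close> of the first \<open>pmult\<close> meets the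
  \<open>\<pi>\<close> that begins the coaction, and the pair cancels.\<close>

lemma comult_pmult:
  assumes [simp]: "a \<in> vcarr K" "b \<in> vcarr K"
  shows "sweedler K (pmult a b) (tpure K K) =
          sweedler K a (\<lambda>a1 a2. sweedler K b (\<lambda>b1 b2. tlift H K (coad a2) (\<lambda>h a0.
            (pmult a1 (l h b1)) \<otimes>\<^bsub>K,K\<^esub> (pmult a0 b2))))"
proof -
  have "sweedler K a (\<lambda>a1 a2. sweedler K b (\<lambda>b1 b2. tlift H K (coad a2) (\<lambda>h a0.
            (pmult a1 (l h b1)) \<otimes>\<^bsub>K,K\<^esub> (pmult a0 b2)))) =
    sweedler K a (\<lambda>a1 q. sweedler K q (\<lambda>p w. sweedler K w (\<lambda>a4 a5. sweedler K b (\<lambda>b1 b2.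
        (a1 \<cdot>\<^bsub>K\<^esub> l (sweedler K p (\<lambda>a2 a3. antipode H (\<pi> a2) \<cdot>\<^bsub>H\<^esub> \<pi> a3) \<cdot>\<^bsub>H\<^esub> antipode H (\<pi> a5)) b1)
          \<otimes>\<^bsub>K,K\<^esub> (pmult a4 b2)))))"
    by (simp add: pmult_def tlift_coad[where U="tensor K K"]
      push sw_pi_rules[where U="tensor K K"] exchange[of K b K])
  also have "\<dots> = sweedler K (pmult a b) (tpure K K)"
    by (simp add: spi_left) (simp add: pmult_def push sw_pi_rules[where U="tensor K K"]
      exchange[of K b K])
  finally show ?thesis by simp
qed

lemma pmult_Spi_right:
  assumes [simp]: "a \<in> vcarr K"
  shows "sweedler K a (\<lambda>a1 a2. pmult a1 (Spi a2)) = vscale K (counit K a) \<one>\<^bsub>K\<^esub>"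
proof -
  have "sweedler K a (\<lambda>a1 a2. pmult a1 (Spi a2)) =
    sweedler K a (\<lambda>a1 q. sweedler K q (\<lambda>w a4. a1 \<cdot>\<^bsub>K\<^esub> l (sweedler K w (\<lambda>a2 a3. antipode H (\<pi> a2)
      \<cdot>\<^bsub>H\<^esub> \<pi> a3)) (antipode K a4)))"
    by (simp add: pmult_def Spi_def push sw_pi_rules[where U=K])
  also have "\<dots> = sweedler K a (\<lambda>a1 a2. a1 \<cdot>\<^bsub>K\<^esub> antipode K a2)"
    by (simp add: spi_left) (simp add: push sw_pi_rules[where U=K] K.antipode_right)
  also have "\<dots> = vscale K (counit K a) \<one>\<^bsub>K\<^esub>" by (simp add: K.antipode_right)
  finally show ?thesis .
qed

text \<open>\<open>r_spi\<close> solved for its term in \<open>l\<close>. It is used in the opposite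
  direction to the other eliminations: it brings in the right action where \<open>l_mult\<close> is
  to be read backwards.\<close>

lemma spi_l:
  assumes [simp]: "x \<in> vcarr H" "b \<in> vcarr K"
  shows "antipode H (\<pi> (l x b)) = sweedler H x (\<lambda>x1 x2. sweedler K b (\<lambda>b1 b2.
    r x1 b1 \<cdot>\<^bsub>H\<^esub> antipode H (\<pi> b2)) \<cdot>\<^bsub>H\<^esub> antipode H x2)"
proof -
  have "antipode H (\<pi> (l x b)) = sweedler H x (\<lambda>x1 q. antipode H (\<pi> (l x1 b))
    \<cdot>\<^bsub>H\<^esub> (vscale H (counit H q) \<one>\<^bsub>H\<^esub>))"
    by (simp add: push sw_pi_rules[where U=H])
  also have "\<dots> = sweedler H x (\<lambda>x1 q. antipode H (\<pi> (l x1 b)) \<cdot>\<^bsub>H\<^esub> sweedler H q (\<lambda>x2 x3.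
    x2 \<cdot>\<^bsub>H\<^esub> antipode H x3))"
    by (simp add: H.antipode_right)
  also have "\<dots> = sweedler H x (\<lambda>q x3. sweedler H q (\<lambda>x1 x2. antipode H (\<pi> (l x1 b)) \<cdot>\<^bsub>H\<^esub> x2)
    \<cdot>\<^bsub>H\<^esub> antipode H x3)"
    by (simp add: push sw_pi_rules[where U=H])
  also have "\<dots> = sweedler H x (\<lambda>x1 x2. sweedler K b (\<lambda>b1 b2. r x1 b1 \<cdot>\<^bsub>H\<^esub> antipode H (\<pi> b2))
    \<cdot>\<^bsub>H\<^esub> antipode H x2)"
    by (simp add: r_spi)
  finally show ?thesis .
qed

text \<open>Unlike in \<open>pmult_Spi_right\<close>, the coproduct of \<open>Spi a1\<close> is
  needed, and it yields \<open>S\<pi>\<close> of an action. After \<open>spi_l\<close> and a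
  cancellation, the sum is the action of \<open>\<pi> a1\<close> on \<open>S(a2) a3\<close>,
  expanded by \<open>l_mult\<close>.\<close>

lemma pmult_Spi_left:
  assumes [simp]: "a \<in> vcarr K"
  shows "sweedler K a (\<lambda>a1 a2. pmult (Spi a1) a2) = vscale K (counit K a) \<one>\<^bsub>K\<^esub>"
proof -
  have "sweedler K a (\<lambda>a1 a2. pmult (Spi a1) a2) =
    sweedler K a (\<lambda>p a5. sweedler K p (\<lambda>a1 a2. sweedler H (\<pi> a1) (\<lambda>x1 x2.
      sweedler K (antipode K a2) (\<lambda>b1 b2.
      l x1 b1 \<cdot>\<^bsub>K\<^esub> l (antipode H (\<pi> (l x2 b2))) a5))))"
    by (simp add: pmult_def Spi_def push sw_pi_rules[where U=K])
  also have "\<dots> = sweedler K a (\<lambda>a1 p. sweedler K p (\<lambda>a2 q. sweedler K q (\<lambda>w s.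
    sweedler K s (\<lambda>a5 t. sweedler K t (\<lambda>a6 a7.
      l (\<pi> a1) (antipode K a6) \<cdot>\<^bsub>K\<^esub> l (r (\<pi> a2) (antipode K a5)
        \<cdot>\<^bsub>H\<^esub> antipode H (sweedler K w (\<lambda>a3 a4. \<pi> a3 \<cdot>\<^bsub>H\<^esub> antipode H (\<pi> a4)))) a7)))))"
    by (simp add: spi_l) (simp add: push sw_pi_rules[where U=K])
  also have "\<dots> = sweedler K a (\<lambda>a1 p. l (\<pi> a1) (sweedler K p (\<lambda>a2 a3. antipode K a2 \<cdot>\<^bsub>K\<^esub> a3)))"
    by (simp add: spi_right) (simp add: push sw_pi_rules[where U=K])
  also have "\<dots> = vscale K (counit K a) \<one>\<^bsub>K\<^esub>"
    by (simp add: K.antipode_left) (simp add: push sw_pi_rules[where U=K])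
  finally show ?thesis .
qed

end

section \<open>The double cross product\<close>

text \<open>All constructions see a space only through \<open>vcarr\<close> and
  \<open>vscale\<close>. The records for \<open>D\<close>, \<open>K_pi\<close>, the Yetter-Drinfeld
  objects and the biproduct can thus be replaced by the plain spaces that the calculation rules
  know.\<close>

lemma same_vspace:
  assumes "vcarr V = vcarr V'" "vscale V = vscale V'"
  shows "kspace V = kspace V'" "linear_map V W f = linear_map V' W f" "linear_map X V g =
    linear_map X V' g"
    "bilinear_map V W X h = bilinear_map V' W X h" "bilinear_map W V X h' = bilinear_map W V' X h'"
    "bilinear_map W X V h'' = bilinear_map W X V' h''"
    "tpure V W = tpure V' W" "tpure W V = tpure W V'" "tensor V W = tensor V' W" "tensor W V =
      tensor W V'"
    "tlift V W = tlift V' W" "tlift W V = tlift W V'"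
proof -
  show k: "kspace V = kspace V'" using assms by (simp add: kspace_def)
  show "linear_map V W f = linear_map V' W f" "linear_map X V g = linear_map X V' g"
    using assms by (simp_all add: linear_map_def)
  show b1: "bilinear_map V W X h = bilinear_map V' W X h" for W X h
    using assms by (simp add: bilinear_map_def linear_map_def)
  show b2: "bilinear_map W V X h' = bilinear_map W V' X h'" for W X h'
    using assms by (simp add: bilinear_map_def linear_map_def)
  show "bilinear_map W X V h'' = bilinear_map W X V' h''"
    using assms by (simp add: bilinear_map_def linear_map_def)
  show p1: "tpure V W = tpure V' W"
    by (simp add: tpure_def fun_eq_iff b1)
  show p2: "tpure W V = tpure W V'"
    by (simp add: tpure_def fun_eq_iff b2)
  show "tensor V W = tensor V' W" "tensor W V = tensor W V'"
    using assms by (simp_all add: tensor_def p1 p2)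
  have "trep V W = trep V' W" "trep W V = trep W V'"
    using assms by (simp_all add: trep_def p1 p2 fun_eq_iff)
  then show "tlift V W = tlift V' W" "tlift W V = tlift W V'"
    by (simp_all add: tlift_def fun_eq_iff)
qed

lemma linear_map_times [simp]:
  "linear_map V base_field f \<Longrightarrow> linear_map V base_field (\<lambda>v. f v * c)"
  "linear_map V base_field f \<Longrightarrow> linear_map V base_field (\<lambda>v. c * f v)"
  by (auto simp: linear_map_def base_field_def algebra_simps)

context matched_hopf_pair begin

abbreviation "T \<equiv> tensor K H"
abbreviation "D \<equiv> double_cross_product H K l r"
abbreviation "dm \<equiv> double_cross_mult H K l r"

text \<open>
  The congruence rules assume membership in the carrier as it is written, so carriers of derived
  records are replaced with these rules switched off.
\<close>

lemma D_carr: "vcarr D = vcarr T" "vscale D = vscale T"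
  and mult_D [simp]: "mult D = dm" and one_D [simp]: "one D = \<one>\<^bsub>K\<^esub> \<otimes>\<^bsub>K,H\<^esub> \<one>\<^bsub>H\<^esub>"
  by (simp_all add: double_cross_product_def)

lemmas [simp] = D_carr same_vspace[OF D_carr]

lemma T_ext:
  assumes "linear_map T U f" "linear_map T U g" "t \<in> vcarr T"
    "\<And>a x. a \<in> vcarr K \<Longrightarrow> x \<in> vcarr H \<Longrightarrow> f (a \<otimes>\<^bsub>K,H\<^esub> x) = g (a \<otimes>\<^bsub>K,H\<^esub> x)"
  shows "f t = g t"
  by (rule linear_map_tensor_unique[OF K.kspace H.kspace assms(1,2,4,3)])

lemma T_ball:
  assumes "linear_map T U f" "linear_map T U g"
    "\<And>a x. a \<in> vcarr K \<Longrightarrow> x \<in> vcarr H \<Longrightarrow> f (a \<otimes>\<^bsub>K,H\<^esub> x) = g (a \<otimes>\<^bsub>K,H\<^esub> x)"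
  shows "\<forall>t\<in>vcarr T. f t = g t"
  using T_ext[OF assms(1,2) _ assms(3)] by blast

section \<open>The algebra structure of the double cross product\<close>

lemma dm_bil: "bilinear_map T T T dm"
  unfolding double_cross_mult_def[abs_def] by simp

lemmas [simp] = bilinear_closed[OF dm_bil] bilinear_lin1[OF dm_bil] bilinear_lin2[OF dm_bil]
  bilinear_mapD(1)[OF dm_bil]
lemmas [push] = bilinear_sweedler1[OF dm_bil] bilinear_sweedler2[OF dm_bil]
  bilinear_scale1[OF dm_bil] bilinear_scale2[OF dm_bil]

lemma dm_pure [push]:
  assumes [simp]: "a \<in> vcarr K" "b \<in> vcarr K" "x \<in> vcarr H" "y \<in> vcarr H"
  shows "dm (a \<otimes>\<^bsub>K,H\<^esub> x) (b \<otimes>\<^bsub>K,H\<^esub> y) =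
    sweedler H x (\<lambda>x1 x2. sweedler K b (\<lambda>b1 b2. (a \<cdot>\<^bsub>K\<^esub> l x1 b1) \<otimes>\<^bsub>K,H\<^esub> (r x2 b2 \<cdot>\<^bsub>H\<^esub> y)))"
  by (simp add: double_cross_mult_def tlift_pure[where U=T])

text \<open>\<open>l_mult\<close> expands the left action on the \<open>K\<close>-part of the inner
  product and \<open>r_mult\<close> the right action on the \<open>H\<close>-part; with them both
  sides have the same normal form.\<close>

lemma dm_assoc_pure:
  assumes [simp]: "a \<in> vcarr K" "b \<in> vcarr K" "c \<in> vcarr K" "x \<in> vcarr H" "y \<in> vcarr H"
    "z \<in> vcarr H"
  shows "dm (dm (a \<otimes>\<^bsub>K,H\<^esub> x) (b \<otimes>\<^bsub>K,H\<^esub> y)) (c \<otimes>\<^bsub>K,H\<^esub> z) = dm (a \<otimes>\<^bsub>K,H\<^esub> x) (dm (b \<otimes>\<^bsub>K,H\<^esub> y)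
    (c \<otimes>\<^bsub>K,H\<^esub> z))"
  by (simp add: push sw[where U=T] exchange[of H y H] exchange[of K c K])

text \<open>Linear maps are determined on pure tensors, so the arguments are generalised one at a
  time, beginning with the rightmost.\<close>

lemma dm_assoc:
  assumes [simp]: "s \<in> vcarr T" "t \<in> vcarr T" "u \<in> vcarr T"
  shows "dm (dm s t) u = dm s (dm t u)"
proof -
  have 1: "dm (dm (a \<otimes>\<^bsub>K,H\<^esub> x) (b \<otimes>\<^bsub>K,H\<^esub> y)) u = dm (a \<otimes>\<^bsub>K,H\<^esub> x) (dm (b \<otimes>\<^bsub>K,H\<^esub> y) u)"
    if [simp]: "a \<in> vcarr K" "b \<in> vcarr K" "x \<in> vcarr H" "y \<in> vcarr H" for a b x y
    by (rule T_ext[where t=u and U=T]) (simp_all add: dm_assoc_pure)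
  have 2: "dm (dm (a \<otimes>\<^bsub>K,H\<^esub> x) t) u = dm (a \<otimes>\<^bsub>K,H\<^esub> x) (dm t u)"
    if [simp]: "a \<in> vcarr K" "x \<in> vcarr H" for a x
    by (rule T_ext[where t=t and U=T]) (simp_all add: 1)
  show ?thesis
    by (rule T_ext[where t=s and U=T]) (simp_all add: 2)
qed

lemma dm_one:
  assumes [simp]: "t \<in> vcarr T"
  shows "dm (\<one>\<^bsub>K\<^esub> \<otimes>\<^bsub>K,H\<^esub> \<one>\<^bsub>H\<^esub>) t = t" "dm t (\<one>\<^bsub>K\<^esub> \<otimes>\<^bsub>K,H\<^esub> \<one>\<^bsub>H\<^esub>) = t"
proof -
  show "dm (\<one>\<^bsub>K\<^esub> \<otimes>\<^bsub>K,H\<^esub> \<one>\<^bsub>H\<^esub>) t = t"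
    by (rule T_ext[where t=t and U=T]) (simp_all add: push sw[where U=T])
  show "dm t (\<one>\<^bsub>K\<^esub> \<otimes>\<^bsub>K,H\<^esub> \<one>\<^bsub>H\<^esub>) = t"
    by (rule T_ext[where t=t and U=T]) (simp_all add: push sw[where U=T])
qed

section \<open>The coalgebra structure of the double cross product\<close>

lemma comult_D_lin: "linear_map T (tensor T T) (comult D)"
  by (simp add: double_cross_product_def)

lemma cospace_D [simp]: "cospace D"
  using comult_D_lin by (simp add: cospace_def)

lemmas [simp] = lin_sweedler_body[where C=D, unfolded D_carr]
  sweedler_closed[where C=D, unfolded D_carr]

lemma sw_D:
  assumes U: "kspace U" and f: "bilinear_map T T U f" and [simp]: "a \<in> vcarr K" "x \<in> vcarr H"
  shows "sweedler D (a \<otimes>\<^bsub>K,H\<^esub> x) f = sweedler K a (\<lambda>a1 a2. sweedler H x (\<lambda>x1 x2. f (a1 \<otimes>\<^bsub>K,H\<^esub> x1)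
    (a2 \<otimes>\<^bsub>K,H\<^esub> x2)))"
proof -
  have L: "linear_map (tensor T T) U (\<lambda>t. tlift T T t f)"
    by (intro tlift_linear kspace_tensor U f)
  have "comult D (a \<otimes>\<^bsub>K,H\<^esub> x) = sweedler K a (\<lambda>a1 a2. sweedler H x (\<lambda>x1 x2.
          (a1 \<otimes>\<^bsub>K,H\<^esub> x1) \<otimes>\<^bsub>tensor K H,tensor K H\<^esub> (a2 \<otimes>\<^bsub>K,H\<^esub> x2)))"
    by (simp add: double_cross_product_def tlift_pure[where U="tensor T T"])
  then show ?thesis unfolding sweedler_def[of D]
    by (simp add: linear_map_sweedler[OF L] tlift_pure[OF _ _ U f])
qed

lemma counit_D_lin: "linear_map T base_field (counit D)"
  by (simp add: double_cross_product_def)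

lemmas [simp] = counit_D_lin linear_map_comp[OF counit_D_lin]
lemmas [push] = linear_map_sweedler[OF counit_D_lin] linear_mapD(3)[OF counit_D_lin]

lemma counit_D_pure [push]: "a \<in> vcarr K \<Longrightarrow> x \<in> vcarr H \<Longrightarrow> counit D (a \<otimes>\<^bsub>K,H\<^esub> x) =
  counit K a * counit H x"
  by (simp add: double_cross_product_def tlift_pure[where U=base_field])

lemmas sw_D_rules = sw sw_D sweedler_sweedler[OF _ cospace_D]

lemma coalg_D: "coalg D"
proof -
  have "\<forall>t\<in>vcarr T. sweedler D t (\<lambda>x1 x2. sweedler D x1 (\<lambda>y z. y \<otimes>\<^bsub>T,tensor T T\<^esub> (z \<otimes>\<^bsub>T,T\<^esub> x2)))
      = sweedler D t (\<lambda>x1 x2. sweedler D x2 (\<lambda>y z. x1 \<otimes>\<^bsub>T,tensor T T\<^esub> (y \<otimes>\<^bsub>T,T\<^esub> z)))"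
    by (rule T_ball[where U="tensor T (tensor T T)"])
       (simp_all add: push sw_D_rules[where U="tensor T (tensor T T)"])
  moreover have "sweedler D t (\<lambda>x1 x2. vscale T (counit D x1) x2) = t" if [simp]: "t \<in> vcarr T"
    for t
    by (rule T_ext[where t=t and U=T]) (simp_all add: push sw_D_rules[where U=T])
  moreover have "sweedler D t (\<lambda>x1 x2. vscale T (counit D x2) x1) = t" if [simp]: "t \<in> vcarr T"
    for t
    by (rule T_ext[where t=t and U=T]) (simp_all add: push sw_D_rules[where U=T])
  ultimately show ?thesis
    using comult_D_lin counit_D_lin by (simp add: counital_coalgebra_def cong del: sweedler_cong)
qed

section \<open>Multiplicativity of counit and coproduct\<close>

lemma counit_dm:
  assumes [simp]: "s \<in> vcarr T" "t \<in> vcarr T"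
  shows "counit D (dm s t) = counit D s * counit D t"
proof -
  have 1: "counit D (dm (a \<otimes>\<^bsub>K,H\<^esub> x) t) = counit D (a \<otimes>\<^bsub>K,H\<^esub> x) * counit D t"
    if [simp]: "a \<in> vcarr K" "x \<in> vcarr H" for a x
  proof (rule T_ext[where t=t and U=base_field])
    fix b y assume [simp]: "b \<in> vcarr K" "y \<in> vcarr H"
    have "counit D (dm (a \<otimes>\<^bsub>K,H\<^esub> x) (b \<otimes>\<^bsub>K,H\<^esub> y)) =
      sweedler H x (\<lambda>x1 x2. sweedler K b (\<lambda>b1 b2.
        vscale base_field (counit K b1) (vscale base_field (counit K b2)
          (vscale base_field (counit H x1) (vscale base_field (counit H x2)
         (counit K a * counit H y))))))"
      by (simp add: push ac_simps)
    also have "\<dots> = counit D (a \<otimes>\<^bsub>K,H\<^esub> x) * counit D (b \<otimes>\<^bsub>K,H\<^esub> y)"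
      by (simp add: sw[where U=base_field]) (simp add: push ac_simps)
    finally show "counit D (dm (a \<otimes>\<^bsub>K,H\<^esub> x) (b \<otimes>\<^bsub>K,H\<^esub> y)) = counit D (a \<otimes>\<^bsub>K,H\<^esub> x)
      * counit D (b \<otimes>\<^bsub>K,H\<^esub> y)" .
  qed simp_all
  show ?thesis
    by (rule T_ext[where t=s and U=base_field]) (simp_all add: 1)
qed

text \<open>The coproduct of the product places \<open>r x3 b3\<close> in the first tensor factor
  and \<open>l x2 b2\<close> in the second, whereas the product of the coproducts has
  \<open>r x2 b2\<close> and \<open>l x3 b3\<close> there. The exchange axiom identifies the
  two.\<close>

lemma comult_dm:
  assumes [simp]: "s \<in> vcarr T" "t \<in> vcarr T"
  shows "comult D (dm s t) = sweedler D s (\<lambda>s1 s2. sweedler D t (\<lambda>t1 t2. dm s1 t1 \<otimes>\<^bsub>T,T\<^esub> dm s2 t2))"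
proof -
  have 0: "sweedler D (dm (a \<otimes>\<^bsub>K,H\<^esub> x) (b \<otimes>\<^bsub>K,H\<^esub> y)) (tpure T T) =
     sweedler D (a \<otimes>\<^bsub>K,H\<^esub> x) (\<lambda>s1 s2. sweedler D (b \<otimes>\<^bsub>K,H\<^esub> y) (\<lambda>t1 t2. dm s1 t1 \<otimes>\<^bsub>T,T\<^esub> dm s2 t2))"
    if [simp]: "a \<in> vcarr K" "x \<in> vcarr H" "b \<in> vcarr K" "y \<in> vcarr H" for a x b y
  proof -
    have c: "sweedler H x (\<lambda>x2 x3. sweedler K b (\<lambda>b2 b3. ((a1 \<cdot>\<^bsub>K\<^esub> l x1 b1)
      \<otimes>\<^bsub>K,H\<^esub> (r x3 b3 \<cdot>\<^bsub>H\<^esub> y1)) \<otimes>\<^bsub>T,T\<^esub>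
        ((a2 \<cdot>\<^bsub>K\<^esub> l x2 b2) \<otimes>\<^bsub>K,H\<^esub> (r x4 b4 \<cdot>\<^bsub>H\<^esub> y2)))) =
     sweedler H x (\<lambda>x2 x3. sweedler K b (\<lambda>b2 b3. ((a1 \<cdot>\<^bsub>K\<^esub> l x1 b1) \<otimes>\<^bsub>K,H\<^esub> (r x2 b2 \<cdot>\<^bsub>H\<^esub> y1)) \<otimes>\<^bsub>T,T\<^esub>
        ((a2 \<cdot>\<^bsub>K\<^esub> l x3 b3) \<otimes>\<^bsub>K,H\<^esub> (r x4 b4 \<cdot>\<^bsub>H\<^esub> y2))))"
      if "x \<in> vcarr H" "b \<in> vcarr K" "a1 \<in> vcarr K" "a2 \<in> vcarr K" "b1 \<in> vcarr K" "b4 \<in> vcarr K"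
         "x1 \<in> vcarr H" "x4 \<in> vcarr H" "y1 \<in> vcarr H" "y2 \<in> vcarr H" for x b a1 a2 x1 x4 y1 y2 b1 b4
      using that by (intro compat_gen[where U="tensor T T" and f="\<lambda>u v. ((a1 \<cdot>\<^bsub>K\<^esub> l x1 b1)
        \<otimes>\<^bsub>K,H\<^esub> (v \<cdot>\<^bsub>H\<^esub> y1)) \<otimes>\<^bsub>T,T\<^esub>
        ((a2 \<cdot>\<^bsub>K\<^esub> u) \<otimes>\<^bsub>K,H\<^esub> (r x4 b4 \<cdot>\<^bsub>H\<^esub> y2))"]) simp_all
    have "sweedler D (dm (a \<otimes>\<^bsub>K,H\<^esub> x) (b \<otimes>\<^bsub>K,H\<^esub> y)) (tpure T T) =
      sweedler K a (\<lambda>a1 a2. sweedler H x (\<lambda>x1 p. sweedler K b (\<lambda>b1 q. sweedler H p (\<lambda>w x4.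
        sweedler K q (\<lambda>z b4.
       sweedler H y (\<lambda>y1 y2.
      sweedler H w (\<lambda>x2 x3. sweedler K z (\<lambda>b2 b3. ((a1 \<cdot>\<^bsub>K\<^esub> l x1 b1) \<otimes>\<^bsub>K,H\<^esub> (r x3 b3 \<cdot>\<^bsub>H\<^esub> y1))
        \<otimes>\<^bsub>T,T\<^esub>
        ((a2 \<cdot>\<^bsub>K\<^esub> l x2 b2) \<otimes>\<^bsub>K,H\<^esub> (r x4 b4 \<cdot>\<^bsub>H\<^esub> y2)))))))))) "
      by (simp add: push sw_D_rules[where U="tensor T T"] exchange[of K b K] exchange[of H y H])
    also have "\<dots> = sweedler D (a \<otimes>\<^bsub>K,H\<^esub> x) (\<lambda>s1 s2. sweedler D (b \<otimes>\<^bsub>K,H\<^esub> y) (\<lambda>t1 t2.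
      dm s1 t1 \<otimes>\<^bsub>T,T\<^esub> dm s2 t2))"
      by (simp add: c) (simp add: push sw_D_rules[where U="tensor T T"] exchange[of K b K]
        exchange[of H y H])
    finally show ?thesis .
  qed
  have 1: "\<forall>t\<in>vcarr T. sweedler D (dm (a \<otimes>\<^bsub>K,H\<^esub> x) t) (tpure T T) =
     sweedler D (a \<otimes>\<^bsub>K,H\<^esub> x) (\<lambda>s1 s2. sweedler D t (\<lambda>t1 t2. dm s1 t1 \<otimes>\<^bsub>T,T\<^esub> dm s2 t2))"
    if [simp]: "a \<in> vcarr K" "x \<in> vcarr H" for a x
    by (rule T_ball[where U="tensor T T"]) (simp_all add: 0)
  have 2: "\<forall>s\<in>vcarr T. sweedler D (dm s t) (tpure T T) = sweedler D s (\<lambda>s1 s2.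
    sweedler D t (\<lambda>t1 t2. dm s1 t1 \<otimes>\<^bsub>T,T\<^esub> dm s2 t2))"
    by (rule T_ball[where U="tensor T T"]) (simp_all add: 1)
  show ?thesis by (simp add: comult_sweedler 2)
qed

section \<open>The antipode of the double cross product\<close>

abbreviation "SD \<equiv> antipode D"

lemma SD_lin: "linear_map T T SD"
  by (simp add: double_cross_product_def)

lemmas [simp] = linear_mapD(1)[OF SD_lin] SD_lin linear_map_comp[OF SD_lin]

lemma SD_pure:
  "a \<in> vcarr K \<Longrightarrow> x \<in> vcarr H \<Longrightarrow> SD (a \<otimes>\<^bsub>K,H\<^esub> x) =
    dm (\<one>\<^bsub>K\<^esub> \<otimes>\<^bsub>K,H\<^esub> antipode H x) (antipode K a \<otimes>\<^bsub>K,H\<^esub> \<one>\<^bsub>H\<^esub>)"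
  by (simp add: double_cross_product_def tlift_pure[where U=T])

lemma dm_KK: "a \<in> vcarr K \<Longrightarrow> b \<in> vcarr K \<Longrightarrow> dm (a \<otimes>\<^bsub>K,H\<^esub> \<one>\<^bsub>H\<^esub>) (b \<otimes>\<^bsub>K,H\<^esub> \<one>\<^bsub>H\<^esub>) = (a \<cdot>\<^bsub>K\<^esub> b)
  \<otimes>\<^bsub>K,H\<^esub> \<one>\<^bsub>H\<^esub>"
  by (simp add: push sw[where U=T])

lemma dm_HH: "x \<in> vcarr H \<Longrightarrow> y \<in> vcarr H \<Longrightarrow> dm (\<one>\<^bsub>K\<^esub> \<otimes>\<^bsub>K,H\<^esub> x) (\<one>\<^bsub>K\<^esub> \<otimes>\<^bsub>K,H\<^esub> y) =
  \<one>\<^bsub>K\<^esub> \<otimes>\<^bsub>K,H\<^esub> (x \<cdot>\<^bsub>H\<^esub> y)"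
  by (simp add: push sw[where U=T])

lemma dm_KH: "a \<in> vcarr K \<Longrightarrow> x \<in> vcarr H \<Longrightarrow> dm (a \<otimes>\<^bsub>K,H\<^esub> \<one>\<^bsub>H\<^esub>) (\<one>\<^bsub>K\<^esub> \<otimes>\<^bsub>K,H\<^esub> x) = a \<otimes>\<^bsub>K,H\<^esub> x"
  by (simp add: push sw[where U=T])

text \<open>With \<open>a \<otimes> x\<close> written as
  \<open>(a \<otimes> 1) (1 \<otimes> x)\<close>, associativity brings the two
  \<open>K\<close>-parts together; they cancel, and then the \<open>H\<close>-parts do. In
  \<open>SD_right_pure\<close> the order is reversed.\<close>

lemma SD_left_pure:
  assumes [simp]: "a \<in> vcarr K" "x \<in> vcarr H"
  shows "sweedler K a (\<lambda>a1 a2. sweedler H x (\<lambda>x1 x2. dm (SD (a1 \<otimes>\<^bsub>K,H\<^esub> x1)) (a2 \<otimes>\<^bsub>K,H\<^esub> x2))) =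
    vscale T (counit K a * counit H x) (\<one>\<^bsub>K\<^esub> \<otimes>\<^bsub>K,H\<^esub> \<one>\<^bsub>H\<^esub>)"
proof -
  have e: "dm (SD (a1 \<otimes>\<^bsub>K,H\<^esub> x1)) (a2 \<otimes>\<^bsub>K,H\<^esub> x2) =
     dm (\<one>\<^bsub>K\<^esub> \<otimes>\<^bsub>K,H\<^esub> antipode H x1) (dm ((antipode K a1 \<cdot>\<^bsub>K\<^esub> a2) \<otimes>\<^bsub>K,H\<^esub> \<one>\<^bsub>H\<^esub>) (\<one>\<^bsub>K\<^esub> \<otimes>\<^bsub>K,H\<^esub> x2))"
    if [simp]: "a1 \<in> vcarr K" "a2 \<in> vcarr K" "x1 \<in> vcarr H" "x2 \<in> vcarr H" for a1 a2 x1 x2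
  proof -
    have "dm (SD (a1 \<otimes>\<^bsub>K,H\<^esub> x1)) (a2 \<otimes>\<^bsub>K,H\<^esub> x2) =
      dm (dm (\<one>\<^bsub>K\<^esub> \<otimes>\<^bsub>K,H\<^esub> antipode H x1) (antipode K a1 \<otimes>\<^bsub>K,H\<^esub> \<one>\<^bsub>H\<^esub>)) (dm (a2 \<otimes>\<^bsub>K,H\<^esub> \<one>\<^bsub>H\<^esub>)
        (\<one>\<^bsub>K\<^esub> \<otimes>\<^bsub>K,H\<^esub> x2))"
      by (simp add: SD_pure dm_KH)
    also have "\<dots> = dm (\<one>\<^bsub>K\<^esub> \<otimes>\<^bsub>K,H\<^esub> antipode H x1) (dm (dm (antipode K a1 \<otimes>\<^bsub>K,H\<^esub> \<one>\<^bsub>H\<^esub>)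
      (a2 \<otimes>\<^bsub>K,H\<^esub> \<one>\<^bsub>H\<^esub>)) (\<one>\<^bsub>K\<^esub> \<otimes>\<^bsub>K,H\<^esub> x2))"
      by (simp add: dm_assoc)
    finally show ?thesis by (simp add: dm_KK)
  qed
  have "sweedler K a (\<lambda>a1 a2. sweedler H x (\<lambda>x1 x2. dm (SD (a1 \<otimes>\<^bsub>K,H\<^esub> x1)) (a2 \<otimes>\<^bsub>K,H\<^esub> x2))) =
    sweedler H x (\<lambda>x1 x2. sweedler K a (\<lambda>a1 a2. dm (\<one>\<^bsub>K\<^esub> \<otimes>\<^bsub>K,H\<^esub> antipode H x1)
      (dm ((antipode K a1 \<cdot>\<^bsub>K\<^esub> a2) \<otimes>\<^bsub>K,H\<^esub> \<one>\<^bsub>H\<^esub>) (\<one>\<^bsub>K\<^esub> \<otimes>\<^bsub>K,H\<^esub> x2))))"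
    by (simp add: e) (simp only: sweedler_exchange[of K _ H])
  also have "\<dots> = sweedler H x (\<lambda>x1 x2. dm (\<one>\<^bsub>K\<^esub> \<otimes>\<^bsub>K,H\<^esub> antipode H x1) (dm (sweedler K a (\<lambda>a1 a2.
    antipode K a1 \<cdot>\<^bsub>K\<^esub> a2) \<otimes>\<^bsub>K,H\<^esub> \<one>\<^bsub>H\<^esub>) (\<one>\<^bsub>K\<^esub> \<otimes>\<^bsub>K,H\<^esub> x2)))"
    by (simp add: bilinear_sweedler1[OF bilinear_tpure] bilinear_sweedler1[OF dm_bil]
      bilinear_sweedler2[OF dm_bil])
  also have "\<dots> = sweedler H x (\<lambda>x1 x2. vscale T (counit K a) (\<one>\<^bsub>K\<^esub> \<otimes>\<^bsub>K,H\<^esub> (antipode H x1 \<cdot>\<^bsub>H\<^esub> x2)))"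
    by (simp add: K.antipode_left bilinear_scale1[OF bilinear_tpure] bilinear_scale1[OF dm_bil]
      bilinear_scale2[OF dm_bil] dm_HH H.one_mult)
  also have "\<dots> = vscale T (counit K a) (\<one>\<^bsub>K\<^esub> \<otimes>\<^bsub>K,H\<^esub> sweedler H x (\<lambda>x1 x2. antipode H x1 \<cdot>\<^bsub>H\<^esub> x2))"
    by (simp add: push sw[where U=T])
  also have "\<dots> = vscale T (counit K a * counit H x) (\<one>\<^bsub>K\<^esub> \<otimes>\<^bsub>K,H\<^esub> \<one>\<^bsub>H\<^esub>)"
    by (simp add: H.antipode_left) (simp add: push)
  finally show ?thesis .
qed

lemma SD_right_pure:
  assumes [simp]: "a \<in> vcarr K" "x \<in> vcarr H"
  shows "sweedler K a (\<lambda>a1 a2. sweedler H x (\<lambda>x1 x2. dm (a1 \<otimes>\<^bsub>K,H\<^esub> x1) (SD (a2 \<otimes>\<^bsub>K,H\<^esub> x2)))) =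
    vscale T (counit K a * counit H x) (\<one>\<^bsub>K\<^esub> \<otimes>\<^bsub>K,H\<^esub> \<one>\<^bsub>H\<^esub>)"
proof -
  have e: "dm (a1 \<otimes>\<^bsub>K,H\<^esub> x1) (SD (a2 \<otimes>\<^bsub>K,H\<^esub> x2)) =
     dm (a1 \<otimes>\<^bsub>K,H\<^esub> \<one>\<^bsub>H\<^esub>) (dm (\<one>\<^bsub>K\<^esub> \<otimes>\<^bsub>K,H\<^esub> (x1 \<cdot>\<^bsub>H\<^esub> antipode H x2)) (antipode K a2 \<otimes>\<^bsub>K,H\<^esub> \<one>\<^bsub>H\<^esub>))"
    if [simp]: "a1 \<in> vcarr K" "a2 \<in> vcarr K" "x1 \<in> vcarr H" "x2 \<in> vcarr H" for a1 a2 x1 x2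
  proof -
    have "dm (a1 \<otimes>\<^bsub>K,H\<^esub> x1) (SD (a2 \<otimes>\<^bsub>K,H\<^esub> x2)) =
      dm (dm (a1 \<otimes>\<^bsub>K,H\<^esub> \<one>\<^bsub>H\<^esub>) (\<one>\<^bsub>K\<^esub> \<otimes>\<^bsub>K,H\<^esub> x1)) (dm (\<one>\<^bsub>K\<^esub> \<otimes>\<^bsub>K,H\<^esub> antipode H x2)
        (antipode K a2 \<otimes>\<^bsub>K,H\<^esub> \<one>\<^bsub>H\<^esub>))"
      by (simp add: SD_pure dm_KH)
    also have "\<dots> = dm (a1 \<otimes>\<^bsub>K,H\<^esub> \<one>\<^bsub>H\<^esub>) (dm (dm (\<one>\<^bsub>K\<^esub> \<otimes>\<^bsub>K,H\<^esub> x1) (\<one>\<^bsub>K\<^esub> \<otimes>\<^bsub>K,H\<^esub> antipode H x2))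
      (antipode K a2 \<otimes>\<^bsub>K,H\<^esub> \<one>\<^bsub>H\<^esub>))"
      by (simp add: dm_assoc)
    finally show ?thesis by (simp add: dm_HH)
  qed
  have "sweedler K a (\<lambda>a1 a2. sweedler H x (\<lambda>x1 x2. dm (a1 \<otimes>\<^bsub>K,H\<^esub> x1) (SD (a2 \<otimes>\<^bsub>K,H\<^esub> x2)))) =
    sweedler K a (\<lambda>a1 a2. dm (a1 \<otimes>\<^bsub>K,H\<^esub> \<one>\<^bsub>H\<^esub>) (dm (\<one>\<^bsub>K\<^esub> \<otimes>\<^bsub>K,H\<^esub> sweedler H x (\<lambda>x1 x2.
      x1 \<cdot>\<^bsub>H\<^esub> antipode H x2)) (antipode K a2 \<otimes>\<^bsub>K,H\<^esub> \<one>\<^bsub>H\<^esub>)))"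
    by (simp add: e bilinear_sweedler2[OF bilinear_tpure] bilinear_sweedler1[OF dm_bil]
      bilinear_sweedler2[OF dm_bil])
  also have "\<dots> = sweedler K a (\<lambda>a1 a2. vscale T (counit H x) ((a1 \<cdot>\<^bsub>K\<^esub> antipode K a2) \<otimes>\<^bsub>K,H\<^esub> \<one>\<^bsub>H\<^esub>))"
    by (simp add: H.antipode_right bilinear_scale2[OF bilinear_tpure] bilinear_scale1[OF dm_bil]
      bilinear_scale2[OF dm_bil] dm_KK K.one_mult)
  also have "\<dots> = vscale T (counit H x) (sweedler K a (\<lambda>a1 a2. a1 \<cdot>\<^bsub>K\<^esub> antipode K a2) \<otimes>\<^bsub>K,H\<^esub> \<one>\<^bsub>H\<^esub>)"
    by (simp add: push sw[where U=T])
  also have "\<dots> = vscale T (counit K a * counit H x) (\<one>\<^bsub>K\<^esub> \<otimes>\<^bsub>K,H\<^esub> \<one>\<^bsub>H\<^esub>)"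
    by (simp add: K.antipode_right) (simp add: push)
  finally show ?thesis .
qed

lemma antipode_D:
  assumes [simp]: "t \<in> vcarr T"
  shows "sweedler D t (\<lambda>t1 t2. dm (SD t1) t2) = vscale T (counit D t) (\<one>\<^bsub>K\<^esub> \<otimes>\<^bsub>K,H\<^esub> \<one>\<^bsub>H\<^esub>)"
    "sweedler D t (\<lambda>t1 t2. dm t1 (SD t2)) = vscale T (counit D t) (\<one>\<^bsub>K\<^esub> \<otimes>\<^bsub>K,H\<^esub> \<one>\<^bsub>H\<^esub>)"
proof -
  show "sweedler D t (\<lambda>t1 t2. dm (SD t1) t2) = vscale T (counit D t) (\<one>\<^bsub>K\<^esub> \<otimes>\<^bsub>K,H\<^esub> \<one>\<^bsub>H\<^esub>)"
    by (rule T_ext[where t=t and U=T]) (simp_all add: sw_D[where U=T] counit_D_pure SD_left_pure)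
  show "sweedler D t (\<lambda>t1 t2. dm t1 (SD t2)) = vscale T (counit D t) (\<one>\<^bsub>K\<^esub> \<otimes>\<^bsub>K,H\<^esub> \<one>\<^bsub>H\<^esub>)"
    by (rule T_ext[where t=t and U=T]) (simp_all add: sw_D[where U=T] counit_D_pure SD_right_pure)
qed

lemma hopf_D: "hopf_algebra D"
proof -
  have "comult D (\<one>\<^bsub>K\<^esub> \<otimes>\<^bsub>K,H\<^esub> \<one>\<^bsub>H\<^esub>) = (\<one>\<^bsub>K\<^esub> \<otimes>\<^bsub>K,H\<^esub> \<one>\<^bsub>H\<^esub>) \<otimes>\<^bsub>T,T\<^esub> (\<one>\<^bsub>K\<^esub> \<otimes>\<^bsub>K,H\<^esub> \<one>\<^bsub>H\<^esub>)"
    by (simp add: comult_sweedler sw_D_rules[where U="tensor T T"])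
  then show ?thesis
    using dm_bil coalg_D SD_lin
    by (simp add: hopf_algebra_def unital_algebra_def counit_algebra_map_def antipode_axioms_def
      dm_assoc dm_one
      counit_dm comult_dm antipode_D counit_D_pure push cong del: sweedler_cong)
qed

end

section \<open>Transport of structure along a linear bijection\<close>

lemma tensor_ball:
  assumes "kspace V" "kspace W" "linear_map (tensor V W) U f" "linear_map (tensor V W) U g"
    "\<And>a x. a \<in> vcarr V \<Longrightarrow> x \<in> vcarr W \<Longrightarrow> f (a \<otimes>\<^bsub>V,W\<^esub> x) = g (a \<otimes>\<^bsub>V,W\<^esub> x)"
  shows "\<forall>t\<in>vcarr (tensor V W). f t = g t"
  using linear_map_tensor_unique[OF assms(1-5)] by blast

lemma linear_map_cong:
  assumes "kspace V" "\<And>v. v \<in> vcarr V \<Longrightarrow> f v = g v"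
  shows "linear_map V W f = linear_map V W g"
  using assms kspaceD[OF assms(1)] by (auto simp: linear_map_def)

lemma bilinear_map_cong:
  assumes "kspace V" "kspace W" "\<And>v w. v \<in> vcarr V \<Longrightarrow> w \<in> vcarr W \<Longrightarrow> f v w = g v w"
  shows "bilinear_map V W U f = bilinear_map V W U g"
  using linear_map_cong[OF assms(1)] linear_map_cong[OF assms(2)] assms(3)
  unfolding bilinear_map_def by (smt (verit))

lemma tlift_sweedler:
  assumes "kspace V" "kspace W" "kspace U" "bilinear_map V W U g" "cospace C" "x \<in> vcarr C"
    "\<And>c d. c \<in> vcarr C \<Longrightarrow> d \<in> vcarr C \<Longrightarrow> f c d \<in> vcarr (tensor V W)"
  shows "tlift V W (sweedler C x f) g = sweedler C x (\<lambda>c d. tlift V W (f c d) g)"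
  by (rule linear_map_sweedler[OF tlift_linear[OF assms(1-4)]]) (use assms in auto)

lemma tlift_tlift:
  assumes "kspace V" "kspace W" "kspace U" "bilinear_map V W U g" "kspace X" "kspace Y"
    "t \<in> vcarr (tensor X Y)"
    "\<And>c d. c \<in> vcarr X \<Longrightarrow> d \<in> vcarr Y \<Longrightarrow> f c d \<in> vcarr (tensor V W)"
  shows "tlift V W (tlift X Y t f) g = tlift X Y t (\<lambda>c d. tlift V W (f c d) g)"
  by (rule linear_map_tlift[OF tlift_linear[OF assms(1-4)]]) (use assms in auto)

lemma tlift_scale:
  assumes "kspace V" "kspace W" "kspace U" "bilinear_map V W U g" "t \<in> vcarr (tensor V W)"
  shows "tlift V W (vscale (tensor V W) c t) g = vscale U c (tlift V W t g)"
  using linear_mapD(3)[OF tlift_linear[OF assms(1-4)]] assms by auto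

lemmas tlift_simps = tlift_sweedler tlift_tlift tlift_scale tlift_pure

text \<open>The structure maps of the target are known only on images under \<open>f\<close>. As
  \<open>f\<close> is linear and onto, linearity can be checked there.\<close>

lemma linear_map_transport:
  assumes "linear_map A B f" "bij_betw f (vcarr A) (vcarr B)" "kspace A" "linear_map A U (\<lambda>x.
    h (f x))"
  shows "linear_map B U h"
proof (rule linear_mapI)
  have ex: "\<exists>x\<in>vcarr A. f x = v" if "v \<in> vcarr B" for v
    using that bij_betw_imp_surj_on[OF assms(2), symmetric] by auto
  note f = linear_mapD[OF assms(1)] and h = linear_mapD[OF assms(4)]
  show "h v \<in> vcarr U" if "v \<in> vcarr B" for v
    using ex[OF that] h(1) by auto
  show "h (u + v) = h u + h v" if "u \<in> vcarr B" "v \<in> vcarr B" for u v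
    using ex[OF that(1)] ex[OF that(2)] f(2) h(2) by fastforce
  show "h (vscale B c v) = vscale U c (h v)" if "v \<in> vcarr B" for c v
    using ex[OF that] f(3) h(3) by fastforce
qed

lemma sweedler_transport:
  assumes [simp]: "cospace A" "kspace B" and f: "linear_map A B f"
    and comult: "\<And>x. x \<in> vcarr A \<Longrightarrow> comult B (f x) = sweedler A x (\<lambda>x1 x2. f x1 \<otimes>\<^bsub>B,B\<^esub> f x2)"
    and "kspace U" "bilinear_map B B U g" "x \<in> vcarr A"
  shows "sweedler B (f x) g = sweedler A x (\<lambda>u v. g (f u) (f v))"
  using assms(5-) linear_mapD(1)[OF f] by (simp add: sweedler_def[of B]
    comult tlift_simps[where U=U])

text \<open>By surjectivity each axiom of \<open>B\<close> is a statement about images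
  \<open>f x\<close>, and there it is the image of the axiom of \<open>H\<close>. The structure maps
  of \<open>B\<close> are given beforehand, because the biproduct comes with its own
  formulas.\<close>

lemma (in hopf) hopf_transport:
  assumes f: "linear_map H B f" and bij: "bij_betw f (vcarr H) (vcarr B)" and B [simp]: "kspace B"
    and mult: "\<And>x y. x \<in> vcarr H \<Longrightarrow> y \<in> vcarr H \<Longrightarrow> f x \<cdot>\<^bsub>B\<^esub> f y = f (x \<cdot>\<^bsub>H\<^esub> y)"
    and one: "\<one>\<^bsub>B\<^esub> = f \<one>\<^bsub>H\<^esub>"
    and comult: "\<And>x. x \<in> vcarr H \<Longrightarrow> comult B (f x) = sweedler H x (\<lambda>x1 x2. f x1 \<otimes>\<^bsub>B,B\<^esub> f x2)"
    and counit: "\<And>x. x \<in> vcarr H \<Longrightarrow> counit B (f x) = counit H x"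
    and antipode: "\<And>x. x \<in> vcarr H \<Longrightarrow> antipode B (f x) = f (antipode H x)"
  shows "hopf_algebra B"
proof -
  note [simp] = linear_mapD(1)[OF f] f linear_map_comp[OF f]
  note [push] = linear_mapD(3)[OF f] linear_map_sweedler[OF f]
  note lin = linear_map_transport[OF f bij kspace]
  have B_ball: "(\<forall>y\<in>vcarr B. P y) \<longleftrightarrow> (\<forall>x\<in>vcarr H. P (f x))" for P
    unfolding bij_betw_imp_surj_on[OF bij, symmetric] by blast
  have mult_bil: "bilinear_map B B B (mult B)"
    unfolding bilinear_map_def B_ball by (intro conjI ballI lin)
      (simp_all add: mult linear_map_cong[OF kspace])
  have comult_lin: "linear_map B (tensor B B) (comult B)"
    by (rule lin) (simp add: comult linear_map_cong[OF kspace])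
  then have cospace [simp]: "cospace B" by (simp add: cospace_def)
  have counit_lin: "linear_map B base_field (counit B)"
    by (rule lin) (simp add: counit linear_map_cong[OF kspace])
  have antipode_lin: "linear_map B B (antipode B)"
    by (rule lin) (simp add: antipode linear_map_cong[OF kspace])
  note [simp] = bilinear_closed[OF mult_bil] bilinear_lin1[OF mult_bil] bilinear_lin2[OF mult_bil]
    bilinear_mapD(1)[OF mult_bil]
    linear_mapD(1)[OF counit_lin] counit_lin linear_map_comp[OF counit_lin]
    linear_mapD(1)[OF antipode_lin] antipode_lin linear_map_comp[OF antipode_lin]
  have "unital_algebra B"
    unfolding unital_algebra_def B_ball using mult_bil by (simp add: one mult push)
  moreover have "coalg B"
    unfolding counital_coalgebra_def B_ball using comult_lin
    by (simp add: sweedler_transport[where A=H and B=B and f=f and U="tensor B (tensor B B)"]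
      sweedler_transport[where A=H and B=B and f=f and U=B] sw[where U="tensor B (tensor B B)"]
      sw[where U=B] counit comult)
  moreover have "counit_algebra_map B"
    unfolding counit_algebra_map_def B_ball by (simp add: counit mult one push)
  moreover have "comult B \<one>\<^bsub>B\<^esub> = \<one>\<^bsub>B\<^esub> \<otimes>\<^bsub>B,B\<^esub> \<one>\<^bsub>B\<^esub>"
    by (simp add: one comult sw[where U="tensor B B"])
  moreover have "\<forall>x\<in>vcarr B. \<forall>y\<in>vcarr B. comult B (x \<cdot>\<^bsub>B\<^esub> y) =
        sweedler B x (\<lambda>x1 x2. sweedler B y (\<lambda>y1 y2. (x1 \<cdot>\<^bsub>B\<^esub> y1) \<otimes>\<^bsub>B,B\<^esub> (x2 \<cdot>\<^bsub>B\<^esub> y2)))"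
    unfolding B_ball by (simp add: comult mult sweedler_transport[where A=H and B=B and f=f and
      U="tensor B B"] sw[where U="tensor B B"])
  moreover have "antipode_axioms B"
    unfolding antipode_axioms_def B_ball using antipode_lin
    by (simp add: sweedler_transport[where A=H and B=B and f=f and U=B]
      comult antipode mult counit one linear_map_sweedler[OF f, symmetric]
      antipode_left antipode_right linear_mapD(3)[OF f])
  ultimately show ?thesis by (simp add: hopf_algebra_def)
qed

section \<open>\<open>K\<close> as a Yetter-Drinfeld module\<close>

context split_matched_pair begin

abbreviation "L \<equiv> K_pi K l \<pi>"
abbreviation "Cd \<equiv> Coad_pi H K \<pi>"
abbreviation "M \<equiv> yd_object L l Cd"
abbreviation "MM \<equiv> yd_tensor H M M"
abbreviation "B \<equiv> biproduct H L l Cd"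

lemma K_pi_carr: "vcarr L = vcarr K" "vscale L = vscale K" by (simp_all add: K_pi_def)
lemmas [simp] = K_pi_carr same_vspace[OF K_pi_carr]
lemma yd_object_carr: "vcarr M = vcarr K" "vscale M = vscale K" by (simp_all add: yd_object_def)
lemmas [simp] = yd_object_carr same_vspace[OF yd_object_carr]
lemma yd_tensor_carr: "vcarr MM = vcarr (tensor K K)" "vscale MM = vscale (tensor K K)"
  by (simp_all add: yd_tensor_def)
lemmas [simp] = yd_tensor_carr same_vspace[OF yd_tensor_carr]
lemma yd_unit_carr: "vcarr (yd_unit H) = vcarr base_field" "vscale (yd_unit H) = vscale base_field"
  by (simp_all add: yd_unit_def base_field_def)
lemmas [simp] = yd_unit_carr same_vspace[OF yd_unit_carr]
lemma biproduct_carr: "vcarr B = vcarr T" "vscale B = vscale T" by (simp_all add: biproduct_def)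
lemmas [simp] = biproduct_carr same_vspace[OF biproduct_carr]

lemma K_pi_simps [simp]: "one L = one K" "comult L = comult K" "counit L = counit K" "antipode L =
  Spi"
  by (simp_all add: K_pi_def fun_eq_iff Spi_def)

lemma sweedler_L [simp]: "sweedler L = sweedler K"
  by (simp add: sweedler_def fun_eq_iff cong del: tlift_cong)

lemma mult_L [simp]: "a \<in> vcarr K \<Longrightarrow> mult L a b = pmult a b"
  by (simp add: K_pi_def pmult_def pi_antipode)

lemma Cd_eq [simp]: "a \<in> vcarr K \<Longrightarrow> Cd a = coad a"
  by (simp add: Coad_pi_def sweedler3_def coad_def push sw_pi_rules[where U="tensor H K"])

lemma yd_object_simps [simp]: "act M = l" "coact M = Cd" by (simp_all add: yd_object_def)

lemma yd_tensor_simps: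
  "act MM x t = tlift K K t (\<lambda>m n. sweedler H x (\<lambda>x1 x2. l x1 m \<otimes>\<^bsub>K,K\<^esub> l x2 n))"
  "coact MM t = tlift K K t (\<lambda>m n. tlift H K (Cd m) (\<lambda>h m0. tlift H K (Cd n) (\<lambda>g n0.
          (h \<cdot>\<^bsub>H\<^esub> g) \<otimes>\<^bsub>H,tensor K K\<^esub> (m0 \<otimes>\<^bsub>K,K\<^esub> n0))))"
  by (simp_all add: yd_tensor_def cong del: tlift_cong sweedler_cong)

lemma yd_unit_simps:
  "act (yd_unit H) x c = counit H x * c" "coact (yd_unit H) c = \<one>\<^bsub>H\<^esub> \<otimes>\<^bsub>H,base_field\<^esub> c"
  by (simp_all add: yd_unit_def)

lemma yd_module_M: "yd_module H M"
proof -
  have "left_action H K l" using mp by (simp add: matched_pair_def)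
  then have "left_action H M l" by (simp add: left_action_def)
  moreover have "linear_map K (tensor H K) Cd" by (simp add: linear_map_cong[of K Cd coad])
  ultimately show ?thesis
    by (simp add: yd_module_def left_coaction_def cong del: tlift_cong sweedler_cong)
      (simp add: coad_coassoc coad_counit coad_l)
qed

lemma unital_L: "unital_algebra L"
  using bilinear_map_cong[of K K "mult L" pmult K]
  by (simp add: unital_algebra_def pmult_assoc pmult_one pmult_bil cong del: tlift_cong
    sweedler_cong)

lemma coalg_L: "coalg L"
  using K.coalg by (simp add: counital_coalgebra_def cong del: tlift_cong sweedler_cong)

section \<open>The structure maps as Yetter-Drinfeld morphisms\<close>

lemma mult_act:
  assumes [simp]: "x \<in> vcarr H"
  shows "\<forall>t\<in>vcarr (tensor K K). tlift K K (tlift K K t (\<lambda>m n. sweedler H x (\<lambda>x1 x2.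
    l x1 m \<otimes>\<^bsub>K,K\<^esub> l x2 n))) pmult = l x (tlift K K t pmult)"
  by (rule tensor_ball[where U=K]) (simp_all add: tlift_simps[where U=K]
    tlift_pure[where U="tensor K K"] l_pmult pmult_bil)

lemma mult_coact:
  "\<forall>t\<in>vcarr (tensor K K). coad (tlift K K t pmult) = tlift H (tensor K K) (tlift K K t (\<lambda>m n.
    tlift H K (coad m) (\<lambda>h m0. tlift H K (coad n) (\<lambda>g n0.
          (h \<cdot>\<^bsub>H\<^esub> g) \<otimes>\<^bsub>H,tensor K K\<^esub> (m0 \<otimes>\<^bsub>K,K\<^esub> n0))))) (\<lambda>h n. h \<otimes>\<^bsub>H,K\<^esub> tlift K K n pmult)"
  by (rule tensor_ball[where U="tensor H K"])
   (simp_all add: tlift_simps[where U="tensor H K"] tlift_pure[where U="tensor H (tensor K K)"]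
     tlift_pure[where U=K] coad_pmult pmult_bil)

lemma mult_morph: "yd_morphism H MM M (\<lambda>t. tlift L L t (mult L))"
proof -
  \<comment> \<open>\<open>mult_L\<close> is available on the carrier, so the product is replaced
    under the lift.\<close>
  have e: "tlift K K t (mult L) = tlift K K t pmult" if "t \<in> vcarr (tensor K K)" for t
    using that by (intro tlift_cong refl) simp_all
  have "linear_map (tensor K K) K (\<lambda>t. tlift K K t (mult L))"
    by (subst linear_map_cong[of _ _ "\<lambda>t. tlift K K t pmult"]) (simp_all add: e pmult_bil)
  then show ?thesis
    by (simp add: yd_morphism_def yd_tensor_simps cong del: tlift_cong sweedler_cong)
      (simp add: e mult_act mult_coact)
qed

lemma unit_morph: "yd_morphism H (yd_unit H) M (\<lambda>c. vscale L c \<one>\<^bsub>L\<^esub>)"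
proof -
  have "coad \<one>\<^bsub>K\<^esub> = \<one>\<^bsub>H\<^esub> \<otimes>\<^bsub>H,K\<^esub> \<one>\<^bsub>K\<^esub>"
    by (simp add: coad_def push sw_pi_rules[where U="tensor H K"])
  then show ?thesis
    by (simp add: yd_morphism_def yd_unit_simps cong del: tlift_cong sweedler_cong)
      (simp add: push tlift_pure[where U="tensor H K"])
qed

lemma comult_morph: "yd_morphism H M MM (comult L)"
proof -
  have "comult K (l x m) = tlift K K (comult K m) (\<lambda>m n. sweedler H x (\<lambda>x1 x2.
    l x1 m \<otimes>\<^bsub>K,K\<^esub> l x2 n))"
    if [simp]: "x \<in> vcarr H" "m \<in> vcarr K" for x m
    by (simp add: comult_sweedler[of K "l x m"] sweedler_def[of K m, symmetric]
      sw[where U="tensor K K"] push)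
  moreover have "tlift K K (comult K m) (\<lambda>m n. tlift H K (coad m) (\<lambda>h m0. tlift H K (coad n) (\<lambda>g n0.
          (h \<cdot>\<^bsub>H\<^esub> g) \<otimes>\<^bsub>H,tensor K K\<^esub> (m0 \<otimes>\<^bsub>K,K\<^esub> n0)))) = tlift H K (coad m) (\<lambda>h n.
            h \<otimes>\<^bsub>H,tensor K K\<^esub> comult K n)"
    if [simp]: "m \<in> vcarr K" for m
    unfolding coad_comult[OF that, symmetric] by (simp add: sweedler_def)
  moreover note cospaceD(2)[OF K.cospace]
  ultimately show ?thesis
    by (simp add: yd_morphism_def yd_tensor_simps cong del: tlift_cong sweedler_cong)
      (simp add: comult_in)
qed

lemma counit_morph: "yd_morphism H M (yd_unit H) (counit L)"
  by (simp add: yd_morphism_def yd_unit_simps cong del: tlift_cong sweedler_cong)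
    (simp add: coad_counit_morph counit_l)

lemma antipode_morph: "yd_morphism H M M (antipode L)"
  by (simp add: yd_morphism_def cong del: tlift_cong sweedler_cong) (simp add: Spi_l coad_Spi)

lemma braided: "braided_hopf_algebra H L l Cd"
proof -
  have "comult K \<one>\<^bsub>K\<^esub> = \<one>\<^bsub>K\<^esub> \<otimes>\<^bsub>K,K\<^esub> \<one>\<^bsub>K\<^esub>" using K.hopf by (simp add: hopf_algebra_def)
  then show ?thesis
    using mult_morph unit_morph comult_morph counit_morph antipode_morph
    by (simp add: braided_hopf_algebra_def yd_module_M unital_L coalg_L
        Let_def counit_algebra_map_def antipode_axioms_def cong del: tlift_cong sweedler_cong)
     (simp add: counit_pmult K.counit_one comult_sweedler[of K "pmult _ _"]
       comult_pmult pmult_Spi_left pmult_Spi_right)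
qed

end

section \<open>The isomorphism with the biproduct\<close>

context split_matched_pair begin

text \<open>Here and in \<open>bcomult\<close> and \<open>bantipode\<close>, the biproduct's
  operations are restated with \<open>pmult\<close>, \<open>coad\<close> and \<open>Spi\<close>, for
  which the calculation rules hold.\<close>

definition bmult where "bmult s t = tlift K H s (\<lambda>a x. tlift K H t (\<lambda>b y.
       sweedler H x (\<lambda>x1 x2. pmult a (l x1 b) \<otimes>\<^bsub>K,H\<^esub> (x2 \<cdot>\<^bsub>H\<^esub> y))))"

lemma bmult_bil: "bilinear_map T T T bmult"
  unfolding bmult_def[abs_def] by simp

lemmas [simp] = bilinear_closed[OF bmult_bil] bilinear_lin1[OF bmult_bil]
  bilinear_lin2[OF bmult_bil] bilinear_mapD(1)[OF bmult_bil]
lemmas [push] = bilinear_sweedler1[OF bmult_bil] bilinear_sweedler2[OF bmult_bil]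
  bilinear_scale1[OF bmult_bil] bilinear_scale2[OF bmult_bil]

lemma bmult_pure [push]:
  assumes [simp]: "a \<in> vcarr K" "b \<in> vcarr K" "x \<in> vcarr H" "y \<in> vcarr H"
  shows "bmult (a \<otimes>\<^bsub>K,H\<^esub> x) (b \<otimes>\<^bsub>K,H\<^esub> y) =
    sweedler H x (\<lambda>x1 x2. pmult a (l x1 b) \<otimes>\<^bsub>K,H\<^esub> (x2 \<cdot>\<^bsub>H\<^esub> y))"
  by (simp add: bmult_def tlift_pure[where U=T])

lemma mult_B: "s \<in> vcarr T \<Longrightarrow> t \<in> vcarr T \<Longrightarrow> mult B s t = bmult s t"
  by (simp add: biproduct_def biproduct_mult_def bmult_def cong del: tlift_cong sweedler_cong) simp

section \<open>The linear bijection \<open>\<beta>\<close>\<close>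

abbreviation "\<beta> \<equiv> beta H K \<pi>"

lemma beta_lin: "linear_map T T \<beta>"
  unfolding beta_def[abs_def] by simp

lemmas [simp] = linear_mapD(1)[OF beta_lin] beta_lin linear_map_comp[OF beta_lin]
lemmas [push] = linear_mapD(3)[OF beta_lin] linear_map_sweedler[OF beta_lin]

lemma beta_pure [push]:
  assumes [simp]: "a \<in> vcarr K" "x \<in> vcarr H"
  shows "\<beta> (a \<otimes>\<^bsub>K,H\<^esub> x) = sweedler K a (\<lambda>a1 a2. a1 \<otimes>\<^bsub>K,H\<^esub> (\<pi> a2 \<cdot>\<^bsub>H\<^esub> x))"
  by (simp add: beta_def tlift_pure[where U=T])

definition beta_inv where "beta_inv t =
     tlift K H t (\<lambda>a x. sweedler K a (\<lambda>a1 a2. a1 \<otimes>\<^bsub>K,H\<^esub> (antipode H (\<pi> a2) \<cdot>\<^bsub>H\<^esub> x)))"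

lemma beta_inv_lin: "linear_map T T beta_inv"
  unfolding beta_inv_def[abs_def] by simp

lemmas [simp] = linear_mapD(1)[OF beta_inv_lin] beta_inv_lin linear_map_comp[OF beta_inv_lin]
lemmas [push] = linear_mapD(3)[OF beta_inv_lin] linear_map_sweedler[OF beta_inv_lin]

lemma beta_inv_pure [push]:
  assumes [simp]: "a \<in> vcarr K" "x \<in> vcarr H"
  shows "beta_inv (a \<otimes>\<^bsub>K,H\<^esub> x) = sweedler K a (\<lambda>a1 a2. a1 \<otimes>\<^bsub>K,H\<^esub> (antipode H (\<pi> a2) \<cdot>\<^bsub>H\<^esub> x))"
  by (simp add: beta_inv_def tlift_pure[where U=T])

lemma beta_beta_inv: "\<forall>t\<in>vcarr T. \<beta> (beta_inv t) = t"
proof (rule T_ball[where U=T])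
  fix a x assume [simp]: "a \<in> vcarr K" "x \<in> vcarr H"
  have "\<beta> (beta_inv (a \<otimes>\<^bsub>K,H\<^esub> x)) = sweedler K a (\<lambda>a1 q. a1 \<otimes>\<^bsub>K,H\<^esub> (sweedler K q (\<lambda>a2 a3.
    \<pi> a2 \<cdot>\<^bsub>H\<^esub> antipode H (\<pi> a3)) \<cdot>\<^bsub>H\<^esub> x))"
    by (simp add: push sw_pi_rules[where U=T])
  also have "\<dots> = a \<otimes>\<^bsub>K,H\<^esub> x"
    by (simp add: spi_right) (simp add: push sw_pi_rules[where U=T])
  finally show "\<beta> (beta_inv (a \<otimes>\<^bsub>K,H\<^esub> x)) = a \<otimes>\<^bsub>K,H\<^esub> x" .
qed simp_all

lemma beta_inv_beta: "\<forall>t\<in>vcarr T. beta_inv (\<beta> t) = t"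
proof (rule T_ball[where U=T])
  fix a x assume [simp]: "a \<in> vcarr K" "x \<in> vcarr H"
  have "beta_inv (\<beta> (a \<otimes>\<^bsub>K,H\<^esub> x)) = sweedler K a (\<lambda>a1 q. a1 \<otimes>\<^bsub>K,H\<^esub> (sweedler K q (\<lambda>a2 a3.
    antipode H (\<pi> a2) \<cdot>\<^bsub>H\<^esub> \<pi> a3) \<cdot>\<^bsub>H\<^esub> x))"
    by (simp add: push sw_pi_rules[where U=T])
  also have "\<dots> = a \<otimes>\<^bsub>K,H\<^esub> x"
    by (simp add: spi_left) (simp add: push sw_pi_rules[where U=T])
  finally show "beta_inv (\<beta> (a \<otimes>\<^bsub>K,H\<^esub> x)) = a \<otimes>\<^bsub>K,H\<^esub> x" .
qed simp_all

lemma beta_bij: "bij_betw \<beta> (vcarr T) (vcarr T)"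
  by (rule bij_betw_byWitness[where f'=beta_inv]) (auto simp: beta_beta_inv beta_inv_beta)

section \<open>Compatibility of \<open>\<beta>\<close> with the structure maps\<close>

lemma beta_dm_pure:
  assumes [simp]: "a \<in> vcarr K" "b \<in> vcarr K" "x \<in> vcarr H" "y \<in> vcarr H"
  shows "\<beta> (dm (a \<otimes>\<^bsub>K,H\<^esub> x) (b \<otimes>\<^bsub>K,H\<^esub> y)) = bmult (\<beta> (a \<otimes>\<^bsub>K,H\<^esub> x)) (\<beta> (b \<otimes>\<^bsub>K,H\<^esub> y))"
proof -
  \<comment> \<open>Splitting off the \<open>\<pi>\<close>-part of the product produces exactly the
    right side of \<open>cross\<close>, through which the right action disappears.\<close>
  have "\<beta> (dm (a \<otimes>\<^bsub>K,H\<^esub> x) (b \<otimes>\<^bsub>K,H\<^esub> y)) =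
    sweedler K a (\<lambda>a1 a2. sweedler H x (\<lambda>x1 p. sweedler K b (\<lambda>b1 q. (a1 \<cdot>\<^bsub>K\<^esub> l x1 b1) \<otimes>\<^bsub>K,H\<^esub>
      (\<pi> a2 \<cdot>\<^bsub>H\<^esub> (sweedler H p (\<lambda>x2 x3. sweedler K q (\<lambda>b2 b3. \<pi> (l x2 b2) \<cdot>\<^bsub>H\<^esub> r x3 b3))
        \<cdot>\<^bsub>H\<^esub> y)))))"
    by (simp add: push sw_pi_rules[where U=T] exchange[of K b K])
  also have "\<dots> = sweedler K a (\<lambda>a1 a2. sweedler H x (\<lambda>x1 x2. sweedler K b (\<lambda>b1 b2.
    (a1 \<cdot>\<^bsub>K\<^esub> l x1 b1) \<otimes>\<^bsub>K,H\<^esub>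
      (\<pi> a2 \<cdot>\<^bsub>H\<^esub> ((x2 \<cdot>\<^bsub>H\<^esub> \<pi> b2) \<cdot>\<^bsub>H\<^esub> y)))))"
    by (simp add: cross[symmetric])
  \<comment> \<open>The trivial factor \<open>S\<pi>(a2) \<pi>(a3)\<close> is inserted: its first
    half turns the product of \<open>K\<close> into \<open>pmult\<close>, its second half belongs to
    the action of \<open>\<pi>(a3) x\<close>.\<close>
  also have "\<dots> = sweedler K a (\<lambda>a1 w. sweedler K w (\<lambda>p a4. sweedler H x (\<lambda>x1 x2.
    sweedler K b (\<lambda>b1 b2.
     (a1 \<cdot>\<^bsub>K\<^esub> l (sweedler K p (\<lambda>a2 a3. antipode H (\<pi> a2) \<cdot>\<^bsub>H\<^esub> \<pi> a3)) (l x1 b1)) \<otimes>\<^bsub>K,H\<^esub>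
      (\<pi> a4 \<cdot>\<^bsub>H\<^esub> ((x2 \<cdot>\<^bsub>H\<^esub> \<pi> b2) \<cdot>\<^bsub>H\<^esub> y))))))"
    by (simp add: spi_left) (simp add: push sw_pi_rules[where U=T])
  also have "\<dots> = bmult (\<beta> (a \<otimes>\<^bsub>K,H\<^esub> x)) (\<beta> (b \<otimes>\<^bsub>K,H\<^esub> y))"
    by (simp add: pmult_def push sw_pi_rules[where U=T] exchange[of K b K])
  finally show ?thesis .
qed

lemma beta_dm:
  assumes [simp]: "s \<in> vcarr T" "t \<in> vcarr T"
  shows "\<beta> (dm s t) = bmult (\<beta> s) (\<beta> t)"
proof -
  have 1: "\<forall>t\<in>vcarr T. \<beta> (dm (a \<otimes>\<^bsub>K,H\<^esub> x) t) = bmult (\<beta> (a \<otimes>\<^bsub>K,H\<^esub> x)) (\<beta> t)"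
    if [simp]: "a \<in> vcarr K" "x \<in> vcarr H" for a x
    by (rule T_ball[where U=T]) (simp_all add: beta_dm_pure)
  have 2: "\<forall>s\<in>vcarr T. \<beta> (dm s t) = bmult (\<beta> s) (\<beta> t)"
    by (rule T_ball[where U=T]) (simp_all add: 1)
  then show ?thesis by simp
qed

definition bcomult where "bcomult t = tlift K H t (\<lambda>a x.
        sweedler K a (\<lambda>a1 a2. tlift H K (coad a2) (\<lambda>h a0. sweedler H x (\<lambda>x1 x2.
          (a1 \<otimes>\<^bsub>K,H\<^esub> (h \<cdot>\<^bsub>H\<^esub> x1)) \<otimes>\<^bsub>T,T\<^esub> (a0 \<otimes>\<^bsub>K,H\<^esub> x2)))))"

lemma comult_B: "t \<in> vcarr T \<Longrightarrow> comult B t = bcomult t"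
proof -
  assume [simp]: "t \<in> vcarr T"
  have "comult B t = tlift K H t (\<lambda>a x.
        sweedler K a (\<lambda>a1 a2. tlift H K (Cd a2) (\<lambda>h a0. sweedler H x (\<lambda>x1 x2.
          (a1 \<otimes>\<^bsub>K,H\<^esub> (h \<cdot>\<^bsub>H\<^esub> x1)) \<otimes>\<^bsub>T,T\<^esub> (a0 \<otimes>\<^bsub>K,H\<^esub> x2)))))"
    by (simp add: biproduct_def cong del: tlift_cong sweedler_cong)
  also have "\<dots> = bcomult t" by (simp add: bcomult_def)
  finally show ?thesis .
qed

lemma bcomult_lin: "linear_map T (tensor T T) bcomult"
  unfolding bcomult_def[abs_def] by simp

lemmas [simp] = linear_mapD(1)[OF bcomult_lin] bcomult_lin linear_map_comp[OF bcomult_lin]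
lemmas [push] = linear_mapD(3)[OF bcomult_lin] linear_map_sweedler[OF bcomult_lin]

lemma bcomult_pure [push]:
  assumes [simp]: "a \<in> vcarr K" "x \<in> vcarr H"
  shows "bcomult (a \<otimes>\<^bsub>K,H\<^esub> x) = sweedler K a (\<lambda>a1 a2. tlift H K (coad a2) (\<lambda>h a0.
    sweedler H x (\<lambda>x1 x2.
          (a1 \<otimes>\<^bsub>K,H\<^esub> (h \<cdot>\<^bsub>H\<^esub> x1)) \<otimes>\<^bsub>T,T\<^esub> (a0 \<otimes>\<^bsub>K,H\<^esub> x2))))"
  by (simp add: bcomult_def tlift_pure[where U="tensor T T"])

lemma beta_comult: "\<forall>t\<in>vcarr T. bcomult (\<beta> t) = sweedler D t (\<lambda>t1 t2. \<beta> t1 \<otimes>\<^bsub>T,T\<^esub> \<beta> t2)"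
proof (rule T_ball[where U="tensor T T"])
  fix a x assume [simp]: "a \<in> vcarr K" "x \<in> vcarr H"
  \<comment> \<open>The coaction ends in \<open>S\<pi>(a4)\<close> and meets the factor
    \<open>\<pi>(a5)\<close> contributed by \<open>\<beta>\<close>.\<close>
  have "bcomult (\<beta> (a \<otimes>\<^bsub>K,H\<^esub> x)) = sweedler K a (\<lambda>a1 p. sweedler K p (\<lambda>a2 q. sweedler K q (\<lambda>a3 w.
    sweedler K w (\<lambda>z a6.
     sweedler H x (\<lambda>x1 x2.
      (a1 \<otimes>\<^bsub>K,H\<^esub> (\<pi> a2 \<cdot>\<^bsub>H\<^esub> (sweedler K z (\<lambda>a4 a5. antipode H (\<pi> a4) \<cdot>\<^bsub>H\<^esub> \<pi> a5) \<cdot>\<^bsub>H\<^esub> x1))) \<otimes>\<^bsub>T,T\<^esub>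
      (a3 \<otimes>\<^bsub>K,H\<^esub> (\<pi> a6 \<cdot>\<^bsub>H\<^esub> x2)))))))"
    by (simp add: tlift_coad[where U="tensor T T"] push sw_pi_rules[where U="tensor T T"])
  also have "\<dots> = sweedler D (a \<otimes>\<^bsub>K,H\<^esub> x) (\<lambda>t1 t2. \<beta> t1 \<otimes>\<^bsub>T,T\<^esub> \<beta> t2)"
    by (simp add: spi_left) (simp add: push sw_pi_rules[where U="tensor T T"]
      sw_D[where U="tensor T T"])
  finally show "bcomult (\<beta> (a \<otimes>\<^bsub>K,H\<^esub> x)) = sweedler D (a \<otimes>\<^bsub>K,H\<^esub> x) (\<lambda>t1 t2. \<beta> t1 \<otimes>\<^bsub>T,T\<^esub> \<beta> t2)" .
qed simp_all

lemma beta_counit: "\<forall>t\<in>vcarr T. counit B (\<beta> t) = counit D t"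
proof -
  have e: "counit B = counit D"
    by (simp add: biproduct_def double_cross_product_def fun_eq_iff cong del: tlift_cong)
  show ?thesis unfolding e
  proof (rule T_ball[where U=base_field])
    fix a x assume [simp]: "a \<in> vcarr K" "x \<in> vcarr H"
    have "counit D (\<beta> (a \<otimes>\<^bsub>K,H\<^esub> x)) = sweedler K a (\<lambda>a1 a2. vscale base_field (counit K a1)
      (counit K a2 * counit H x))"
      by (simp add: push)
    also have "\<dots> = counit D (a \<otimes>\<^bsub>K,H\<^esub> x)"
      by (simp add: sw[where U=base_field]) (simp add: push)
    finally show "counit D (\<beta> (a \<otimes>\<^bsub>K,H\<^esub> x)) = counit D (a \<otimes>\<^bsub>K,H\<^esub> x)" .
  qed simp_all
qed

definition bantipode where "bantipode t = tlift K H t (\<lambda>a x. tlift H K (coad a) (\<lambda>h a0.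
   bmult (\<one>\<^bsub>K\<^esub> \<otimes>\<^bsub>K,H\<^esub> antipode H (h \<cdot>\<^bsub>H\<^esub> x)) (Spi a0 \<otimes>\<^bsub>K,H\<^esub> \<one>\<^bsub>H\<^esub>)))"

lemma antipode_B: "t \<in> vcarr T \<Longrightarrow> antipode B t = bantipode t"
proof -
  assume [simp]: "t \<in> vcarr T"
  have "antipode B t = tlift K H t (\<lambda>a x. tlift H K (Cd a) (\<lambda>h a0.
   mult B (\<one>\<^bsub>K\<^esub> \<otimes>\<^bsub>K,H\<^esub> antipode H (h \<cdot>\<^bsub>H\<^esub> x)) (Spi a0 \<otimes>\<^bsub>K,H\<^esub> \<one>\<^bsub>H\<^esub>)))"
    by (simp add: biproduct_def cong del: tlift_cong sweedler_cong)
  also have "\<dots> = bantipode t" by (simp add: bantipode_def mult_B)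
  finally show ?thesis .
qed

lemma bantipode_lin: "linear_map T T bantipode"
  unfolding bantipode_def[abs_def] by simp

lemmas [simp] = linear_mapD(1)[OF bantipode_lin] bantipode_lin linear_map_comp[OF bantipode_lin]
lemmas [push] = linear_mapD(3)[OF bantipode_lin] linear_map_sweedler[OF bantipode_lin]

lemma bantipode_pure [push]:
  assumes [simp]: "a \<in> vcarr K" "x \<in> vcarr H"
  shows "bantipode (a \<otimes>\<^bsub>K,H\<^esub> x) = tlift H K (coad a) (\<lambda>h a0.
   bmult (\<one>\<^bsub>K\<^esub> \<otimes>\<^bsub>K,H\<^esub> antipode H (h \<cdot>\<^bsub>H\<^esub> x)) (Spi a0 \<otimes>\<^bsub>K,H\<^esub> \<one>\<^bsub>H\<^esub>))"
  by (simp add: bantipode_def tlift_pure[where U=T])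

text \<open>Two pairs cancel in Radford's formula: the end of the coaction against the
  \<open>\<pi>\<close> of \<open>\<beta>\<close>, and then \<open>S\<pi>(a2)\<close> against the
  \<open>\<pi>(a3)\<close> of \<open>Spi\<close>. What remains is the product of the images of
  \<open>1 \<otimes> S(x)\<close> and \<open>S(a) \<otimes> 1\<close>, the image of
  \<open>SD\<close> by \<open>beta_dm\<close>.\<close>

lemma beta_antipode: "\<forall>t\<in>vcarr T. bantipode (\<beta> t) = \<beta> (SD t)"
proof (rule T_ball[where U=T])
  fix a x assume [simp]: "a \<in> vcarr K" "x \<in> vcarr H"
  \<comment> \<open>The product \<open>bmult\<close> stays unexpanded until the first pair has
    cancelled.\<close>
  have "bantipode (\<beta> (a \<otimes>\<^bsub>K,H\<^esub> x)) = sweedler K a (\<lambda>a1 q. sweedler K q (\<lambda>a2 w.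
     bmult (\<one>\<^bsub>K\<^esub> \<otimes>\<^bsub>K,H\<^esub> antipode H (\<pi> a1 \<cdot>\<^bsub>H\<^esub> (sweedler K w (\<lambda>a3 a4. antipode H (\<pi> a3) \<cdot>\<^bsub>H\<^esub> \<pi> a4)
       \<cdot>\<^bsub>H\<^esub> x))) (Spi a2 \<otimes>\<^bsub>K,H\<^esub> \<one>\<^bsub>H\<^esub>)))"
    by (simp add: tlift_coad[where U=T] push sw_pi_rules[where U=T] del: bmult_pure)
  also have "\<dots> = sweedler K a (\<lambda>a1 q. sweedler K q (\<lambda>w a4. sweedler K w (\<lambda>a2 a3.
    sweedler H x (\<lambda>x1 x2.
     l (antipode H x2) (l (antipode H (\<pi> a2) \<cdot>\<^bsub>H\<^esub> \<pi> a3) (antipode K a4))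
       \<otimes>\<^bsub>K,H\<^esub> (antipode H x1 \<cdot>\<^bsub>H\<^esub> antipode H (\<pi> a1))))))"
    by (simp add: spi_left) (simp add: pmult_one Spi_def push sw_pi_rules[where U=T])
  also have "\<dots> = sweedler K a (\<lambda>a1 q. sweedler K q (\<lambda>w a4. sweedler H x (\<lambda>x1 x2.
     l (antipode H x2) (l (sweedler K w (\<lambda>a2 a3. antipode H (\<pi> a2) \<cdot>\<^bsub>H\<^esub> \<pi> a3)) (antipode K a4))
       \<otimes>\<^bsub>K,H\<^esub> (antipode H x1 \<cdot>\<^bsub>H\<^esub> antipode H (\<pi> a1)))))"
    by (simp add: push sw_pi_rules[where U=T])
  also have "\<dots> = \<beta> (SD (a \<otimes>\<^bsub>K,H\<^esub> x))"
    by (simp add: spi_left SD_pure beta_dm) (simp add: pmult_one push sw_pi_rules[where U=T])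
  finally show "bantipode (\<beta> (a \<otimes>\<^bsub>K,H\<^esub> x)) = \<beta> (SD (a \<otimes>\<^bsub>K,H\<^esub> x))" .
qed simp_all

lemma beta_one: "\<one>\<^bsub>B\<^esub> = \<beta> (\<one>\<^bsub>K\<^esub> \<otimes>\<^bsub>K,H\<^esub> \<one>\<^bsub>H\<^esub>)"
  by (simp add: biproduct_def push sw_pi_rules[where U=T])

lemma hopf_B: "hopf_algebra B"
proof -
  interpret D: hopf D by unfold_locales (rule hopf_D)
  show ?thesis
    by (rule D.hopf_transport[where f=\<beta>])
     (simp_all add: beta_bij mult_B beta_dm beta_one[unfolded K_pi_simps]
       comult_B beta_comult beta_counit antipode_B beta_antipode)
qed

lemma iso: "hopf_iso D B \<beta>"
  using hopf_D hopf_B beta_bij beta_one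
  by (simp add: hopf_iso_def hopf_hom_def beta_dm mult_B comult_B beta_comult beta_counit)

end

section \<open>From the projection to the relations for \<pi>\<close>

theorem theorem3p7:
  fixes H :: "('k::field, 'h::ab_group_add) hopf"
    and K :: "('k, 'a::ab_group_add) hopf"
    and l :: "'h \<Rightarrow> 'a \<Rightarrow> 'a"
    and r :: "'h \<Rightarrow> 'a \<Rightarrow> 'h"
    and \<theta> :: "('k, 'a, 'h) tensor \<Rightarrow> 'h"
    and \<pi> :: "'a \<Rightarrow> 'h"
  assumes "matched_pair H K l r"
    and "hopf_hom (double_cross_product H K l r) H \<theta>"
    and "\<forall>x\<in>vcarr H. \<theta> (incl_H H K x) = x"
    and "\<pi> = (\<lambda>a. \<theta> (incl_K H K a))"
  shows "braided_hopf_algebra H (K_pi K l \<pi>) l (Coad_pi H K \<pi>) \<and>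
         hopf_iso (double_cross_product H K l r)
                  (biproduct H (K_pi K l \<pi>) l (Coad_pi H K \<pi>))
                  (beta H K \<pi>)"
proof -
  have "hopf_algebra H" "hopf_algebra K" using assms(1) by (auto simp: matched_pair_def)
  then interpret matched_hopf_pair H K l r
    by (intro matched_hopf_pair.intro hopf.intro matched_hopf_pair_axioms.intro assms(1))
  have th: "linear_map T H \<theta>" "\<And>s t. s \<in> vcarr T \<Longrightarrow> t \<in> vcarr T \<Longrightarrow> \<theta> (dm s t) = \<theta> s \<cdot>\<^bsub>H\<^esub> \<theta> t"
    "\<theta> (\<one>\<^bsub>K\<^esub> \<otimes>\<^bsub>K,H\<^esub> \<one>\<^bsub>H\<^esub>) = \<one>\<^bsub>H\<^esub>"
    "\<And>t. t \<in> vcarr T \<Longrightarrow> comult H (\<theta> t) = sweedler D t (\<lambda>t1 t2. \<theta> t1 \<otimes>\<^bsub>H,H\<^esub> \<theta> t2)"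
    "\<And>t. t \<in> vcarr T \<Longrightarrow> counit H (\<theta> t) = counit D t"
    using assms(2) by (simp_all add: hopf_hom_def)
  have thH: "\<theta> (\<one>\<^bsub>K\<^esub> \<otimes>\<^bsub>K,H\<^esub> x) = x" if "x \<in> vcarr H" for x
    using assms(3) that by (simp add: incl_H_def)
  have p: "\<pi> a = \<theta> (a \<otimes>\<^bsub>K,H\<^esub> \<one>\<^bsub>H\<^esub>)" for a by (simp add: assms(4) incl_K_def)
  note [simp] = linear_mapD(1)[OF th(1)] th(1) linear_map_comp[OF th(1)]
  note thp = linear_map_sweedler[OF th(1)]
  have thKH: "\<theta> (a \<otimes>\<^bsub>K,H\<^esub> x) = \<pi> a \<cdot>\<^bsub>H\<^esub> x" if [simp]: "a \<in> vcarr K" "x \<in> vcarr H" for a x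
    using th(2)[of "a \<otimes>\<^bsub>K,H\<^esub> \<one>\<^bsub>H\<^esub>" "\<one>\<^bsub>K\<^esub> \<otimes>\<^bsub>K,H\<^esub> x"] by (simp add: dm_KH thH p)
  \<comment> \<open>The inclusion of \<open>K\<close> respects products, units, coproducts and
    counits, so \<open>\<pi>\<close> inherits these properties from \<open>\<theta>\<close>;
    \<open>cross\<close> comes from applying \<open>\<theta>\<close> to the product of
    \<open>1 \<otimes> x\<close> and \<open>a \<otimes> 1\<close>.\<close>
  have "split_matched_pair_axioms H K l r \<pi>"
  proof
    show "linear_map K H \<pi>" unfolding p by simp
    show "\<pi> \<one>\<^bsub>K\<^esub> = \<one>\<^bsub>H\<^esub>" by (simp add: p th)
    fix a assume [simp]: "a \<in> vcarr K"
    show "\<pi> (a \<cdot>\<^bsub>K\<^esub> b) = \<pi> a \<cdot>\<^bsub>H\<^esub> \<pi> b" if [simp]: "b \<in> vcarr K" for b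
      using th(2)[of "a \<otimes>\<^bsub>K,H\<^esub> \<one>\<^bsub>H\<^esub>" "b \<otimes>\<^bsub>K,H\<^esub> \<one>\<^bsub>H\<^esub>"] by (simp add: dm_KK p)
    show "comult H (\<pi> a) = sweedler K a (\<lambda>a1 a2. \<pi> a1 \<otimes>\<^bsub>H,H\<^esub> \<pi> a2)"
      by (simp add: p th sw_D[where U="tensor H H"] H.sw_one[where U="tensor H H"])
    show "counit H (\<pi> a) = counit K a"
      by (simp add: p th push)
    show "x \<cdot>\<^bsub>H\<^esub> \<pi> a = sweedler H x (\<lambda>x1 x2. sweedler K a (\<lambda>a1 a2. \<pi> (l x1 a1) \<cdot>\<^bsub>H\<^esub> r x2 a2))"
      if [simp]: "x \<in> vcarr H" for x
    proof -
      have "x \<cdot>\<^bsub>H\<^esub> \<pi> a = \<theta> (dm (\<one>\<^bsub>K\<^esub> \<otimes>\<^bsub>K,H\<^esub> x) (a \<otimes>\<^bsub>K,H\<^esub> \<one>\<^bsub>H\<^esub>))"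
        by (simp add: th(2) thH p)
      also have "\<dots> = sweedler H x (\<lambda>x1 x2. sweedler K a (\<lambda>a1 a2. \<theta> (l x1 a1 \<otimes>\<^bsub>K,H\<^esub> r x2 a2)))"
        by (simp add: push thp)
      finally show ?thesis by (simp add: thKH)
    qed
  qed
  then interpret split_matched_pair H K l r \<pi> by (intro split_matched_pair.intro
    matched_hopf_pair_axioms)
  show ?thesis using braided iso by simp
qed

end
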